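(* Let $k>0$, $A\in\Lambda^{1}(U,\mathrm{End}(V))$ and $J_{e}\in\mathcal{E}^{k+1}(U,V)$. The unique solution $\phi\in\Lambda^{k}(U,V)\setminus\ker(A\wedge\_)$ of $$d^{\nabla}\phi=d\phi+A\wedge\phi=J_{e}$$ with $dH\phi=c\in\mathcal{E}(U,V)\setminus\ker(A\wedge\_)$ is $$\phi=\phi_{H}+\phi_{I},\qquad \phi_{I}=\sum_{l=0}^{\infty}(-1)^{l}(H(A\wedge\_))^{l}HJ_{e},$$ where $\phi_{H}=\sum_{l=0}^{\infty}(-1)^{l}(H(A\wedge\_))^{l}c$ is the solution of the homogeneous equation ($J_{e}=0$) with $dH\phi_H=c$. The series is convergent to the continuous solution in the ball $B(x_{0},r)$, where the radius is given by $r\,\frac{\|A\|_{\infty}}{k}=1$, the supremum norm being taken over the closed ball. When $HJ_{e}\in\mathcal{A}^{k}(U,V)\cap\ker(A\wedge\_)$, the solution reduces to $\phi=\phi_{H}+HJ_{e}$.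
   Context: $U\subset\mathbb{R}^{n}$ is a bounded open set, star-shaped with respect to a point $x_{0}\in U$; $V$ is a finite-dimensional real vector space with a chosen basis. $\Lambda^{k}(U,V)$ denotes $V$-valued differential $k$-forms on $U$. $A$ is a smooth $\mathrm{End}(V)$-valued one-form (assumed of constant rank), $A\wedge\_$ is the operator $\omega\mapsto A\wedge\omega$ on $V$-valued forms (matrix action combined with wedge), and $d^{\nabla}=d+A\wedge\_$. Solutions are in general only continuous forms with continuous exterior derivative. Homotopy operator: with $\mathcal{K}=(x-x_{0})^{i}\partial_{i}$, for a $k$-form $\omega$, $k\ge 1$, $(H\omega)(x)=\int_{0}^{1}\mathcal{K}(x)\lrcorner\,\omega|_{x_{0}+t(x-x_{0})}\,t^{k-1}\,dt$, and $H=0$ on $0$-forms; it acts componentwise on vector-valued forms. It satisfies $H^{2}=0$ and $dH+Hd=I-s_{x_0}^{*}$, where $s_{x_0}^{*}$ is evaluation at $x_{0}$ on $0$-forms and zero on forms of positive degree. $(H(A\wedge\_))^{l}$ is the $l$-fold composition of $\omega\mapsto H(A\wedge\omega)$, with $(H(A\wedge\_))^{0}=\mathrm{Id}$. $\mathcal{E}^{k}(U,V)$ is the space of exact (equivalently closed) $k$-forms; $\mathcal{A}^{k}(U,V)=\ker H$ in degree $k$ is the module of antiexact forms, $\{\omega : \mathcal{K}\lrcorner\omega=0,\ \omega|_{x=x_{0}}=0\}$. Norm: for $A=[A^{i}_{j,k}(x)\,dx^{k}]$, $\|A\|_{\infty}=\max_{i,j,k}\sup_{x}|A^{i}_{j,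k}(x)|$.
   Formalization: Existence is false in general (e.g. A=dx1, J_e=dx2∧dx3, c=dx2): it is proved that any solution is unique and equals the series on the ball, and that for C¹ data c, J_e the sum φ (likewise φ_H when J_e=0) has dHφ=c and solves the equation if and only if A∧φ is closed. *)

theory Defs
  imports "HOL-Analysis.Analysis"
begin

text \<open>
  A differential form on a subset of a space \<open>'a\<close> with values in \<open>'w\<close> is a function
  \<open>'a \<Rightarrow> 'a list \<Rightarrow> 'w\<close>: a base point and the list of tangent vectors that are plugged in.
  A form of degree \<open>k\<close> vanishes on lists of length other than \<open>k\<close>, so that forms can be
  compared as functions and the operators below need no degree argument.
\<close>

definition alternating_map :: "nat \<Rightarrow> ('a::real_vector list \<Rightarrow> 'w::real_vector) \<Rightarrow> bool" where
  "alternating_map k f \<longleftrightarrow>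
     (\<forall>vs. length vs \<noteq> k \<longrightarrow> f vs = 0) \<and>
     (\<forall>vs i. length vs = k \<longrightarrow> i < k \<longrightarrow> linear (\<lambda>v. f (vs[i := v]))) \<and>
     (\<forall>vs i j. length vs = k \<longrightarrow> i < j \<longrightarrow> j < k \<longrightarrow> vs ! i = vs ! j \<longrightarrow> f vs = 0)"

definition drop_nth :: "nat \<Rightarrow> 'a list \<Rightarrow> 'a list" where
  "drop_nth i vs = take i vs @ drop (Suc i) vs"

definition ext_deriv ::
  "('a::real_normed_vector \<Rightarrow> 'a list \<Rightarrow> 'w::real_normed_vector) \<Rightarrow> 'a \<Rightarrow> 'a list \<Rightarrow> 'w" where
  "ext_deriv \<omega> x vs =
     (\<Sum>i<length vs. (-1) ^ i *\<^sub>R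
        frechet_derivative (\<lambda>y. \<omega> y (drop_nth i vs)) (at x) (vs ! i))"

text \<open>Wedge product of an endomorphism-valued one-form with a vector-valued form.\<close>

definition wedge ::
  "('a \<Rightarrow> 'a list \<Rightarrow> 'w \<Rightarrow>\<^sub>L 'w) \<Rightarrow> ('a \<Rightarrow> 'a list \<Rightarrow> 'w::real_normed_vector)
     \<Rightarrow> 'a \<Rightarrow> 'a list \<Rightarrow> 'w" where
  "wedge A \<omega> x vs =
     (\<Sum>i<length vs. (-1) ^ i *\<^sub>R blinfun_apply (A x [vs ! i]) (\<omega> x (drop_nth i vs)))"

text \<open>
  If \<open>\<omega>\<close> has degree \<open>k \<ge> 1\<close>, then only lists \<open>ws\<close> of length \<open>k - 1\<close> contribute, hence the
  weight is \<open>t ^ (k - 1)\<close>. On forms of degree 0 the operator is zero.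
\<close>

definition homotopy_op ::
  "'a \<Rightarrow> ('a::real_vector \<Rightarrow> 'a list \<Rightarrow> 'w::real_normed_vector) \<Rightarrow> 'a \<Rightarrow> 'a list \<Rightarrow> 'w" where
  "homotopy_op x0 \<omega> x ws =
     integral {0..1::real}
       (\<lambda>t. t ^ length ws *\<^sub>R \<omega> (x0 + t *\<^sub>R (x - x0)) ((x - x0) # ws))"

text \<open>Intended for open \<open>S\<close> in a finite-dimensional space.\<close>

primrec Ck_on :: "nat \<Rightarrow> ('a::real_normed_vector \<Rightarrow> 'b::real_normed_vector) \<Rightarrow> 'a set \<Rightarrow> bool" where
  "Ck_on 0 f S \<longleftrightarrow> continuous_on S f"
| "Ck_on (Suc m) f S \<longleftrightarrow>
     f differentiable_on S \<and> (\<forall>v. Ck_on m (\<lambda>x. frechet_derivative f (at x) v) S)"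

definition Ck_form ::
  "nat \<Rightarrow> nat \<Rightarrow> 'a::real_normed_vector set \<Rightarrow> ('a \<Rightarrow> 'a list \<Rightarrow> 'w::real_normed_vector) \<Rightarrow> bool" where
  "Ck_form m k U \<omega> \<longleftrightarrow>
     (\<forall>x\<in>U. alternating_map k (\<omega> x)) \<and> (\<forall>vs. Ck_on m (\<lambda>x. \<omega> x vs) U)"

definition smooth_form ::
  "nat \<Rightarrow> 'a::real_normed_vector set \<Rightarrow> ('a \<Rightarrow> 'a list \<Rightarrow> 'w::real_normed_vector) \<Rightarrow> bool" where
  "smooth_form k U \<omega> \<longleftrightarrow> (\<forall>m. Ck_form m k U \<omega>)"

abbreviation continuous_form ::
  "nat \<Rightarrow> 'a::real_normed_vector set \<Rightarrow> ('a \<Rightarrow> 'a list \<Rightarrow> 'w::real_normed_vector) \<Rightarrow> bool" where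
  "continuous_form \<equiv> Ck_form 0"

definition differentiable_form ::
  "'a::real_normed_vector set \<Rightarrow> ('a \<Rightarrow> 'a list \<Rightarrow> 'w::real_normed_vector) \<Rightarrow> bool" where
  "differentiable_form U \<omega> \<longleftrightarrow> (\<forall>vs. (\<lambda>x. \<omega> x vs) differentiable_on U)"

text \<open>
  Continuous forms with continuous exterior derivative. The individual partial derivatives
  of the coefficients exist but need not be continuous; every smooth form belongs to this class.
\<close>

definition d_continuous_form ::
  "nat \<Rightarrow> 'a::real_normed_vector set \<Rightarrow> ('a \<Rightarrow> 'a list \<Rightarrow> 'w::real_normed_vector) \<Rightarrow> bool" where
  "d_continuous_form k U \<omega> \<longleftrightarrow>
     continuous_form k U \<omega> \<and> differentiable_form U \<omega> \<and> continuous_form (Suc k) U (ext_deriv \<omega>)"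

definition exact_form ::
  "nat \<Rightarrow> 'a::real_normed_vector set \<Rightarrow> ('a \<Rightarrow> 'a list \<Rightarrow> 'w::real_normed_vector) \<Rightarrow> bool" where
  "exact_form k U \<omega> \<longleftrightarrow>
     (\<exists>m \<beta>. k = Suc m \<and> d_continuous_form m U \<beta> \<and> (\<forall>x\<in>U. \<omega> x = ext_deriv \<beta> x))"

definition closed_form ::
  "'a::real_normed_vector set \<Rightarrow> ('a \<Rightarrow> 'a list \<Rightarrow> 'w::real_normed_vector) \<Rightarrow> bool" where
  "closed_form U \<omega> \<longleftrightarrow> differentiable_form U \<omega> \<and> (\<forall>x\<in>U. \<forall>vs. ext_deriv \<omega> x vs = 0)"

text \<open>The first equation says that the contraction with the radial field vanishes.\<close>

definition antiexact_form ::
  "'a \<Rightarrow> nat \<Rightarrow> 'a::real_normed_vector set \<Rightarrow> ('a \<Rightarrow> 'a list \<Rightarrow> 'w::real_normed_vector) \<Rightarrow> bool" where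
  "antiexact_form x0 k U \<omega> \<longleftrightarrow>
     continuous_form k U \<omega> \<and>
     (\<forall>x\<in>U. \<forall>ws. \<omega> x ((x - x0) # ws) = 0) \<and> (\<forall>vs. \<omega> x0 vs = 0)"

definition in_wedge_kernel ::
  "('a \<Rightarrow> 'a list \<Rightarrow> 'w \<Rightarrow>\<^sub>L 'w) \<Rightarrow> 'a set \<Rightarrow> ('a \<Rightarrow> 'a list \<Rightarrow> 'w::real_normed_vector) \<Rightarrow> bool" where
  "in_wedge_kernel A U \<omega> \<longleftrightarrow> (\<forall>x\<in>U. \<forall>vs. wedge A \<omega> x vs = 0)"

definition solves_covariant ::
  "('a \<Rightarrow> 'a list \<Rightarrow> 'w \<Rightarrow>\<^sub>L 'w) \<Rightarrow> ('a \<Rightarrow> 'a list \<Rightarrow> 'w) \<Rightarrow> nat \<Rightarrow> 'a set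
     \<Rightarrow> ('a::real_normed_vector \<Rightarrow> 'a list \<Rightarrow> 'w::real_normed_vector) \<Rightarrow> bool" where
  "solves_covariant A J k S \<phi> \<longleftrightarrow>
     d_continuous_form k S \<phi> \<and>
     (\<forall>x\<in>S. \<forall>vs. ext_deriv \<phi> x vs + wedge A \<phi> x vs = J x vs)"

definition dH_equals ::
  "'a \<Rightarrow> ('a \<Rightarrow> 'a list \<Rightarrow> 'w) \<Rightarrow> 'a set
     \<Rightarrow> ('a::real_normed_vector \<Rightarrow> 'a list \<Rightarrow> 'w::real_normed_vector) \<Rightarrow> bool" where
  "dH_equals x0 c S \<phi> \<longleftrightarrow>
     differentiable_form S (homotopy_op x0 \<phi>) \<and>
     (\<forall>x\<in>S. \<forall>vs. ext_deriv (homotopy_op x0 \<phi>) x vs = c x vs)"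

definition series_term ::
  "'a \<Rightarrow> ('a \<Rightarrow> 'a list \<Rightarrow> 'w \<Rightarrow>\<^sub>L 'w) \<Rightarrow> ('a \<Rightarrow> 'a list \<Rightarrow> 'w) \<Rightarrow> nat
     \<Rightarrow> 'a::real_normed_vector \<Rightarrow> 'a list \<Rightarrow> 'w::real_normed_vector" where
  "series_term x0 A \<eta> l x vs =
     (-1) ^ l *\<^sub>R ((\<lambda>\<omega>. homotopy_op x0 (wedge A \<omega>)) ^^ l) \<eta> x vs"

definition series_sum ::
  "'a \<Rightarrow> ('a \<Rightarrow> 'a list \<Rightarrow> 'w \<Rightarrow>\<^sub>L 'w) \<Rightarrow> ('a \<Rightarrow> 'a list \<Rightarrow> 'w)
     \<Rightarrow> 'a::real_normed_vector \<Rightarrow> 'a list \<Rightarrow> 'w::real_normed_vector" where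
  "series_sum x0 A \<eta> x vs = (\<Sum>l. series_term x0 A \<eta> l x vs)"

definition series_converges ::
  "'a \<Rightarrow> ('a \<Rightarrow> 'a list \<Rightarrow> 'w \<Rightarrow>\<^sub>L 'w) \<Rightarrow> ('a \<Rightarrow> 'a list \<Rightarrow> 'w) \<Rightarrow> 'a set
     \<Rightarrow> ('a::real_normed_vector \<Rightarrow> 'a list \<Rightarrow> 'w::real_normed_vector) \<Rightarrow> bool" where
  "series_converges x0 A \<eta> S \<phi> \<longleftrightarrow>
     (\<forall>x\<in>S. \<forall>vs. (\<lambda>l. series_term x0 A \<eta> l x vs) sums \<phi> x vs) \<and>
     (\<forall>K vs. compact K \<longrightarrow> K \<subseteq> S \<longrightarrow>
        uniform_limit K (\<lambda>N x. \<Sum>l<N. series_term x0 A \<eta> l x vs) (\<lambda>x. \<phi> x vs) sequentially)"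

text \<open>
  The largest supremum over \<open>S\<close> of a coefficient of \<open>A\<close>; extended-real valued because
  a coefficient may be unbounded on \<open>S\<close>.
\<close>

definition coeff_sup_norm ::
  "(real ^ 'n \<Rightarrow> (real ^ 'n) list \<Rightarrow> 'v \<Rightarrow>\<^sub>L 'v::euclidean_space) \<Rightarrow> (real ^ 'n) set \<Rightarrow> ereal" where
  "coeff_sup_norm A S =
     Max ((\<lambda>(i, j, l). SUP x\<in>S. ereal \<bar>blinfun_apply (A x [axis l 1]) j \<bullet> i\<bar>)
            ` (Basis \<times> Basis \<times> UNIV))"

end

theory Submission
  imports Defs
begin

text \<open>
  The covariant equation leads to a Volterra equation along the rays from \<open>x0\<close>. The homotopy
  formula \<open>\<psi> = d H \<psi> + H d \<psi>\<close> turns \<open>d \<psi> + A \<and> \<psi> = J\<close> with \<open>d H \<psi> = c\<close> into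
  \<open>\<psi> = (c + H J) - H (A \<and> \<psi>)\<close> (\<open>solution_integral_equation\<close>), and the alternating series in
  \<open>H (A \<and> _)\<close> is the Neumann series of this equation.

  The operator \<open>\<omega> \<mapsto> H (A \<and> \<omega>)\<close> integrates along rays over a length \<open>\<rho> = |x - x0|\<close>. In the
  weighted norm with weight \<open>exp (\<mu> \<rho>)\<close> its norm is of order \<open>1 / \<mu>\<close> on every compact set
  that is star-shaped about \<open>x0\<close>, so for large \<open>\<mu>\<close> it is a contraction
  (\<open>volterra_weight_bound\<close>). This yields locally uniform convergence of the series
  (\<open>picard_uniform_limit\<close>), that its sum solves the integral equation (\<open>picard_fixpoint\<close>),
  and uniqueness (\<open>volterra_unique\<close>). If the data are continuously differentiable, the
  differentiated series converges as well, and the sum is differentiable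
  (\<open>picard_differentiable\<close>). The sum then solves the covariant equation exactly
  if \<open>A \<and> \<phi>\<close> is closed (\<open>volterra_solution_iff\<close>). When \<open>A \<and> H J = 0\<close>, all terms of the
  second series but the first vanish.

  The delicate point is regularity. A solution has a continuous exterior derivative, but
  its partial derivatives need not be continuous, so neither differentiation under the
  integral nor equality of mixed second derivatives is available. Both the homotopy formula
  (\<open>homotopy_formula\<close>) and \<open>d d = 0\<close> (\<open>ext_deriv_exact_zero\<close>) are therefore derived from a
  divergence theorem in the style of Goursat (\<open>divergence_theorem_box\<close>): for a
  differentiable field with continuous divergence, bisection of a box shows that the flux
  equals the integral of the divergence. Applied to boxes that shrink to a point, it gives
  the pointwise identities.
\<close>

section \<open>Averages and fluxes over parallelepipeds\<close>

lemma integral_eq_zeroI: "(\<And>t. t \<in> T \<Longrightarrow> f t = 0) \<Longrightarrow> integral T f = 0"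
  using integral_cong[of T f "\<lambda>_. 0"] by simp

lemma integral_unit_interval_near:
  fixes g :: "real \<Rightarrow> 'w::banach"
  assumes "continuous_on {0..1} g" "\<And>t. t \<in> {0..1} \<Longrightarrow> norm (g t - c) \<le> e"
  shows "norm (integral {0..1} g - c) \<le> e"
proof -
  have i: "g integrable_on {0..1}" using assms(1) integrable_continuous_real by blast
  have "integral {0..1} g - c = integral {0..1} (\<lambda>t. g t - c)"
    by (subst integral_diff) (auto simp: i)
  moreover have "norm (integral {0..1} (\<lambda>t. g t - c)) \<le> e * (1 - 0)"
    by (rule integral_bound) (auto intro!: continuous_intros assms)
  ultimately show ?thesis by simp
qed

lemma integral_unit_interval_halve:
  fixes g :: "real \<Rightarrow> 'w::banach"
  assumes "continuous_on {0..1} g"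
  shows "integral {0..1} g =
    (1/2) *\<^sub>R (integral {0..1} (\<lambda>t. g (t / 2)) + integral {0..1} (\<lambda>t. g (1/2 + t / 2)))"
proof -
  have gi: "g integrable_on {0..1}" using assms integrable_continuous_real by blast
  have "integral {0..1} g = integral {0..1/2} g + integral {1/2..1} g"
    using Henstock_Kurzweil_Integration.integral_combine[of 0 "1/2" 1 g] gi by simp
  moreover have "((\<lambda>t. g (t/2)) has_integral (integral {0..1/2} g /\<^sub>R (1/2))) {0..1}"
  proof -
    have "(g has_integral integral {0..1/2} g) (cbox 0 (1/2))"
      using integrable_on_subinterval[OF gi, of 0 "1/2"] by (auto simp: integrable_integral)
    from has_integral_affinity'[OF this, of "1/2" 0] show ?thesis by simp
  qed
  moreover have "((\<lambda>t. g (1/2 + t/2)) has_integral (integral {1/2..1} g /\<^sub>R (1/2))) {0..1}"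
  proof -
    have "(g has_integral integral {1/2..1} g) (cbox (1/2) 1)"
      using integrable_on_subinterval[OF gi, of "1/2" 1] by (auto simp: integrable_integral)
    from has_integral_affinity'[OF this, of "1/2" "1/2"] show ?thesis by (simp add: add.commute)
  qed
  ultimately show ?thesis by (simp add: integral_unique scaleR_add_right)
qed

text \<open>
  The parallelepiped with corner \<open>x\<close> and edges \<open>vs\<close>, which may be linearly dependent. The
  edges form a list because forms of variable degree are integrated over boxes, whose
  dimension therefore has to be a number and not a type.
\<close>

primrec pbox :: "'a::real_vector list \<Rightarrow> 'a \<Rightarrow> 'a set" where
  "pbox [] x = {x}"
| "pbox (v # vs) x = (\<Union>t\<in>{0..1::real}. pbox vs (x + t *\<^sub>R v))"

primrec box_avg :: "'a::real_normed_vector list \<Rightarrow> ('a \<Rightarrow> 'w::banach) \<Rightarrow> 'a \<Rightarrow> 'w" where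
  "box_avg [] f x = f x"
| "box_avg (v # vs) f x = integral {0..1} (\<lambda>t. box_avg vs f (x + t *\<^sub>R v))"

text \<open>
  The outward flux of a field whose \<open>i\<close>-th component is the coefficient of the \<open>i\<close>-th edge
  direction. The recursion on the edges avoids deleting an edge from the middle of a
  list; \<open>flux_eq_sum\<close> gives the sum over the faces.
\<close>

primrec flux :: "'a::real_normed_vector list \<Rightarrow> (nat \<Rightarrow> 'a \<Rightarrow> 'w::banach) \<Rightarrow> 'a \<Rightarrow> 'w" where
  "flux [] F x = 0"
| "flux (v # vs) F x = box_avg vs (F 0) (x + v) - box_avg vs (F 0) x
     + integral {0..1} (\<lambda>t. flux vs (\<lambda>i. F (Suc i)) (x + t *\<^sub>R v))"

lemma pbox_ConsI: "y \<in> pbox vs (x + t *\<^sub>R v) \<Longrightarrow> 0 \<le> t \<Longrightarrow> t \<le> 1 \<Longrightarrow> y \<in> pbox (v # vs) x"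
  by force

lemma pbox_ConsD: "pbox (v # vs) x \<subseteq> Q \<Longrightarrow> 0 \<le> t \<Longrightarrow> t \<le> 1 \<Longrightarrow> pbox vs (x + t *\<^sub>R v) \<subseteq> Q"
  by force

lemma pbox_Cons_ends:
  "pbox vs x \<subseteq> pbox (v # vs) x" "pbox vs (x + v) \<subseteq> pbox (v # vs) x"
  using pbox_ConsI[of _ vs x 0 v] pbox_ConsI[of _ vs x 1 v] by (auto simp del: pbox.simps)

lemma pbox_start: "x \<in> pbox vs x"
  by (induction vs arbitrary: x) (auto intro!: bexI[of _ 0])

lemma pbox_shift: "y \<in> pbox vs x \<Longrightarrow> y + w \<in> pbox vs (x + w)"
proof (induction vs arbitrary: x)
  case (Cons v vs)
  then obtain t where t: "t \<in> {0..1}" "y \<in> pbox vs (x + t *\<^sub>R v)" by auto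
  with Cons.IH have "y + w \<in> pbox vs (x + w + t *\<^sub>R v)" by (metis add.assoc add.commute)
  with t show ?case by auto
qed auto

lemma pbox_unshift: "y \<in> pbox vs (x + w) \<Longrightarrow> y - w \<in> pbox vs x"
  using pbox_shift[of y vs "x + w" "- w"] by simp

lemma pbox_bounded:
  "y \<in> pbox vs x \<Longrightarrow> norm (y - x) \<le> (\<Sum>v\<leftarrow>vs. norm v)"
proof (induction vs arbitrary: x)
  case (Cons v vs)
  then obtain t where t: "t \<in> {0..1}" "y \<in> pbox vs (x + t *\<^sub>R v)" by auto
  have "y - x = (y - (x + t *\<^sub>R v)) + t *\<^sub>R v" by simp
  then have "norm (y - x) \<le> norm (y - (x + t *\<^sub>R v)) + norm (t *\<^sub>R v)"
    by (metis norm_triangle_ineq)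
  moreover have "norm (t *\<^sub>R v) \<le> norm v" using t by (auto intro: mult_left_le_one_le)
  ultimately show ?case using Cons.IH[OF t(2)] by auto
qed auto

lemma box_avg_continuous:
  assumes "continuous_on Q f"
  shows "continuous_on {x. pbox vs x \<subseteq> Q} (box_avg vs f)"
proof (induction vs)
  case Nil
  then show ?case using assms by simp
next
  case (Cons v vs)
  have "continuous_on ({x. pbox (v # vs) x \<subseteq> Q} \<times> cbox 0 1) (\<lambda>(x, t). box_avg vs f (x + t *\<^sub>R v))"
    unfolding split_def
    by (rule continuous_on_compose2[OF Cons.IH]) (force intro!: continuous_intros)+
  from integral_continuous_on_param[OF this] show ?case by simp
qed

lemma box_avg_continuous_line:
  assumes "continuous_on Q f" "pbox (v # vs) x \<subseteq> Q"
  shows "continuous_on {0..1} (\<lambda>t. box_avg vs f (x + t *\<^sub>R v))"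
  by (rule continuous_on_compose2[OF box_avg_continuous[OF assms(1), of vs]])
     (use assms(2) in \<open>force intro!: continuous_intros\<close>)+

lemma flux_continuous:
  assumes "\<And>i. i < length vs \<Longrightarrow> continuous_on Q (F i)"
  shows "continuous_on {x. pbox vs x \<subseteq> Q} (flux vs F)"
  using assms
proof (induction vs arbitrary: F)
  case Nil
  then show ?case by simp
next
  case (Cons v vs)
  let ?Z = "{x. pbox (v # vs) x \<subseteq> Q}"
  have IH: "continuous_on {x. pbox vs x \<subseteq> Q} (flux vs (\<lambda>i. F (Suc i)))"
    by (rule Cons.IH) (use Cons.prems in auto)
  have 1: "continuous_on (?Z \<times> cbox 0 1) (\<lambda>(x, t). flux vs (\<lambda>i. F (Suc i)) (x + t *\<^sub>R v))"
    unfolding split_def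
    by (rule continuous_on_compose2[OF IH]) (force intro!: continuous_intros)+
  have c0: "continuous_on Q (F 0)" using Cons.prems by simp
  have 2: "continuous_on ?Z (\<lambda>x. box_avg vs (F 0) (x + v))"
    by (rule continuous_on_compose2[OF box_avg_continuous[OF c0, of vs]])
       (use pbox_Cons_ends in \<open>force intro!: continuous_intros\<close>)+
  have 3: "continuous_on ?Z (box_avg vs (F 0))"
    by (rule continuous_on_subset[OF box_avg_continuous[OF c0, of vs]])
       (use pbox_Cons_ends in force)
  show ?case
    using continuous_on_add[OF continuous_on_diff[OF 2 3] integral_continuous_on_param[OF 1]] by simp
qed

lemma flux_continuous_line:
  assumes "\<And>i. i < length vs \<Longrightarrow> continuous_on Q (F i)" "pbox (v # vs) x \<subseteq> Q"
  shows "continuous_on {0..1} (\<lambda>t. flux vs F (x + t *\<^sub>R v))"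
  by (rule continuous_on_compose2[OF flux_continuous[OF assms(1)]])
     (use assms(2) in \<open>force intro!: continuous_intros\<close>)+

lemma box_avg_near:
  assumes "continuous_on Q f" "pbox vs x \<subseteq> Q" "\<And>y. y \<in> pbox vs x \<Longrightarrow> norm (f y - c) \<le> e"
  shows "norm (box_avg vs f x - c) \<le> e"
  using assms(2,3)
proof (induction vs arbitrary: x)
  case Nil
  then show ?case by simp
next
  case (Cons v vs)
  have "norm (box_avg vs f (x + t *\<^sub>R v) - c) \<le> e" if "t \<in> {0..1}" for t
    using that pbox_ConsI[of _ vs x t v] Cons.prems
    by (intro Cons.IH) (auto simp del: pbox.simps)
  then show ?case unfolding box_avg.simps
    by (intro integral_unit_interval_near box_avg_continuous_line[OF assms(1) Cons.prems(1)]) auto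
qed

lemma box_avg_diff:
  assumes "continuous_on Q f" "continuous_on Q g" "pbox vs x \<subseteq> Q"
  shows "box_avg vs (\<lambda>y. f y - g y) x = box_avg vs f x - box_avg vs g x"
  using assms(3)
proof (induction vs arbitrary: x)
  case (Cons v vs)
  have "integral {0..1} (\<lambda>t. box_avg vs (\<lambda>y. f y - g y) (x + t *\<^sub>R v))
      = integral {0..1} (\<lambda>t. box_avg vs f (x + t *\<^sub>R v) - box_avg vs g (x + t *\<^sub>R v))"
    by (rule integral_cong) (use Cons in force)
  then show ?case
    by (simp add: integral_diff integrable_continuous_real
         box_avg_continuous_line[OF assms(1) Cons.prems] box_avg_continuous_line[OF assms(2) Cons.prems])
qed simp

lemma box_avg_scaleR: "box_avg vs (\<lambda>y. c *\<^sub>R f y) x = c *\<^sub>R box_avg vs f x"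
  by (induction vs arbitrary: x) auto

lemma box_avg_shift: "box_avg vs f (x + w) = box_avg vs (\<lambda>y. f (y + w)) x"
proof (induction vs arbitrary: x)
  case (Cons v vs)
  show ?case by (simp add: Cons.IH[symmetric] algebra_simps)
qed simp

lemma box_avg_cong:
  "(\<And>y. y \<in> pbox vs x \<Longrightarrow> f y = g y) \<Longrightarrow> box_avg vs f x = box_avg vs g x"
  by (induction vs arbitrary: x) (auto intro!: integral_cong)

text \<open>
  An affine field has exactly the flux \<open>\<Sum>i. L i (vs ! i)\<close>: opposite faces differ by the
  translation along an edge. The error of the affine approximation enters once for each
  of the two faces in each direction.
\<close>

lemma flux_near:
  assumes "\<And>i. i < length vs \<Longrightarrow> continuous_on Q (F i)" "pbox vs x \<subseteq> Q"
    and "\<And>i. i < length vs \<Longrightarrow> linear (L i)"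
    and "\<And>i y. i < length vs \<Longrightarrow> y \<in> pbox vs x \<Longrightarrow> norm (F i y - (a i + L i y)) \<le> e"
  shows "norm (flux vs F x - (\<Sum>i<length vs. L i (vs ! i))) \<le> 2 * real (length vs) * e"
  using assms
proof (induction vs arbitrary: x F L a)
  case Nil
  then show ?case by simp
next
  case (Cons v vs)
  let ?F = "\<lambda>i. F (Suc i)" and ?S = "\<Sum>i<length vs. L (Suc i) (vs ! i)"
  have c0: "continuous_on Q (F 0)" using Cons.prems(1) by simp
  let ?Z = "pbox vs x"
  have c1: "continuous_on ?Z (\<lambda>y. F 0 (y + v))"
    by (rule continuous_on_compose2[OF c0])
       (use pbox_shift[of _ vs x v] pbox_Cons_ends[of vs x v] Cons.prems(2) in \<open>force intro!: continuous_intros\<close>)+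
  have c2: "continuous_on ?Z (F 0)"
    by (rule continuous_on_subset[OF c0]) (use pbox_Cons_ends[of vs x v] Cons.prems(2) in force)
  have "norm (box_avg vs (\<lambda>y. F 0 (y + v) - F 0 y) x - L 0 v) \<le> 2 * e"
  proof (rule box_avg_near[OF continuous_on_diff[OF c1 c2] order_refl])
    fix y assume y: "y \<in> pbox vs x"
    have l: "L 0 (y + v) = L 0 y + L 0 v" using Cons.prems(3)[of 0] by (simp add: linear_add)
    have "norm (F 0 (y + v) - (a 0 + L 0 (y + v))) \<le> e"
      using Cons.prems(4)[of 0 "y + v"] pbox_shift[OF y, of v] pbox_Cons_ends[of vs x v] by auto
    moreover have "norm (F 0 y - (a 0 + L 0 y)) \<le> e"
      using Cons.prems(4)[of 0 "y"] y pbox_Cons_ends[of vs x v] by auto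
    moreover have "F 0 (y + v) - F 0 y - L 0 v
        = (F 0 (y + v) - (a 0 + L 0 (y + v))) - (F 0 y - (a 0 + L 0 y))"
      by (simp add: l)
    ultimately show "norm (F 0 (y + v) - F 0 y - L 0 v) \<le> 2 * e"
      by (smt (verit) norm_triangle_ineq4)
  qed
  then have 1: "norm (box_avg vs (F 0) (x + v) - box_avg vs (F 0) x - L 0 v) \<le> 2 * e"
    by (simp add: box_avg_diff[OF c1 c2] box_avg_shift)
  have fc: "\<And>i. i < length vs \<Longrightarrow> continuous_on Q (?F i)" using Cons.prems(1) by simp
  have "norm (flux vs ?F (x + t *\<^sub>R v) - ?S) \<le> 2 * real (length vs) * e" if "t \<in> {0..1}" for t
  proof (rule Cons.IH)
    show "pbox vs (x + t *\<^sub>R v) \<subseteq> Q" using Cons.prems(2) that by force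
    show "norm (F (Suc i) y - (a (Suc i) + L (Suc i) y)) \<le> e"
      if "i < length vs" "y \<in> pbox vs (x + t *\<^sub>R v)" for i y
      using Cons.prems(4)[of "Suc i" y] that(1) pbox_ConsI[OF that(2)] \<open>t \<in> _\<close>
      by (simp del: pbox.simps)
  qed (use Cons.prems in auto)
  then have 2: "norm (integral {0..1} (\<lambda>t. flux vs ?F (x + t *\<^sub>R v)) - ?S) \<le> 2 * real (length vs) * e"
    by (intro integral_unit_interval_near flux_continuous_line[OF fc Cons.prems(2)]) auto
  have "flux (v # vs) F x - (\<Sum>i<length (v # vs). L i ((v # vs) ! i))
      = (box_avg vs (F 0) (x + v) - box_avg vs (F 0) x - L 0 v)
        + (integral {0..1} (\<lambda>t. flux vs ?F (x + t *\<^sub>R v)) - ?S)"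
    by (simp add: sum.lessThan_Suc_shift del: sum.lessThan_Suc)
  then have "norm (flux (v # vs) F x - (\<Sum>i<length (v # vs). L i ((v # vs) ! i)))
      \<le> 2 * e + 2 * real (length vs) * e" using 1 2 by (smt (verit) norm_triangle_ineq)
  then show ?case by (simp add: algebra_simps)
qed

section \<open>The divergence theorem for differentiable fields\<close>

text \<open>
  Halving all edges cuts a box into translates of the halved box; their corners are the
  points over which this average is taken.
\<close>

primrec corner_avg :: "'a::real_normed_vector list \<Rightarrow> ('a \<Rightarrow> 'w::real_normed_vector) \<Rightarrow> 'a \<Rightarrow> 'w" where
  "corner_avg [] g x = g x"
| "corner_avg (v # vs) g x = (1/2) *\<^sub>R (corner_avg vs g x + corner_avg vs g (x + (1/2) *\<^sub>R v))"

abbreviation halves :: "'a::real_vector list \<Rightarrow> 'a list" where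
  "halves vs \<equiv> map (scaleR (1/2)) vs"

lemma corner_avg_diff: "corner_avg vs (\<lambda>y. f y - g y) x = corner_avg vs f x - corner_avg vs g x"
  by (induction vs arbitrary: x) (auto simp: scaleR_add_right scaleR_diff_right)

lemma corner_avg_add: "corner_avg vs (\<lambda>y. f y + g y) x = corner_avg vs f x + corner_avg vs g x"
  by (induction vs arbitrary: x) (auto simp: scaleR_add_right)

lemma corner_avg_scaleR: "corner_avg vs (\<lambda>y. c *\<^sub>R g y) x = c *\<^sub>R corner_avg vs g x"
  by (induction vs arbitrary: x) (auto simp: scaleR_add_right)

lemma corner_avg_shift: "corner_avg vs (\<lambda>y. g (y + w)) x = corner_avg vs g (x + w)"
proof (induction vs arbitrary: x)
  case (Cons v vs)
  have "x + (1/2) *\<^sub>R v + w = x + w + (1/2) *\<^sub>R v" by (simp add: ac_simps)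
  then show ?case by (simp only: corner_avg.simps Cons.IH)
qed simp

lemma pbox_halves_Cons:
  assumes "pbox (halves vs) z \<subseteq> pbox vs (x + s *\<^sub>R v)" "0 \<le> s" "s \<le> 1/2"
  shows "pbox (halves (v # vs)) z \<subseteq> pbox (v # vs) x"
proof
  fix y assume "y \<in> pbox (halves (v # vs)) z"
  then obtain t where t: "t \<in> {0..1}" "y \<in> pbox (halves vs) (z + (t/2) *\<^sub>R v)"
    by auto
  then have "y - (t/2) *\<^sub>R v \<in> pbox (halves vs) z" by (metis pbox_unshift)
  then have "y - (t/2) *\<^sub>R v \<in> pbox vs (x + s *\<^sub>R v)" using assms(1) by auto
  then have "y \<in> pbox vs (x + (s + t/2) *\<^sub>R v)"
    using pbox_shift[of "y - (t/2) *\<^sub>R v" vs "x + s *\<^sub>R v" "(t/2) *\<^sub>R v"]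
    by (simp add: algebra_simps)
  then show "y \<in> pbox (v # vs) x"
    by (rule pbox_ConsI) (use t assms(2,3) in auto)
qed

text \<open>
  An average cannot exceed all its terms. This selects the subbox in the bisection.
\<close>

lemma corner_avg_witness:
  assumes "e \<le> norm (corner_avg vs g x)"
  shows "\<exists>z. pbox (halves vs) z \<subseteq> pbox vs x \<and> e \<le> norm (g z)"
  using assms
proof (induction vs arbitrary: x)
  case Nil
  then show ?case by auto
next
  case (Cons v vs)
  have "\<exists>s\<in>{0,1/2}. e \<le> norm (corner_avg vs g (x + s *\<^sub>R v))"
  proof (rule ccontr)
    assume "\<not> ?thesis"
    then have "norm (corner_avg vs g x) < e" "norm (corner_avg vs g (x + (1/2) *\<^sub>R v)) < e" by auto
    moreover have "norm (corner_avg (v # vs) g x)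
        \<le> (norm (corner_avg vs g x) + norm (corner_avg vs g (x + (1/2) *\<^sub>R v))) / 2"
      by (simp add: norm_triangle_ineq)
    ultimately show False using Cons.prems by simp
  qed
  then obtain s where s: "s \<in> {0,1/2}" "e \<le> norm (corner_avg vs g (x + s *\<^sub>R v))" by blast
  from Cons.IH[OF s(2)] obtain z where "pbox (halves vs) z \<subseteq> pbox vs (x + s *\<^sub>R v)" "e \<le> norm (g z)"
    by blast
  then show ?case using pbox_halves_Cons[of vs z x s v] s(1)
    by (intro exI[of _ z]) (auto simp del: pbox.simps)
qed

lemma corner_avg_integral:
  fixes G :: "'a::real_normed_vector \<Rightarrow> 'w::banach"
  assumes "\<And>z. pbox (halves vs) z \<subseteq> pbox vs x \<Longrightarrow> (\<lambda>t. G (z + (t/2) *\<^sub>R w)) integrable_on {0..1::real}"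
  shows "((\<lambda>t. corner_avg vs G (x + (t/2) *\<^sub>R w))
     has_integral corner_avg vs (\<lambda>z. integral {0..1} (\<lambda>t. G (z + (t/2) *\<^sub>R w))) x) {0..1}"
  using assms
proof (induction vs arbitrary: x)
  case Nil
  then show ?case by (simp add: integrable_integral)
next
  case (Cons v vs)
  have *: "((\<lambda>t. corner_avg vs G (x + s *\<^sub>R v + (t/2) *\<^sub>R w))
     has_integral corner_avg vs (\<lambda>z. integral {0..1} (\<lambda>t. G (z + (t/2) *\<^sub>R w))) (x + s *\<^sub>R v)) {0..1}"
    if "s \<in> {0,1/2}" for s
    using that by (intro Cons.IH Cons.prems, elim pbox_halves_Cons) auto
  have e: "x + (1/2) *\<^sub>R v + (t/2) *\<^sub>R w = x + (t/2) *\<^sub>R w + (1/2) *\<^sub>R v" for t by simp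
  show ?case
    using has_integral_cmul[OF has_integral_add[OF *[of 0] *[of "1/2"]], of "1/2"] by (simp add: e)
qed

lemma box_avg_halve:
  assumes "continuous_on Q f" "pbox vs x \<subseteq> Q"
  shows "box_avg vs f x = corner_avg vs (box_avg (halves vs) f) x"
  using assms(2)
proof (induction vs arbitrary: x)
  case (Cons v vs)
  have *: "integral {0..1} (\<lambda>t. box_avg vs f (x + (s + t/2) *\<^sub>R v))
      = corner_avg vs (box_avg (halves (v # vs)) f) (x + s *\<^sub>R v)" if s: "s \<in> {0,1/2}" for s
  proof -
    have "box_avg vs f (x + (s + t/2) *\<^sub>R v)
        = corner_avg vs (box_avg (halves vs) f) (x + s *\<^sub>R v + (t/2) *\<^sub>R v)" if "t \<in> {0..1}" for t
      using Cons.IH[of "x + (s + t/2) *\<^sub>R v"] pbox_ConsD[OF Cons.prems, of "s + t/2"] that s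
      by (auto simp: algebra_simps)
    moreover have "((\<lambda>t. corner_avg vs (box_avg (halves vs) f) (x + s *\<^sub>R v + (t/2) *\<^sub>R v))
       has_integral corner_avg vs (\<lambda>z. integral {0..1} (\<lambda>t. box_avg (halves vs) f (z + (t/2) *\<^sub>R v)))
         (x + s *\<^sub>R v)) {0..1}"
    proof (rule corner_avg_integral)
      fix z assume "pbox (halves vs) z \<subseteq> pbox vs (x + s *\<^sub>R v)"
      then have "pbox (halves (v # vs)) z \<subseteq> pbox (v # vs) x" by (rule pbox_halves_Cons) (use s in auto)
      then have "pbox (((1/2) *\<^sub>R v) # halves vs) z \<subseteq> Q" using Cons.prems by auto
      from box_avg_continuous_line[OF assms(1) this]
      show "(\<lambda>t. box_avg (halves vs) f (z + (t/2) *\<^sub>R v)) integrable_on {0..1}"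
        by (intro integrable_continuous_real) simp
    qed
    moreover have "box_avg (halves (v # vs)) f = (\<lambda>z. integral {0..1} (\<lambda>t. box_avg (halves vs) f (z + (t/2) *\<^sub>R v)))"
      by (rule ext) simp
    ultimately show ?thesis
      by (metis (no_types, lifting) integral_cong integral_unique)
  qed
  show ?case
    unfolding box_avg.simps(2)
    using integral_unit_interval_halve[OF box_avg_continuous_line[OF assms(1) Cons.prems]]
      *[of 0] *[of "1/2"] by (simp del: box_avg.simps)
qed simp

text \<open>
  Fluxes through interior faces cancel. The factor 2 arises because all averages are
  normalised by volume, and halving the edges divides the volume of a box by one more
  factor 2 than that of its faces.
\<close>

lemma flux_halve:
  assumes "\<And>i. i < length vs \<Longrightarrow> continuous_on Q (F i)" "pbox vs x \<subseteq> Q"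
  shows "flux vs F x = corner_avg vs (\<lambda>z. 2 *\<^sub>R flux (halves vs) F z) x"
  using assms
proof (induction vs arbitrary: x F)
  case Nil
  then show ?case by simp
next
  case (Cons v vs)
  let ?F = "\<lambda>i. F (Suc i)" and ?b = "box_avg (halves vs) (F 0)"
  have fc: "\<And>i. i < length vs \<Longrightarrow> continuous_on Q (?F i)" using Cons.prems(1) by simp
  have c0: "continuous_on Q (F 0)" using Cons.prems(1) by simp
  let ?I = "\<lambda>z. integral {0..1} (\<lambda>t. flux (halves vs) ?F (z + (t/2) *\<^sub>R v))"
  have *: "integral {0..1} (\<lambda>t. flux vs ?F (x + (s + t/2) *\<^sub>R v))
      = 2 *\<^sub>R corner_avg vs ?I (x + s *\<^sub>R v)" if s: "s \<in> {0,1/2}" for s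
  proof -
    have "flux vs ?F (x + (s + t/2) *\<^sub>R v)
        = 2 *\<^sub>R corner_avg vs (flux (halves vs) ?F) (x + s *\<^sub>R v + (t/2) *\<^sub>R v)" if "t \<in> {0..1}" for t
      using Cons.IH[of ?F "x + (s + t/2) *\<^sub>R v", OF fc] pbox_ConsD[OF Cons.prems(2), of "s + t/2"] that s
      by (auto simp: algebra_simps corner_avg_scaleR)
    moreover have "((\<lambda>t. corner_avg vs (flux (halves vs) ?F) (x + s *\<^sub>R v + (t/2) *\<^sub>R v))
       has_integral corner_avg vs ?I (x + s *\<^sub>R v)) {0..1}"
    proof (rule corner_avg_integral)
      fix z assume "pbox (halves vs) z \<subseteq> pbox vs (x + s *\<^sub>R v)"
      then have "pbox (halves (v # vs)) z \<subseteq> pbox (v # vs) x" by (rule pbox_halves_Cons) (use s in auto)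
      then have "pbox (((1/2) *\<^sub>R v) # halves vs) z \<subseteq> Q" using Cons.prems by auto
      from flux_continuous_line[OF _ this, of ?F] fc
      show "(\<lambda>t. flux (halves vs) ?F (z + (t/2) *\<^sub>R v)) integrable_on {0..1}"
        by (intro integrable_continuous_real) simp
    qed
    ultimately have "integral {0..1} (\<lambda>t. flux vs ?F (x + (s + t/2) *\<^sub>R v))
        = integral {0..1} (\<lambda>t. 2 *\<^sub>R corner_avg vs (flux (halves vs) ?F) (x + s *\<^sub>R v + (t/2) *\<^sub>R v))"
      and "integral {0..1} (\<lambda>t. corner_avg vs (flux (halves vs) ?F) (x + s *\<^sub>R v + (t/2) *\<^sub>R v))
        = corner_avg vs ?I (x + s *\<^sub>R v)"
      by (blast intro: integral_cong, blast intro: integral_unique)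
    then show ?thesis by simp
  qed
  have 1: "integral {0..1} (\<lambda>t. flux vs ?F (x + t *\<^sub>R v))
      = corner_avg vs ?I x + corner_avg vs ?I (x + (1/2) *\<^sub>R v)"
    using integral_unit_interval_halve[OF flux_continuous_line[OF fc Cons.prems(2)]] *[of 0] *[of "1/2"]
    by (simp add: scaleR_add_right)
  have 2: "box_avg vs (F 0) (x + v) = corner_avg vs ?b (x + v)" "box_avg vs (F 0) x = corner_avg vs ?b x"
    using box_avg_halve[OF c0] pbox_Cons_ends[of vs x v] Cons.prems(2) by blast+
  have 3: "x + (1/2) *\<^sub>R v + (1/2) *\<^sub>R v = x + v" 
    by (metis add.assoc scaleR_half_double scaleR_add_right)
  show ?case
    by (simp add: 1 2 3 corner_avg_add corner_avg_diff corner_avg_scaleR corner_avg_shift scaleR_add_right scaleR_diff_right)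
qed

text \<open>
  At a point of differentiability the flux per size of a box tends to the divergence. The
  box may move, as long as its distance to \<open>q\<close> is bounded by a multiple of its size; the
  bisection needs this because \<open>q\<close> need not lie in a prescribed position of the box.
\<close>

lemma flux_quotient_near:
  assumes Fc: "\<And>i. i < length vs \<Longrightarrow> continuous_on Q (F i)"
    and F: "\<And>i. i < length vs \<Longrightarrow> (F i has_derivative L i) (at q within Q)"
    and "e > 0" "C \<ge> 0"
  shows "\<exists>d>0. \<forall>s z. 0 < s \<longrightarrow> s < d \<longrightarrow> pbox (map (scaleR s) vs) z \<subseteq> Q \<longrightarrow>
           (\<forall>y\<in>pbox (map (scaleR s) vs) z. norm (y - q) \<le> C * s) \<longrightarrow>
           norm ((1/s) *\<^sub>R flux (map (scaleR s) vs) F z - (\<Sum>i<length vs. L i (vs ! i))) \<le> e"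
proof -
  let ?n = "length vs"
  define r where "r = e / (1 + 2 * real ?n * C)"
  have den: "1 + 2 * real ?n * C > 0" using \<open>C \<ge> 0\<close> by (simp add: add_pos_nonneg)
  have r: "r > 0" using \<open>e > 0\<close> den by (simp add: r_def)
  have rr: "2 * real ?n * C * r \<le> e"
  proof -
    have "r * (1 + 2 * real ?n * C) = e" using den unfolding r_def by simp
    then show ?thesis using r by (simp add: algebra_simps)
  qed
  have "\<forall>i. \<exists>d>0. i < ?n \<longrightarrow> (\<forall>y\<in>Q. norm (y - q) < d \<longrightarrow> norm (F i y - F i q - L i (y - q)) \<le> r * norm (y - q))"
    using F r unfolding has_derivative_within_alt by (metis zero_less_one)
  then obtain d where d: "\<And>i. d i > 0" "\<And>i y. i < ?n \<Longrightarrow> y \<in> Q \<Longrightarrow> norm (y - q) < d i \<Longrightarrow>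
      norm (F i y - F i q - L i (y - q)) \<le> r * norm (y - q)" by metis
  define m where "m = Min (insert 1 (d ` {..<?n}))"
  have m: "m > 0" "\<And>i. i < ?n \<Longrightarrow> m \<le> d i" using d(1) by (auto simp: m_def)
  have lin: "i < ?n \<Longrightarrow> linear (L i)" for i using F has_derivative_linear by blast
  show ?thesis
  proof (intro exI[of _ "m / (1 + C)"] conjI allI impI)
    show "m / (1 + C) > 0" using m(1) \<open>C \<ge> 0\<close> by simp
    fix s z
    assume s: "0 < s" "s < m / (1 + C)" and sub: "pbox (map (scaleR s) vs) z \<subseteq> Q"
      and yq: "\<forall>y\<in>pbox (map (scaleR s) vs) z. norm (y - q) \<le> C * s"
    have "s * (1 + C) < m" using s(2) \<open>C \<ge> 0\<close> by (simp add: pos_less_divide_eq)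
    then have sm: "C * s < m" using s(1) by (simp add: algebra_simps)
    let ?us = "map (scaleR s) vs"
    have "norm (flux ?us F z - (\<Sum>i<length ?us. L i (?us ! i))) \<le> 2 * real (length ?us) * (r * (C * s))"
    proof (rule flux_near[where Q = Q])
      fix i y assume i: "i < length ?us" and y: "y \<in> pbox ?us z"
      have "norm (F i y - F i q - L i (y - q)) \<le> r * norm (y - q)"
        using d(2)[of i y] i yq y sub sm m(2)[of i] by force
      also have "\<dots> \<le> r * (C * s)" using yq y r by (intro mult_left_mono) auto
      finally show "norm (F i y - (F i q - L i q + L i y)) \<le> r * (C * s)"
        using lin[of i] i by (simp add: linear_diff algebra_simps)
    qed (use Fc sub lin in auto)
    moreover have "(\<Sum>i<length ?us. L i (?us ! i)) = s *\<^sub>R (\<Sum>i<?n. L i (vs ! i))"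
      using lin by (simp add: scaleR_sum_right linear_cmul)
    ultimately have "norm (flux ?us F z - s *\<^sub>R (\<Sum>i<?n. L i (vs ! i))) \<le> s * (2 * real ?n * C * r)"
      by (simp add: algebra_simps)
    also have "\<dots> \<le> s * e" using rr s(1) by (intro mult_left_mono) auto
    finally have "norm (flux ?us F z - s *\<^sub>R (\<Sum>i<?n. L i (vs ! i))) / s \<le> e"
      using s(1) by (simp add: divide_le_eq mult.commute)
    moreover have "(1/s) *\<^sub>R flux ?us F z - (\<Sum>i<?n. L i (vs ! i))
        = (1/s) *\<^sub>R (flux ?us F z - s *\<^sub>R (\<Sum>i<?n. L i (vs ! i)))"
      using s(1) by (simp add: scaleR_diff_right)
    ultimately show "norm ((1/s) *\<^sub>R flux ?us F z - (\<Sum>i<?n. L i (vs ! i))) \<le> e"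
      using s(1) by simp
  qed
qed

lemma box_avg_small_near:
  assumes "continuous_on Q h" "q \<in> Q" "e > 0" "C \<ge> 0"
  shows "\<exists>d>0. \<forall>s z. 0 < s \<longrightarrow> s < d \<longrightarrow> pbox (map (scaleR s) vs) z \<subseteq> Q \<longrightarrow>
           (\<forall>y\<in>pbox (map (scaleR s) vs) z. norm (y - q) \<le> C * s) \<longrightarrow>
           norm (box_avg (map (scaleR s) vs) h z - h q) \<le> e"
proof -
  obtain d where d: "d > 0" "\<And>y. y \<in> Q \<Longrightarrow> norm (y - q) < d \<Longrightarrow> norm (h y - h q) < e"
    using assms(1-3) unfolding continuous_on_iff dist_norm by metis
  show ?thesis
  proof (intro exI[of _ "d / (1 + C)"] conjI allI impI)
    show "d / (1 + C) > 0" using d(1) \<open>C \<ge> 0\<close> by simp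
    fix s z
    assume s: "0 < s" "s < d / (1 + C)" and sub: "pbox (map (scaleR s) vs) z \<subseteq> Q"
      and yq: "\<forall>y\<in>pbox (map (scaleR s) vs) z. norm (y - q) \<le> C * s"
    have "s * (1 + C) < d" using s(2) \<open>C \<ge> 0\<close> by (simp add: pos_less_divide_eq)
    then have sm: "C * s < d" using s(1) by (simp add: algebra_simps)
    show "norm (box_avg (map (scaleR s) vs) h z - h q) \<le> e"
      by (rule box_avg_near[OF assms(1) sub]) (use yq sub sm d(2) in force)
  qed
qed

text \<open>
  Goursat's argument. The defect between average divergence and flux of a box, per size,
  is the average of the defects of the halved subboxes, so one subbox has a defect at
  least as large. Nested subboxes shrink to a point, where differentiability of the
  field and continuity of the divergence force the defect to 0. Hence the partial
  derivatives themselves need not be continuous.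
\<close>

lemma divergence_theorem_box:
  fixes F :: "nat \<Rightarrow> 'a::banach \<Rightarrow> 'w::banach"
  assumes Q: "closed Q" "pbox vs x \<subseteq> Q"
    and F: "\<And>i q. i < length vs \<Longrightarrow> q \<in> Q \<Longrightarrow> (F i has_derivative F' i q) (at q within Q)"
    and h: "continuous_on Q h" "\<And>q. q \<in> Q \<Longrightarrow> h q = (\<Sum>i<length vs. F' i q (vs ! i))"
  shows "box_avg vs h x = flux vs F x"
proof (rule ccontr)
  let ?n = "length vs"
  have Fc: "continuous_on Q (F i)" if "i < ?n" for i
    using F[OF that] by (meson has_derivative_continuous continuous_on_eq_continuous_within)
  define D where "D = (\<lambda>s z. box_avg (map (scaleR s) vs) h z - (1/s) *\<^sub>R flux (map (scaleR s) vs) F z)"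
  assume "box_avg vs h x \<noteq> flux vs F x"
  define e where "e = norm (D 1 x)"
  have [simp]: "map (scaleR 1) vs = vs" by (simp add: map_idI)
  have e: "e > 0" using \<open>box_avg vs h x \<noteq> flux vs F x\<close> by (simp add: e_def D_def)
  define s where "s = (\<lambda>N::nat. (1/2::real) ^ N)"
  have s0: "s N > 0" for N by (simp add: s_def)
  define B where "B = (\<lambda>N z. pbox (map (scaleR (s N)) vs) z)"
  have hm: "halves (map (scaleR (s N)) vs) = map (scaleR (s (Suc N))) vs" for N by (simp add: s_def)
  have step: "\<exists>z'. (B (Suc N) z' \<subseteq> Q \<and> e \<le> norm (D (s (Suc N)) z')) \<and> B (Suc N) z' \<subseteq> B N z"
    if z: "B N z \<subseteq> Q \<and> e \<le> norm (D (s N) z)" for N z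
  proof -
    have "D (s N) z = corner_avg (map (scaleR (s N)) vs) (D (s (Suc N))) z"
      using box_avg_halve[OF h(1), of "map (scaleR (s N)) vs" z]
            flux_halve[of "map (scaleR (s N)) vs" Q F z] Fc z
      unfolding D_def hm
      by (simp add: B_def corner_avg_diff corner_avg_scaleR s_def)
    with z have "e \<le> norm (corner_avg (map (scaleR (s N)) vs) (D (s (Suc N))) z)" by simp
    from corner_avg_witness[OF this] z show ?thesis unfolding hm B_def by blast
  qed
  have "B 0 x \<subseteq> Q \<and> e \<le> norm (D (s 0) x)" using Q(2) by (simp add: B_def s_def e_def)
  then have "\<exists>z. B 0 z \<subseteq> Q \<and> e \<le> norm (D (s 0) z)" by blast
  then have "\<exists>z. \<forall>N. (B N (z N) \<subseteq> Q \<and> e \<le> norm (D (s N) (z N))) \<and> B (Suc N) (z (Suc N)) \<subseteq> B N (z N)"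
    using step by (intro dependent_nat_choice[where P = "\<lambda>N z. B N z \<subseteq> Q \<and> e \<le> norm (D (s N) z)"]) auto
  then obtain z where z: "\<And>N. B N (z N) \<subseteq> Q" "\<And>N. e \<le> norm (D (s N) (z N))"
      "\<And>N. B (Suc N) (z (Suc N)) \<subseteq> B N (z N)" by metis
  define C where "C = (\<Sum>v\<leftarrow>vs. norm v)"
  have C0: "C \<ge> 0" unfolding C_def by (rule sum_list_nonneg) auto
  have Bb: "norm (y - z N) \<le> s N * C" if "y \<in> B N (z N)" for y N
  proof -
    have "(\<Sum>v\<leftarrow>map (scaleR (s N)) vs. norm v) = s N * C"
      unfolding C_def using s0[of N] by (induction vs) (auto simp: algebra_simps)
    then show ?thesis using pbox_bounded[of y "map (scaleR (s N)) vs" "z N"] that by (simp add: B_def)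
  qed
  have anti: "B M (z M) \<subseteq> B N (z N)" if "N \<le> M" for M N
    using lift_Suc_antimono_le[of "\<lambda>N. B N (z N)", OF z(3) that] .
  have zin: "z M \<in> B N (z N)" if "N \<le> M" for M N
    using anti[OF that] pbox_start[of "z M"] by (auto simp: B_def)
  have slim: "s \<longlonglongrightarrow> 0" unfolding s_def by (rule LIMSEQ_realpow_zero) auto
  have "Cauchy z"
  proof (rule CauchyI)
    fix r :: real assume "r > 0"
    have "(\<lambda>N. 2 * (s N * C)) \<longlonglongrightarrow> 2 * (0 * C)" by (intro tendsto_intros slim)
    then have "eventually (\<lambda>N. 2 * (s N * C) < r) sequentially"
      using order_tendstoD(2)[of _ "2 * (0 * C)" sequentially r] \<open>r > 0\<close> by simp
    then obtain N where N: "2 * (s N * C) < r" by (auto simp: eventually_sequentially)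
    have "norm (z a - z b) < r" if "a \<ge> N" "b \<ge> N" for a b
    proof -
      have "norm (z a - z b) \<le> norm (z a - z N) + norm (z b - z N)"
        by (metis diff_add_cancel norm_minus_commute norm_triangle_sub norm_diff_triangle_le order_refl)
      then show ?thesis using Bb[OF zin, OF that(1)] Bb[OF zin, OF that(2)] N by linarith
    qed
    then show "\<exists>M. \<forall>m\<ge>M. \<forall>n\<ge>M. norm (z m - z n) < r" by blast
  qed
  then obtain q where q: "z \<longlonglongrightarrow> q" using Cauchy_convergent_iff convergent_def by blast
  have qQ: "q \<in> Q"
    using closed_sequentially[OF Q(1) _ q] zin z(1) by (meson order_refl subsetD)
  have zq: "norm (z N - q) \<le> s N * C" for N
  proof -
    have "(\<lambda>M. norm (z N - z M)) \<longlonglongrightarrow> norm (z N - q)" by (intro tendsto_intros q)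
    moreover have "\<forall>M\<ge>N. norm (z N - z M) \<le> s N * C" using Bb[OF zin] by (metis norm_minus_commute)
    ultimately show ?thesis by (meson LIMSEQ_le_const2)
  qed
  \<comment> \<open>The limit \<open>q\<close> need not lie in the boxes, but its distance to them is of the order of their size.\<close>
  have yq: "norm (y - q) \<le> 2 * C * s N" if "y \<in> B N (z N)" for y N
  proof -
    have "norm (y - q) \<le> norm (y - z N) + norm (z N - q)"
      by (metis diff_add_cancel add_diff_eq norm_triangle_ineq)
    then show ?thesis using Bb[OF that] zq[of N] by (auto simp: algebra_simps)
  qed
  have linF: "(\<Sum>i<?n. F' i q (vs ! i)) = h q" using h(2)[OF qQ] by simp
  obtain d1 where d1: "d1 > 0" "\<And>s z. 0 < s \<Longrightarrow> s < d1 \<Longrightarrow> pbox (map (scaleR s) vs) z \<subseteq> Q \<Longrightarrow>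
      (\<forall>y\<in>pbox (map (scaleR s) vs) z. norm (y - q) \<le> (2 * C) * s) \<Longrightarrow>
      norm ((1/s) *\<^sub>R flux (map (scaleR s) vs) F z - h q) \<le> e/3"
    using flux_quotient_near[of vs Q F "\<lambda>i. F' i q" q "e/3" "2 * C"] Fc F[OF _ qQ] e C0 unfolding linF
    by force
  obtain d2 where d2: "d2 > 0" "\<And>s z. 0 < s \<Longrightarrow> s < d2 \<Longrightarrow> pbox (map (scaleR s) vs) z \<subseteq> Q \<Longrightarrow>
      (\<forall>y\<in>pbox (map (scaleR s) vs) z. norm (y - q) \<le> (2 * C) * s) \<Longrightarrow>
      norm (box_avg (map (scaleR s) vs) h z - h q) \<le> e/3"
    using box_avg_small_near[OF h(1) qQ, of "e/3" "2 * C" vs] e C0 by force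
  have "eventually (\<lambda>N. s N < min d1 d2) sequentially"
    using order_tendstoD(2)[OF slim, of "min d1 d2"] d1(1) d2(1) by simp
  then obtain N where N: "s N < d1" "s N < d2" by (auto simp: eventually_sequentially)
  have sub: "pbox (map (scaleR (s N)) vs) (z N) \<subseteq> Q"
    and near: "\<forall>y\<in>pbox (map (scaleR (s N)) vs) (z N). norm (y - q) \<le> (2 * C) * s N"
    using z(1)[of N] yq[of _ N] by (auto simp: B_def)
  have "norm (D (s N) (z N)) \<le> norm (box_avg (map (scaleR (s N)) vs) h (z N) - h q)
      + norm ((1 / s N) *\<^sub>R flux (map (scaleR (s N)) vs) F (z N) - h q)"
    unfolding D_def by (metis (no_types, lifting) diff_diff_eq2 diff_add_cancel norm_triangle_ineq4)
  then have "norm (D (s N) (z N)) \<le> e/3 + e/3"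
    using d1(2)[OF s0 N(1) sub near] d2(2)[OF s0 N(2) sub near] by linarith
  with z(2)[of N] e show False by simp
qed

section \<open>Shrinking boxes and boxes with a time direction\<close>

lemma pbox_scaled_bounded:
  assumes "y \<in> pbox (map (scaleR s) vs) x" "s \<ge> 0"
  shows "norm (y - x) \<le> (\<Sum>v\<leftarrow>vs. norm v) * s"
proof -
  have "(\<Sum>v\<leftarrow>map (scaleR s) vs. norm v) = (\<Sum>v\<leftarrow>vs. norm v) * s"
    using assms(2) by (induction vs) (auto simp: algebra_simps)
  then show ?thesis using pbox_bounded[OF assms(1)] by simp
qed

lemma pbox_small_subset:
  fixes vs :: "'a::real_normed_vector list"
  assumes "R > 0"
  shows "\<forall>\<^sub>F s in at_right 0. pbox (map (scaleR s) vs) p \<subseteq> cball p R"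
proof -
  let ?C = "\<Sum>v\<leftarrow>vs. norm v"
  have C0: "?C \<ge> 0" by (rule sum_list_nonneg) auto
  have "pbox (map (scaleR s) vs) p \<subseteq> cball p R" if s: "0 < s" "s < R / (1 + ?C)" for s
  proof
    fix y assume y: "y \<in> pbox (map (scaleR s) vs) p"
    have "s * (1 + ?C) < R" using s C0 by (simp add: pos_less_divide_eq)
    then have "?C * s < R" using s(1) by (simp add: algebra_simps)
    then show "y \<in> cball p R" using pbox_scaled_bounded[OF y] s(1) by (simp add: dist_norm norm_minus_commute)
  qed
  moreover have "R / (1 + ?C) > 0" using assms C0 by simp
  ultimately show ?thesis unfolding eventually_at_right_field by blast
qed

lemma box_avg_tendsto:
  assumes "continuous_on (cball p R) h" "R > 0"
  shows "((\<lambda>s. box_avg (map (scaleR s) vs) h p) \<longlongrightarrow> h p) (at_right 0)"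
proof (rule tendstoI)
  let ?C = "\<Sum>v\<leftarrow>vs. norm v"
  have C0: "?C \<ge> 0" by (rule sum_list_nonneg) auto
  fix e :: real assume "e > 0"
  then obtain d where d: "d > 0" "\<And>s. 0 < s \<Longrightarrow> s < d \<Longrightarrow> pbox (map (scaleR s) vs) p \<subseteq> cball p R \<Longrightarrow>
      norm (box_avg (map (scaleR s) vs) h p - h p) \<le> e/2"
    using box_avg_small_near[OF assms(1), of p "e/2" ?C vs] C0 assms(2) pbox_scaled_bounded[of _ _ vs p]
    by (smt (verit) centre_in_cball half_gt_zero)
  have "\<forall>\<^sub>F s in at_right 0. s < d" "\<forall>\<^sub>F s in at_right (0::real). 0 < s"
    using d(1) by (auto simp: eventually_at_right_field intro: exI[of _ 1] exI[of _ d])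
  with pbox_small_subset[OF assms(2), of vs p]
  show "\<forall>\<^sub>F s in at_right 0. dist (box_avg (map (scaleR s) vs) h p) (h p) < e"
    by eventually_elim (use d(2) \<open>e > 0\<close> in \<open>force simp: dist_norm\<close>)
qed

lemma flux_quotient_tendsto:
  assumes "\<And>i. i < length vs \<Longrightarrow> continuous_on (cball p R) (F i)" "R > 0"
    and "\<And>i. i < length vs \<Longrightarrow> (F i has_derivative L i) (at p)"
  shows "((\<lambda>s. (1/s) *\<^sub>R flux (map (scaleR s) vs) F p) \<longlongrightarrow> (\<Sum>i<length vs. L i (vs ! i))) (at_right 0)"
proof (rule tendstoI)
  let ?C = "\<Sum>v\<leftarrow>vs. norm v"
  have C0: "?C \<ge> 0" by (rule sum_list_nonneg) auto
  have dw: "\<And>i. i < length vs \<Longrightarrow> (F i has_derivative L i) (at p within cball p R)"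
    using assms(3) has_derivative_at_withinI by blast
  fix e :: real assume "e > 0"
  then obtain d where d: "d > 0" "\<And>s. 0 < s \<Longrightarrow> s < d \<Longrightarrow> pbox (map (scaleR s) vs) p \<subseteq> cball p R \<Longrightarrow>
      norm ((1/s) *\<^sub>R flux (map (scaleR s) vs) F p - (\<Sum>i<length vs. L i (vs ! i))) \<le> e/2"
    using flux_quotient_near[of vs "cball p R" F L p "e/2" ?C, OF assms(1) dw] C0 pbox_scaled_bounded[of _ _ vs p]
    by (smt (verit) half_gt_zero)
  have "\<forall>\<^sub>F s in at_right 0. s < d" "\<forall>\<^sub>F s in at_right (0::real). 0 < s"
    using d(1) by (auto simp: eventually_at_right_field intro: exI[of _ 1] exI[of _ d])
  with pbox_small_subset[OF assms(2), of vs p]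
  show "\<forall>\<^sub>F s in at_right 0. dist ((1/s) *\<^sub>R flux (map (scaleR s) vs) F p) (\<Sum>i<length vs. L i (vs ! i)) < e"
    by eventually_elim (use d(2) \<open>e > 0\<close> in \<open>force simp: dist_norm\<close>)
qed

lemma flux_scaleR: "flux vs (\<lambda>i y. c *\<^sub>R F i y) x = c *\<^sub>R flux vs F x"
  by (induction vs arbitrary: x F) (auto simp: box_avg_scaleR scaleR_diff_right scaleR_add_right)

lemma flux_cong:
  "(\<And>i y. i < length vs \<Longrightarrow> y \<in> pbox vs x \<Longrightarrow> F i y = G i y) \<Longrightarrow> flux vs F x = flux vs G x"
proof (induction vs arbitrary: x F G)
  case (Cons v vs)
  have "box_avg vs (F 0) (x + v) = box_avg vs (G 0) (x + v)" "box_avg vs (F 0) x = box_avg vs (G 0) x"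
    using pbox_Cons_ends[of vs x v] Cons.prems by (auto intro!: box_avg_cong simp del: pbox.simps)
  moreover have "flux vs (\<lambda>i. F (Suc i)) (x + t *\<^sub>R v) = flux vs (\<lambda>i. G (Suc i)) (x + t *\<^sub>R v)"
    if "t \<in> {0..1}" for t
    using that pbox_ConsI[of _ vs x t v] Cons.prems by (intro Cons.IH) (auto simp del: pbox.simps)
  ultimately show ?case by (auto intro!: integral_cong)
qed simp

lemma drop_nth_simps [simp]:
  "drop_nth 0 (v # vs) = vs" "drop_nth (Suc i) (v # vs) = v # drop_nth i vs"
  by (simp_all add: drop_nth_def)

lemma map_drop_nth: "map f (drop_nth i vs) = drop_nth i (map f vs)"
  by (simp add: drop_nth_def take_map drop_map)

lemma length_drop_nth [simp]: "i < length vs \<Longrightarrow> length (drop_nth i vs) = length vs - 1"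
  by (auto simp: drop_nth_def)

lemma pbox_drop_nth:
  assumes "i < length vs"
  shows "pbox (drop_nth i vs) x \<subseteq> pbox vs x" "pbox (drop_nth i vs) (x + vs ! i) \<subseteq> pbox vs x"
  using assms
proof (induction vs arbitrary: i x)
  case (Cons v vs)
  {
    case 1
    then show ?case using Cons.IH(1) pbox_Cons_ends[of vs x v] by (cases i) (force simp del: pbox.simps, force)
  next
    case 2
    show ?case
    proof (cases i)
      case 0
      then show ?thesis using pbox_Cons_ends[of vs x v] by (simp del: pbox.simps)
    next
      case (Suc j)
      have "pbox (drop_nth j vs) (x + vs ! j + t *\<^sub>R v) \<subseteq> pbox vs (x + t *\<^sub>R v)" for t
        using Cons.IH(2)[of j "x + t *\<^sub>R v"] 2 Suc by (simp add: ac_simps)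
      then show ?thesis using Suc by (fastforce)
    qed
  }
qed simp_all

lemma flux_eq_sum:
  assumes "\<And>i. i < length vs \<Longrightarrow> continuous_on Q (F i)" "pbox vs x \<subseteq> Q"
  shows "flux vs F x
    = (\<Sum>i<length vs. box_avg (drop_nth i vs) (F i) (x + vs ! i) - box_avg (drop_nth i vs) (F i) x)"
  using assms
proof (induction vs arbitrary: x F)
  case (Cons v vs)
  let ?F = "\<lambda>i. F (Suc i)"
  have fc: "\<And>i. i < length vs \<Longrightarrow> continuous_on Q (?F i)" using Cons.prems(1) by simp
  have sub: "pbox (v # drop_nth i vs) (x + vs ! i) \<subseteq> Q" "pbox (v # drop_nth i vs) x \<subseteq> Q" if "i < length vs" for i
    using pbox_drop_nth[of "Suc i" "v # vs" x] that Cons.prems(2) by (auto simp del: pbox.simps)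
  have "integral {0..1} (\<lambda>t. flux vs ?F (x + t *\<^sub>R v)) = integral {0..1} (\<lambda>t. \<Sum>i<length vs.
      box_avg (drop_nth i vs) (?F i) (x + vs ! i + t *\<^sub>R v) - box_avg (drop_nth i vs) (?F i) (x + t *\<^sub>R v))"
    using pbox_ConsD[OF Cons.prems(2)] by (intro integral_cong) (simp add: Cons.IH[OF fc] ac_simps)
  also have "\<dots> = (\<Sum>i<length vs. integral {0..1} (\<lambda>t.
      box_avg (drop_nth i vs) (?F i) (x + vs ! i + t *\<^sub>R v) - box_avg (drop_nth i vs) (?F i) (x + t *\<^sub>R v)))"
    by (intro integral_sum integrable_diff integrable_continuous_real)
       (auto intro!: box_avg_continuous_line[OF fc] sub simp del: pbox.simps)
  also have "\<dots> = (\<Sum>i<length vs. box_avg (v # drop_nth i vs) (?F i) (x + vs ! i)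
      - box_avg (v # drop_nth i vs) (?F i) x)"
    unfolding box_avg.simps
    by (intro sum.cong refl integral_diff integrable_continuous_real)
       (auto intro!: box_avg_continuous_line[OF fc] sub simp del: pbox.simps)
  finally show ?case
    by (simp add: sum.lessThan_Suc_shift del: sum.lessThan_Suc box_avg.simps)
qed simp

lemma box_avg_time:
  "box_avg (map (Pair 0) ws @ [(1, 0)]) f (0, p) = box_avg ws (\<lambda>y. integral {0..1::real} (\<lambda>t. f (t, y))) p"
  by (induction ws arbitrary: p) auto

lemma pbox_time:
  "pbox (map (Pair 0) ws @ [(1, 0)]) (0::real, p) \<subseteq> {0..1} \<times> pbox ws p"
  by (induction ws arbitrary: p) force+

text \<open>
  In the product of the time interval with a space, the last edge \<open>(1, 0)\<close> is the time
  direction. Integrating time out first turns the lateral faces into the flux of the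
  time integrals, and leaves the difference of the end values on the base box.
\<close>

lemma flux_time:
  fixes F :: "nat \<Rightarrow> real \<times> 'a::real_normed_vector \<Rightarrow> 'w::banach"
  assumes "\<And>i. i \<le> length ws \<Longrightarrow> continuous_on ({0..1} \<times> Q) (F i)" "pbox ws p \<subseteq> Q"
  shows "flux (map (Pair 0) ws @ [(1, 0)]) F (0, p)
    = flux ws (\<lambda>i y. integral {0..1} (\<lambda>t. F i (t, y))) p
      + box_avg ws (\<lambda>y. F (length ws) (1, y) - F (length ws) (0, y)) p"
  using assms
proof (induction ws arbitrary: p F)
  case Nil
  then show ?case by simp
next
  case (Cons v ws)
  let ?F = "\<lambda>i. F (Suc i)" and ?us = "map (Pair 0) ws @ [(1, 0)]"
  let ?G = "\<lambda>i y. integral {0..1} (\<lambda>t. ?F i (t, y))"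
  let ?g = "\<lambda>y. ?F (length ws) (1, y) - ?F (length ws) (0, y)"
  have fc: "\<And>i. i \<le> length ws \<Longrightarrow> continuous_on ({0..1} \<times> Q) (?F i)" using Cons.prems(1) by simp
  have Gc: "continuous_on Q (?G i)" if "i < length ws" for i
  proof -
    have "continuous_on (Q \<times> cbox 0 1) (\<lambda>(y, t). ?F i (t, y))"
      unfolding split_def by (rule continuous_on_compose2[OF fc[of i]]) (use that in \<open>auto intro!: continuous_intros\<close>)
    from integral_continuous_on_param[OF this] show ?thesis by simp
  qed
  have gc: "continuous_on Q ?g"
    by (intro continuous_on_diff; rule continuous_on_compose2[OF fc[of "length ws"]]) (auto intro!: continuous_intros)
  have "integral {0..1} (\<lambda>t. flux ?us ?F ((0, p) + t *\<^sub>R (0, v)))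
      = integral {0..1} (\<lambda>t. flux ws ?G (p + t *\<^sub>R v) + box_avg ws ?g (p + t *\<^sub>R v))"
    using pbox_ConsD[OF Cons.prems(2)] by (intro integral_cong) (simp add: Cons.IH[OF fc])
  also have "\<dots> = integral {0..1} (\<lambda>t. flux ws ?G (p + t *\<^sub>R v)) + integral {0..1} (\<lambda>t. box_avg ws ?g (p + t *\<^sub>R v))"
    by (intro integral_add integrable_continuous_real flux_continuous_line[OF Gc] box_avg_continuous_line[OF gc] Cons.prems(2))
  finally show ?case by (simp add: box_avg_time)
qed

section \<open>Alternating maps\<close>

lemma nth_drop_nth:
  "i < length vs \<Longrightarrow> j < length vs - 1 \<Longrightarrow> drop_nth i vs ! j = (if j < i then vs ! j else vs ! Suc j)"
  by (auto simp: drop_nth_def nth_append min_def)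

lemma drop_nth_update_same: "drop_nth i (vs[i := v]) = drop_nth i vs"
  by (simp add: drop_nth_def)

lemma drop_nth_update:
  assumes "i < length vs" "j < length vs" "i \<noteq> j"
  shows "drop_nth i (vs[j := v]) = (drop_nth i vs)[(if j < i then j else j - 1) := v]"
  using assms by (intro nth_equalityI) (auto simp: nth_drop_nth nth_list_update)

lemma drop_nth_drop_nth:
  assumes "i \<le> j" "Suc j < length vs"
  shows "drop_nth j (drop_nth i vs) = drop_nth i (drop_nth (Suc j) vs)"
  using assms by (intro nth_equalityI) (auto simp: nth_drop_nth)

lemma alternating_mapD:
  assumes "alternating_map k f"
  shows "length vs \<noteq> k \<Longrightarrow> f vs = 0"
    and "length vs = k \<Longrightarrow> i < k \<Longrightarrow> linear (\<lambda>v. f (vs[i := v]))"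
    and "length vs = k \<Longrightarrow> i < j \<Longrightarrow> j < k \<Longrightarrow> vs ! i = vs ! j \<Longrightarrow> f vs = 0"
  using assms unfolding alternating_map_def by blast+

lemma alternating_linear_slot:
  assumes "alternating_map k f"
  shows "linear (\<lambda>v. f (us @ v # ws))"
proof (cases "length us + Suc (length ws) = k")
  case True
  then show ?thesis
    using alternating_mapD(2)[OF assms, of "us @ undefined # ws" "length us"] by simp
next
  case False
  then have "f (us @ v # ws) = 0" for v using alternating_mapD(1)[OF assms] by simp
  then show ?thesis by (simp add: linear_zero)
qed

lemma alternating_linear_head: "alternating_map k f \<Longrightarrow> linear (\<lambda>v. f (v # ws))"
  using alternating_linear_slot[of k f "[]" ws] by simp

lemma alternating_repeated:
  assumes "alternating_map k f" "i < j" "j < length vs" "vs ! i = vs ! j"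
  shows "f vs = 0"
  using alternating_mapD(1,3)[OF assms(1)] assms by (cases "length vs = k") auto

lemma alternating_adjacent_swap:
  assumes f: "alternating_map k f"
  shows "f (us @ a # b # ws) = - f (us @ b # a # ws)"
proof -
  have z: "f (us @ c # c # ws) = 0" for c
    by (rule alternating_repeated[OF f, of "length us" "Suc (length us)"]) (auto simp: nth_append)
  have l1: "f (us @ (x + y) # v) = f (us @ x # v) + f (us @ y # v)" for x y v
    using linear_add[OF alternating_linear_slot[OF f, of us v]] .
  have l2: "f (us @ c # (x + y) # ws) = f (us @ c # x # ws) + f (us @ c # y # ws)" for c x y
    using linear_add[OF alternating_linear_slot[OF f, of "us @ [c]" ws], of x y] by simp
  have "f (us @ (a + b) # (a + b) # ws)
      = (f (us @ a # a # ws) + f (us @ a # b # ws)) + (f (us @ b # a # ws) + f (us @ b # b # ws))"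
    by (simp only: l1 l2 ac_simps)
  then have "f (us @ a # b # ws) + f (us @ b # a # ws) = 0"
    by (simp add: z)
  then show ?thesis by (simp add: eq_neg_iff_add_eq_0)
qed

lemma alternating_move_to_front:
  assumes f: "alternating_map k f"
  shows "f (us @ a # ws) = (-1) ^ length us *\<^sub>R f (a # us @ ws)"
proof (induction us arbitrary: ws rule: rev_induct)
  case (snoc b us)
  have "f ((us @ [b]) @ a # ws) = - f (us @ a # b # ws)"
    using alternating_adjacent_swap[OF f, of us b a ws] by simp
  then show ?case using snoc.IH[of "b # ws"] by simp
qed simp

lemma alternating_nth_to_front:
  assumes f: "alternating_map k f" and i: "i < length vs"
  shows "f (vs ! i # drop_nth i vs) = (-1) ^ i *\<^sub>R f vs"
proof -
  have "f vs = (-1) ^ i *\<^sub>R f (vs ! i # drop_nth i vs)"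
    using alternating_move_to_front[OF f, of "take i vs" "vs ! i" "drop (Suc i) vs"] i
    by (simp add: id_take_nth_drop[symmetric] drop_nth_def min_def)
  then show ?thesis by (simp flip: power_mult_distrib)
qed

text \<open>
  This supplies the factor \<open>k\<close> in \<open>d/dt (t ^ k)\<close>, which makes the powers of \<open>t\<close> cancel in
  the homotopy formula.
\<close>

lemma alternating_sum_insertions:
  assumes f: "alternating_map k f" and "length vs = k"
  shows "(\<Sum>i<k. (-1) ^ i *\<^sub>R f (vs ! i # drop_nth i vs)) = real k *\<^sub>R f vs"
proof -
  have "(-1) ^ i *\<^sub>R f (vs ! i # drop_nth i vs) = f vs" if "i < k" for i
    using alternating_nth_to_front[OF f, of i vs] that assms(2) by (simp flip: power_mult_distrib)
  then show ?thesis by (simp add: scaleR_conv_of_real sum_constant_scaleR)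
qed

text \<open>
  Moving the common argument to the front in both terms leaves the same list, and the two
  signs differ because one position has shifted by one.
\<close>

lemma alternating_drop_equal_pair:
  assumes f: "alternating_map k f" and "a < b" "b < length vs" "vs ! a = vs ! b"
  shows "(-1) ^ a *\<^sub>R f (drop_nth a vs) + (-1) ^ b *\<^sub>R f (drop_nth b vs) = 0"
proof -
  obtain c where b: "b = Suc c" "a \<le> c" using assms(2) by (cases b) auto
  have e: "drop_nth c (drop_nth a vs) = drop_nth a (drop_nth b vs)"
    using drop_nth_drop_nth[of a c vs] b assms(3) by simp
  let ?x = "f (vs ! a # drop_nth a (drop_nth b vs))"
  have "drop_nth a vs ! c = vs ! a" "drop_nth b vs ! a = vs ! a"
    using assms b by (auto simp: nth_drop_nth)
  then have h: "?x = (-1) ^ c *\<^sub>R f (drop_nth a vs)" "?x = (-1) ^ a *\<^sub>R f (drop_nth b vs)"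
    using alternating_nth_to_front[OF f, of c "drop_nth a vs"]
      alternating_nth_to_front[OF f, of a "drop_nth b vs"] assms b e by auto
  have "f (drop_nth a vs) = (-1) ^ c *\<^sub>R ?x"
    by (subst h(1)) (simp flip: power_mult_distrib)
  moreover have "f (drop_nth b vs) = (-1) ^ a *\<^sub>R ?x"
    by (subst h(2)) (simp flip: power_mult_distrib)
  ultimately show ?thesis by (simp add: b(1) mult.commute)
qed

lemma alternating_expand_head:
  fixes f :: "'a::euclidean_space list \<Rightarrow> 'w::real_vector"
  assumes "alternating_map k f"
  shows "f (u # ws) = (\<Sum>b\<in>Basis. (u \<bullet> b) *\<^sub>R f (b # ws))"
proof -
  have "f (u # ws) = f ((\<Sum>b\<in>Basis. (u \<bullet> b) *\<^sub>R b) # ws)" by (simp add: euclidean_representation)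
  also have "\<dots> = (\<Sum>b\<in>Basis. f (((u \<bullet> b) *\<^sub>R b) # ws))"
    by (rule linear_sum[OF alternating_linear_head[OF assms]])
  also have "\<dots> = (\<Sum>b\<in>Basis. (u \<bullet> b) *\<^sub>R f (b # ws))"
    by (intro sum.cong refl linear_cmul[OF alternating_linear_head[OF assms]])
  finally show ?thesis .
qed

lemma alternating_cong:
  "alternating_map k f \<Longrightarrow> (\<And>vs. g vs = f vs) \<Longrightarrow> alternating_map k g"
  by (simp add: alternating_map_def)

lemma alternating_add:
  assumes "alternating_map k f" "alternating_map k g"
  shows "alternating_map k (\<lambda>vs. f vs + g vs)"
  using assms unfolding alternating_map_def by (auto intro!: linear_compose_add)

lemma alternating_scaleR:
  assumes "alternating_map k f"
  shows "alternating_map k (\<lambda>vs. c *\<^sub>R f vs)"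
  using assms unfolding alternating_map_def by (auto intro!: linear_compose_scale_right)

lemma alternating_zero: "alternating_map k (\<lambda>vs. 0)"
  unfolding alternating_map_def by (auto simp: linear_zero)

lemma alternating_head:
  assumes "alternating_map (Suc k) f"
  shows "alternating_map k (\<lambda>ws. f (u # ws))"
  unfolding alternating_map_def
proof (intro conjI allI impI)
  fix ws :: "'a list" and i assume "length ws = k" "i < k"
  then show "linear (\<lambda>v. f (u # ws[i := v]))"
    using alternating_mapD(2)[OF assms, of "u # ws" "Suc i"] by simp
next
  fix ws :: "'a list" and i j assume "length ws = k" "i < j" "j < k" "ws ! i = ws ! j"
  then show "f (u # ws) = 0"
    using alternating_mapD(3)[OF assms, of "u # ws" "Suc i" "Suc j"] by simp
qed (use alternating_mapD(1)[OF assms] in auto)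

lemma wedge_alternating:
  assumes A: "alternating_map 1 (A x)" and w: "alternating_map k (\<omega> x)"
  shows "alternating_map (Suc k) (wedge A \<omega> x)"
  unfolding alternating_map_def
proof (intro conjI allI impI)
  fix vs :: "'a list" assume "length vs \<noteq> Suc k"
  then have "\<omega> x (drop_nth i vs) = 0" if "i < length vs" for i
    using alternating_mapD(1)[OF w, of "drop_nth i vs"] that by auto
  then show "wedge A \<omega> x vs = 0" by (auto simp: wedge_def intro!: sum.neutral)
next
  fix vs :: "'a list" and j assume vs: "length vs = Suc k" "j < Suc k"
  have "linear (\<lambda>v. (-1) ^ i *\<^sub>R blinfun_apply (A x [vs[j := v] ! i]) (\<omega> x (drop_nth i (vs[j := v]))))"
    if i: "i < Suc k" for i
  proof (cases "i = j")
    case True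
    have "linear (\<lambda>v. A x [v])" using alternating_linear_head[OF A, of "[]"] .
    then show ?thesis using True vs
      by (intro linear_compose_scale_right) (simp add: drop_nth_update_same linear_iff blinfun.add_left blinfun.scaleR_left)
  next
    case False
    have "linear (\<lambda>v. \<omega> x ((drop_nth i vs)[(if j < i then j else j - 1) := v]))"
      by (rule alternating_mapD(2)[OF w]) (use False vs i in auto)
    then show ?thesis using False vs i
      by (intro linear_compose_scale_right) (simp add: drop_nth_update linear_iff blinfun.add_right blinfun.scaleR_right)
  qed
  then show "linear (\<lambda>v. wedge A \<omega> x (vs[j := v]))"
    unfolding wedge_def length_list_update using vs by (intro linear_compose_sum) auto
next
  fix vs :: "'a list" and a b assume vs: "length vs = Suc k" "a < b" "b < Suc k" "vs ! a = vs ! b"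
  let ?t = "\<lambda>i. (-1) ^ i *\<^sub>R blinfun_apply (A x [vs ! i]) (\<omega> x (drop_nth i vs))"
  have z: "?t i = 0" if "i < Suc k" "i \<noteq> a" "i \<noteq> b" for i
  proof -
    have "\<omega> x (drop_nth i vs) = 0"
      by (rule alternating_repeated[OF w, of "if a < i then a else a - 1" "if b < i then b else b - 1"])
         (use vs that in \<open>auto simp: nth_drop_nth\<close>)
    then show ?thesis by simp
  qed
  have "wedge A \<omega> x vs = sum ?t {a, b}"
    unfolding wedge_def using vs z by (intro sum.mono_neutral_right) auto
  also have "\<dots> = blinfun_apply (A x [vs ! a])
      ((-1) ^ a *\<^sub>R \<omega> x (drop_nth a vs) + (-1) ^ b *\<^sub>R \<omega> x (drop_nth b vs))"
    using vs by (simp add: blinfun.add_right blinfun.scaleR_right)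
  also have "\<dots> = 0" using alternating_drop_equal_pair[OF w, of a b vs] vs by simp
  finally show "wedge A \<omega> x vs = 0" .
qed

section \<open>Derivatives of coefficients\<close>

text \<open>
  The directional derivative of a form, as a form again: the coefficients are
  differentiated with constant arguments, so that for fixed \<open>v\<close> the degree is kept.
\<close>

definition coeff_deriv ::
  "('a::real_normed_vector \<Rightarrow> 'a list \<Rightarrow> 'w::real_normed_vector) \<Rightarrow> 'a \<Rightarrow> 'a \<Rightarrow> 'a list \<Rightarrow> 'w" where
  "coeff_deriv \<omega> v x vs = frechet_derivative (\<lambda>y. \<omega> y vs) (at x) v"

lemma ext_deriv_coeff:
  "ext_deriv \<omega> x vs = (\<Sum>i<length vs. (-1) ^ i *\<^sub>R coeff_deriv \<omega> (vs ! i) x (drop_nth i vs))"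
  by (simp add: ext_deriv_def coeff_deriv_def)

lemma ext_deriv_Cons:
  "ext_deriv \<omega> x (u # vs) = coeff_deriv \<omega> u x vs
     - (\<Sum>i<length vs. (-1) ^ i *\<^sub>R coeff_deriv \<omega> (vs ! i) x (u # drop_nth i vs))"
  by (simp add: ext_deriv_coeff sum.lessThan_Suc_shift sum_negf del: sum.lessThan_Suc)

lemma coeff_deriv_unique:
  "((\<lambda>y. \<omega> y vs) has_derivative D) (at x) \<Longrightarrow> coeff_deriv \<omega> v x vs = D v"
  unfolding coeff_deriv_def using frechet_derivative_at by metis

lemma coeff_has_derivative:
  assumes "differentiable_form S \<omega>" "open S" "x \<in> S"
  shows "((\<lambda>y. \<omega> y vs) has_derivative (\<lambda>v. coeff_deriv \<omega> v x vs)) (at x)"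
proof -
  have "(\<lambda>y. \<omega> y vs) differentiable (at x within S)"
    using assms unfolding differentiable_form_def differentiable_on_def by blast
  then have "(\<lambda>y. \<omega> y vs) differentiable (at x)" using at_within_open[OF assms(3,2)] by simp
  then show ?thesis unfolding coeff_deriv_def using frechet_derivative_works by blast
qed

lemma coeff_deriv_cong:
  assumes "open S" "x \<in> S" "\<And>y. y \<in> S \<Longrightarrow> \<omega> y vs = \<eta> y vs'"
  shows "coeff_deriv \<omega> v x vs = coeff_deriv \<eta> v x vs'"
proof -
  have "((\<lambda>y. \<omega> y vs) has_derivative D) (at x) \<longleftrightarrow> ((\<lambda>y. \<eta> y vs') has_derivative D) (at x)" for D
    using has_derivative_transform_within_open[of "\<lambda>y. \<omega> y vs" D x UNIV S "\<lambda>y. \<eta> y vs'"]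
      has_derivative_transform_within_open[of "\<lambda>y. \<eta> y vs'" D x UNIV S "\<lambda>y. \<omega> y vs"] assms by auto
  then show ?thesis unfolding coeff_deriv_def frechet_derivative_def by simp
qed

lemma ext_deriv_cong:
  assumes "open S" "x \<in> S" "\<And>y vs. y \<in> S \<Longrightarrow> \<omega> y vs = \<eta> y vs"
  shows "ext_deriv \<omega> x vs = ext_deriv \<eta> x vs"
  unfolding ext_deriv_coeff by (intro sum.cong refl arg_cong2[where f = scaleR] coeff_deriv_cong[OF assms(1,2)] assms(3))

lemma differentiable_form_cong:
  assumes "differentiable_form S \<omega>" "\<And>y vs. y \<in> S \<Longrightarrow> \<eta> y vs = \<omega> y vs"
  shows "differentiable_form S \<eta>"
  unfolding differentiable_form_def differentiable_on_def
proof (intro allI ballI)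
  fix vs x assume x: "x \<in> S"
  then have "(\<lambda>y. \<omega> y vs) differentiable (at x within S)"
    using assms(1) by (simp add: differentiable_form_def differentiable_on_def)
  then show "(\<lambda>y. \<eta> y vs) differentiable (at x within S)"
    by (rule differentiable_transform_within[where d = 1]) (use x assms(2) in auto)
qed

lemma coeff_deriv_alternating:
  assumes S: "open S" "x \<in> S" and d: "differentiable_form S \<omega>" and a: "\<And>y. y \<in> S \<Longrightarrow> alternating_map k (\<omega> y)"
  shows "alternating_map k (coeff_deriv \<omega> v x)"
  unfolding alternating_map_def
proof (intro conjI allI impI)
  have zero: "coeff_deriv \<omega> v x vs = 0" if "\<And>y. y \<in> S \<Longrightarrow> \<omega> y vs = 0" for vs
  proof -
    have "coeff_deriv \<omega> v x vs = coeff_deriv (\<lambda>y vs. 0) v x vs"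
      by (rule coeff_deriv_cong[OF S]) (use that in auto)
    then show ?thesis by (simp add: coeff_deriv_def)
  qed
  show "coeff_deriv \<omega> v x vs = 0" if "length vs \<noteq> k" for vs
    by (rule zero) (use a that alternating_mapD(1) in blast)
  show "coeff_deriv \<omega> v x vs = 0" if "length vs = k" "i < j" "j < k" "vs ! i = vs ! j" for vs i j
    by (rule zero) (use a that alternating_mapD(3) in blast)
  fix vs :: "'a list" and i assume vs: "length vs = k" "i < k"
  note D = coeff_has_derivative[OF d S]
  have lin: "linear (\<lambda>u. \<omega> y (vs[i := u]))" if "y \<in> S" for y
    using alternating_mapD(2)[OF a[OF that] vs] .
  show "linear (\<lambda>u. coeff_deriv \<omega> v x (vs[i := u]))"
  proof (rule linearI)
    fix u w
    have "((\<lambda>y. \<omega> y (vs[i := u + w])) has_derivative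
       (\<lambda>v. coeff_deriv \<omega> v x (vs[i := u]) + coeff_deriv \<omega> v x (vs[i := w]))) (at x)"
      by (rule has_derivative_transform_within_open[OF has_derivative_add[OF D D] S])
         (simp add: linear_add[OF lin])
    then show "coeff_deriv \<omega> v x (vs[i := u + w]) = coeff_deriv \<omega> v x (vs[i := u]) + coeff_deriv \<omega> v x (vs[i := w])"
      by (rule coeff_deriv_unique)
  next
    fix r u
    have "((\<lambda>y. \<omega> y (vs[i := r *\<^sub>R u])) has_derivative (\<lambda>v. r *\<^sub>R coeff_deriv \<omega> v x (vs[i := u]))) (at x)"
      by (rule has_derivative_transform_within_open[OF has_derivative_scaleR_right[OF D] S])
         (simp add: linear_cmul[OF lin])
    then show "coeff_deriv \<omega> v x (vs[i := r *\<^sub>R u]) = r *\<^sub>R coeff_deriv \<omega> v x (vs[i := u])"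
      by (rule coeff_deriv_unique)
  qed
qed

lemma coeff_deriv_linear:
  assumes "differentiable_form S \<omega>" "open S" "x \<in> S"
  shows "linear (\<lambda>v. coeff_deriv \<omega> v x vs)"
  using has_derivative_linear[OF coeff_has_derivative[OF assms]] .

text \<open>
  Product rule when both the base point and the first argument depend on \<open>z\<close>. The
  coefficients of a form are only differentiable for fixed arguments; expanding the
  first argument in the basis reduces to that case.
\<close>

lemma has_derivative_form_head:
  fixes \<omega> :: "'a::euclidean_space \<Rightarrow> 'a list \<Rightarrow> 'w::real_normed_vector"
  assumes S: "open S" and d: "differentiable_form S \<omega>" and a: "\<And>y. y \<in> S \<Longrightarrow> alternating_map k (\<omega> y)"
    and g: "(g has_derivative g') (at z)" "g z \<in> S" and u: "(u has_derivative u') (at z)"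
  shows "((\<lambda>z. \<omega> (g z) (u z # ws)) has_derivative
           (\<lambda>h. coeff_deriv \<omega> (g' h) (g z) (u z # ws) + \<omega> (g z) (u' h # ws))) (at z)"
proof -
  have ev: "\<forall>\<^sub>F y in at z. g y \<in> S"
    using topological_tendstoD[of g "g z" "at z" S] has_derivative_continuous[OF g(1)] S g(2)
    by (simp add: continuous_at)
  have 1: "((\<lambda>y. \<omega> (g y) (b # ws)) has_derivative (\<lambda>h. coeff_deriv \<omega> (g' h) (g z) (b # ws))) (at z)" for b
    using has_derivative_compose[OF g(1) coeff_has_derivative[OF d S g(2)]] .
  have 2: "((\<lambda>y. u y \<bullet> b) has_derivative (\<lambda>h. u' h \<bullet> b)) (at z)" for b
    using has_derivative_inner_left[OF u] .
  have "((\<lambda>y. \<Sum>b\<in>Basis. (u y \<bullet> b) *\<^sub>R \<omega> (g y) (b # ws)) has_derivative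
     (\<lambda>h. \<Sum>b\<in>Basis. (u z \<bullet> b) *\<^sub>R coeff_deriv \<omega> (g' h) (g z) (b # ws) + (u' h \<bullet> b) *\<^sub>R \<omega> (g z) (b # ws))) (at z)"
    by (intro has_derivative_sum has_derivative_scaleR 1 2)
  moreover have "(\<Sum>b\<in>Basis. (u z \<bullet> b) *\<^sub>R coeff_deriv \<omega> (g' h) (g z) (b # ws) + (u' h \<bullet> b) *\<^sub>R \<omega> (g z) (b # ws))
      = coeff_deriv \<omega> (g' h) (g z) (u z # ws) + \<omega> (g z) (u' h # ws)" for h
    unfolding sum.distrib
    using alternating_expand_head[OF coeff_deriv_alternating[OF S g(2) d a], of "g' h" "u z" ws]
      alternating_expand_head[OF a[OF g(2)], of "u' h" ws] by metis
  ultimately have D: "((\<lambda>y. \<Sum>b\<in>Basis. (u y \<bullet> b) *\<^sub>R \<omega> (g y) (b # ws)) has_derivative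
     (\<lambda>h. coeff_deriv \<omega> (g' h) (g z) (u z # ws) + \<omega> (g z) (u' h # ws))) (at z)"
    by simp
  have e: "\<omega> (g y) (u y # ws) = (\<Sum>b\<in>Basis. (u y \<bullet> b) *\<^sub>R \<omega> (g y) (b # ws))" if "g y \<in> S" for y
    by (rule alternating_expand_head[OF a[OF that]])
  show ?thesis
  proof (rule has_derivative_transform_eventually[OF D])
    show "\<forall>\<^sub>F y in at z. (\<Sum>b\<in>Basis. (u y \<bullet> b) *\<^sub>R \<omega> (g y) (b # ws)) = \<omega> (g y) (u y # ws)"
      using ev by eventually_elim (rule e[symmetric])
  qed (use e[OF g(2)] in auto)
qed

lemma continuous_form_head:
  fixes \<omega> :: "'a::euclidean_space \<Rightarrow> 'a list \<Rightarrow> 'w::real_normed_vector"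
  assumes w: "continuous_form k S \<omega>" and g: "continuous_on T g" "g ` T \<subseteq> S" and u: "continuous_on T u"
  shows "continuous_on T (\<lambda>z. \<omega> (g z) (u z # ws))"
proof -
  have 1: "continuous_on T (\<lambda>y. \<omega> (g y) (b # ws))" for b
    using w g(2) by (intro continuous_on_compose2[OF _ g(1), of S "\<lambda>y. \<omega> y (b # ws)"]) (auto simp: Ck_form_def)
  have c: "continuous_on T (\<lambda>z. \<Sum>b\<in>Basis. (u z \<bullet> b) *\<^sub>R \<omega> (g z) (b # ws))"
    by (intro continuous_intros u 1)
  show ?thesis
  proof (rule continuous_on_eq[OF c])
    fix z assume "z \<in> T"
    then have "alternating_map k (\<omega> (g z))" using w g(2) by (auto simp: Ck_form_def)
    then show "(\<Sum>b\<in>Basis. (u z \<bullet> b) *\<^sub>R \<omega> (g z) (b # ws)) = \<omega> (g z) (u z # ws)"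
      by (rule alternating_expand_head[symmetric])
  qed
qed

section \<open>Exact differentiable forms are closed\<close>

text \<open>
  The cancellation behind \<open>d (d \<beta>) = 0\<close>: deleting \<open>i\<close> and then \<open>j \<ge> i\<close> is the same as
  deleting \<open>Suc j\<close> and then \<open>i\<close>, with the opposite sign.
\<close>

lemma sum_alternating_pairs:
  fixes g :: "nat \<Rightarrow> nat \<Rightarrow> 'w::real_vector"
  assumes "\<And>i j. i \<le> j \<Longrightarrow> j < n \<Longrightarrow> g i j = g (Suc j) i"
  shows "(\<Sum>i<Suc n. \<Sum>j<n. (-1) ^ (i + j) *\<^sub>R g i j) = 0"
proof -
  let ?f = "\<lambda>(i, j). (-1) ^ (i + j) *\<^sub>R g i j"
  let ?L = "{(i, j). i < Suc n \<and> j < n \<and> i \<le> j}" and ?U = "{(i, j). i < Suc n \<and> j < n \<and> j < i}"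
  have fin: "finite ?L" "finite ?U"
    by (rule finite_subset[of _ "{..<Suc n} \<times> {..<n}"]; auto)+
  have "sum ?f ?L = (\<Sum>p\<in>?U. - ?f p)"
    by (rule sum.reindex_bij_witness[where i = "\<lambda>(i, j). (j, i - 1)" and j = "\<lambda>(i, j). (Suc j, i)"])
       (auto simp: assms add.commute)
  then have z: "sum ?f ?L + sum ?f ?U = 0" by (simp add: sum_negf)
  have "(\<Sum>i<Suc n. \<Sum>j<n. (-1) ^ (i + j) *\<^sub>R g i j) = sum ?f ({..<Suc n} \<times> {..<n})"
    by (simp only: sum.cartesian_product)
  also have "{..<Suc n} \<times> {..<n} = ?L \<union> ?U" by auto
  also have "sum ?f (?L \<union> ?U) = 0"
    by (subst sum.union_disjoint) (use fin z in auto)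
  finally show ?thesis .
qed

lemma continuous_form_coeff: "continuous_form k S \<omega> \<Longrightarrow> continuous_on S (\<lambda>x. \<omega> x vs)"
  by (simp add: Ck_form_def)

lemma continuous_form_alternating: "continuous_form k S \<omega> \<Longrightarrow> x \<in> S \<Longrightarrow> alternating_map k (\<omega> x)"
  by (simp add: Ck_form_def)

lemma stokes_box:
  fixes \<beta> :: "'a::euclidean_space \<Rightarrow> 'a list \<Rightarrow> 'w::banach"
  assumes S: "open S" "closed Q" "Q \<subseteq> S" and d: "differentiable_form S \<beta>"
    and c: "continuous_on Q (\<lambda>y. ext_deriv \<beta> y ws)" and box: "pbox (map (scaleR s) ws) x \<subseteq> Q"
  shows "s *\<^sub>R box_avg (map (scaleR s) ws) (\<lambda>y. ext_deriv \<beta> y ws) x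
    = flux (map (scaleR s) ws) (\<lambda>j y. (-1) ^ j *\<^sub>R \<beta> y (drop_nth j ws)) x"
proof -
  have "box_avg (map (scaleR s) ws) (\<lambda>y. s *\<^sub>R ext_deriv \<beta> y ws) x
    = flux (map (scaleR s) ws) (\<lambda>j y. (-1) ^ j *\<^sub>R \<beta> y (drop_nth j ws)) x"
  proof (rule divergence_theorem_box[OF S(2) box])
    fix i q assume "q \<in> Q"
    then have q: "q \<in> S" using S(3) by auto
    show "((\<lambda>y. (-1) ^ i *\<^sub>R \<beta> y (drop_nth i ws)) has_derivative
        (\<lambda>v. (-1) ^ i *\<^sub>R coeff_deriv \<beta> v q (drop_nth i ws))) (at q within Q)"
      by (rule has_derivative_at_withinI[OF has_derivative_scaleR_right[OF coeff_has_derivative[OF d S(1) q]]])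
  next
    fix q assume "q \<in> Q"
    then have q: "q \<in> S" using S(3) by auto
    have "coeff_deriv \<beta> (s *\<^sub>R v) q vs = s *\<^sub>R coeff_deriv \<beta> v q vs" for v vs
      using linear_cmul[OF coeff_deriv_linear[OF d S(1) q]] .
    then show "s *\<^sub>R ext_deriv \<beta> q ws = (\<Sum>i<length (map (scaleR s) ws).
        (-1) ^ i *\<^sub>R coeff_deriv \<beta> (map (scaleR s) ws ! i) q (drop_nth i ws))"
      by (simp add: ext_deriv_coeff scaleR_sum_right mult.commute)
  qed (intro continuous_intros c)
  then show ?thesis by (simp add: box_avg_scaleR)
qed

text \<open>
  Second derivatives of \<open>\<beta>\<close> need not exist, so equality of mixed derivatives is not
  available. Instead the flux of \<open>d \<beta>\<close> through the boundary of a box is, by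
  Stokes on each face, a sum over codimension-two faces in which every face occurs twice
  with opposite signs. Dividing by the size of a shrinking box gives \<open>d \<theta>\<close> at its corner.
\<close>

lemma ext_deriv_exact_zero:
  fixes \<beta> \<theta> :: "'a::euclidean_space \<Rightarrow> 'a list \<Rightarrow> 'w::banach"
  assumes S: "open S" and \<beta>: "d_continuous_form m S \<beta>"
    and \<theta>: "\<And>x vs. x \<in> S \<Longrightarrow> \<theta> x vs = ext_deriv \<beta> x vs" "differentiable_form S \<theta>" and p: "p \<in> S"
  shows "ext_deriv \<theta> p vs = 0"
proof (cases "length vs = Suc (Suc m)")
  case False
  have "alternating_map (Suc m) (\<theta> y)" if "y \<in> S" for y
    using \<beta> that \<theta>(1) alternating_cong[of "Suc m" "ext_deriv \<beta> y"] by (auto simp: d_continuous_form_def Ck_form_def)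
  then have a: "alternating_map (Suc m) (coeff_deriv \<theta> v p)" for v
    by (rule coeff_deriv_alternating[OF S p \<theta>(2)])
  show ?thesis unfolding ext_deriv_coeff
    by (intro sum.neutral ballI) (use False alternating_mapD(1)[OF a] in auto)
next
  case True
  have db: "differentiable_form S \<beta>" and cb: "continuous_form m S \<beta>" and ct: "continuous_form (Suc m) S (ext_deriv \<beta>)"
    using \<beta> by (auto simp: d_continuous_form_def)
  obtain R where R: "R > 0" "cball p R \<subseteq> S" using S p open_contains_cball by blast
  let ?Q = "cball p R"
  have cbQ: "continuous_on ?Q (\<lambda>y. \<beta> y l)" for l
    using continuous_on_subset[OF continuous_form_coeff[OF cb] R(2)] .
  have ctQ: "continuous_on ?Q (\<lambda>y. ext_deriv \<beta> y l)" for l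
    using continuous_on_subset[OF continuous_form_coeff[OF ct] R(2)] .
  let ?G = "\<lambda>i y. (-1) ^ i *\<^sub>R ext_deriv \<beta> y (drop_nth i vs)"
  have cG: "continuous_on ?Q (?G i)" for i by (intro continuous_intros ctQ)
  have zero: "(1/s) *\<^sub>R flux (map (scaleR s) vs) ?G p = 0"
    if s: "0 < s" and box: "pbox (map (scaleR s) vs) p \<subseteq> ?Q" for s
  proof -
    let ?X = "\<lambda>l y. box_avg (map (scaleR s) l) (\<lambda>y. \<beta> y l) y"
    let ?b = "\<lambda>i y. box_avg (map (scaleR s) (drop_nth i vs)) (\<lambda>y. ext_deriv \<beta> y (drop_nth i vs)) y"
    have inner: "s *\<^sub>R ?b i y = (\<Sum>j<Suc m. (-1) ^ j *\<^sub>R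
        (?X (drop_nth j (drop_nth i vs)) (y + s *\<^sub>R (drop_nth i vs ! j)) - ?X (drop_nth j (drop_nth i vs)) y))"
      if i: "i < Suc (Suc m)" and y: "pbox (map (scaleR s) (drop_nth i vs)) y \<subseteq> ?Q" for i y
    proof -
      have "s *\<^sub>R ?b i y = flux (map (scaleR s) (drop_nth i vs)) (\<lambda>j y. (-1) ^ j *\<^sub>R \<beta> y (drop_nth j (drop_nth i vs))) y"
        by (rule stokes_box[OF S closed_cball R(2) db ctQ y])
      also have "\<dots> = (\<Sum>j<length (map (scaleR s) (drop_nth i vs)).
          box_avg (drop_nth j (map (scaleR s) (drop_nth i vs))) (\<lambda>y. (-1) ^ j *\<^sub>R \<beta> y (drop_nth j (drop_nth i vs)))
            (y + map (scaleR s) (drop_nth i vs) ! j)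
          - box_avg (drop_nth j (map (scaleR s) (drop_nth i vs))) (\<lambda>y. (-1) ^ j *\<^sub>R \<beta> y (drop_nth j (drop_nth i vs))) y)"
        by (rule flux_eq_sum[OF _ y]) (intro continuous_intros cbQ)
      also have "\<dots> = (\<Sum>j<Suc m. (-1) ^ j *\<^sub>R
        (?X (drop_nth j (drop_nth i vs)) (y + s *\<^sub>R (drop_nth i vs ! j)) - ?X (drop_nth j (drop_nth i vs)) y))"
        by (rule sum.cong) (use i True in \<open>auto simp: box_avg_scaleR map_drop_nth[symmetric] scaleR_diff_right\<close>)
      finally show ?thesis .
    qed
    \<comment> \<open>The contribution of the four parallel codimension-two faces without the edges \<open>i\<close> and \<open>j\<close>.\<close>
    define g where "g = (\<lambda>i j. ?X (drop_nth j (drop_nth i vs)) (p + s *\<^sub>R (vs ! i) + s *\<^sub>R (drop_nth i vs ! j))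
        - ?X (drop_nth j (drop_nth i vs)) (p + s *\<^sub>R (vs ! i))
        - (?X (drop_nth j (drop_nth i vs)) (p + s *\<^sub>R (drop_nth i vs ! j)) - ?X (drop_nth j (drop_nth i vs)) p))"
    have sub: "pbox (map (scaleR s) (drop_nth i vs)) (p + s *\<^sub>R (vs ! i)) \<subseteq> ?Q"
        "pbox (map (scaleR s) (drop_nth i vs)) p \<subseteq> ?Q" if "i < Suc (Suc m)" for i
      using pbox_drop_nth[of i "map (scaleR s) vs" p] that True box by (auto simp: map_drop_nth)
    have "s *\<^sub>R flux (map (scaleR s) vs) ?G p
      = (\<Sum>i<Suc (Suc m). (-1) ^ i *\<^sub>R (s *\<^sub>R ?b i (p + s *\<^sub>R (vs ! i)) - s *\<^sub>R ?b i p))"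
      by (subst flux_eq_sum[OF cG box])
         (simp add: True scaleR_sum_right box_avg_scaleR map_drop_nth[symmetric] scaleR_diff_right mult.commute
            del: sum.lessThan_Suc)
    also have "\<dots> = (\<Sum>i<Suc (Suc m). (-1) ^ i *\<^sub>R (\<Sum>j<Suc m. (-1) ^ j *\<^sub>R g i j))"
      by (intro sum.cong refl arg_cong2[where f = scaleR])
         (simp add: inner sub g_def flip: sum_subtractf scaleR_diff_right del: sum.lessThan_Suc)
    also have "\<dots> = (\<Sum>i<Suc (Suc m). \<Sum>j<Suc m. (-1) ^ (i + j) *\<^sub>R g i j)"
      by (simp add: scaleR_sum_right power_add del: sum.lessThan_Suc)
    also have "\<dots> = 0"
    proof (rule sum_alternating_pairs)
      fix i j assume ij: "i \<le> j" "j < Suc m"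
      have "drop_nth j (drop_nth i vs) = drop_nth i (drop_nth (Suc j) vs)"
        by (rule drop_nth_drop_nth) (use ij True in auto)
      moreover have "drop_nth i vs ! j = vs ! Suc j" "drop_nth (Suc j) vs ! i = vs ! i"
        using ij True by (auto simp: nth_drop_nth)
      ultimately show "g i j = g (Suc j) i" by (simp add: g_def algebra_simps)
    qed
    finally show ?thesis using s by simp
  qed
  have ev0: "\<forall>\<^sub>F s in at_right (0::real). 0 < s"
    by (simp add: eventually_at_right_less)
  have "\<forall>\<^sub>F s in at_right 0. (1/s) *\<^sub>R flux (map (scaleR s) vs) ?G p = 0"
    using ev0 pbox_small_subset[OF R(1), of vs p] by eventually_elim (use zero in blast)
  then have lim0: "((\<lambda>s. (1/s) *\<^sub>R flux (map (scaleR s) vs) ?G p) \<longlongrightarrow> 0) (at_right 0)"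
    by (rule tendsto_eventually)
  have "((\<lambda>s. (1/s) *\<^sub>R flux (map (scaleR s) vs) ?G p) \<longlongrightarrow>
      (\<Sum>i<length vs. (-1) ^ i *\<^sub>R coeff_deriv \<theta> (vs ! i) p (drop_nth i vs))) (at_right 0)"
  proof (rule flux_quotient_tendsto[OF cG R(1)])
    fix i
    have "((\<lambda>y. (-1) ^ i *\<^sub>R \<theta> y (drop_nth i vs)) has_derivative
        (\<lambda>v. (-1) ^ i *\<^sub>R coeff_deriv \<theta> v p (drop_nth i vs))) (at p)"
      by (rule has_derivative_scaleR_right[OF coeff_has_derivative[OF \<theta>(2) S p]])
    then show "((\<lambda>y. (-1) ^ i *\<^sub>R ext_deriv \<beta> y (drop_nth i vs)) has_derivative
        (\<lambda>v. (-1) ^ i *\<^sub>R coeff_deriv \<theta> v p (drop_nth i vs))) (at p)"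
      by (rule has_derivative_transform_within_open[OF _ S p]) (simp add: \<theta>(1))
  qed
  from tendsto_unique[OF _ this lim0] show ?thesis by (simp add: ext_deriv_coeff)
qed

section \<open>The homotopy formula\<close>

locale star_domain =
  fixes S :: "'a::euclidean_space set" and x0 :: 'a
  assumes open_S: "open S" and center: "x0 \<in> S"
    and ray: "\<And>x t. x \<in> S \<Longrightarrow> 0 \<le> t \<Longrightarrow> t \<le> 1 \<Longrightarrow> x0 + t *\<^sub>R (x - x0) \<in> S"
begin

abbreviation H :: "('a \<Rightarrow> 'a list \<Rightarrow> 'w::banach) \<Rightarrow> 'a \<Rightarrow> 'a list \<Rightarrow> 'w" where
  "H \<equiv> homotopy_op x0"

lemma homotopy_integrand_continuous:
  fixes \<alpha> :: "'a \<Rightarrow> 'a list \<Rightarrow> 'w::banach"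
  assumes "continuous_form m S \<alpha>"
  shows "continuous_on (S \<times> {0..1})
    (\<lambda>(x, t). t ^ n *\<^sub>R \<alpha> (x0 + t *\<^sub>R (x - x0)) ((x - x0) # ws))"
  unfolding split_def
  by (intro continuous_intros continuous_form_head[OF assms]) (auto intro: ray)

lemma homotopy_integrable:
  fixes \<alpha> :: "'a \<Rightarrow> 'a list \<Rightarrow> 'w::banach"
  assumes "continuous_form m S \<alpha>" "x \<in> S"
  shows "(\<lambda>t. t ^ n *\<^sub>R \<alpha> (x0 + t *\<^sub>R (x - x0)) ((x - x0) # ws)) integrable_on {0..1}"
  by (intro integrable_continuous_real continuous_intros continuous_form_head[OF assms(1)])
     (use assms(2) in \<open>auto intro: ray\<close>)

lemma homotopy_continuous:
  fixes \<alpha> :: "'a \<Rightarrow> 'a list \<Rightarrow> 'w::banach"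
  assumes "continuous_form m S \<alpha>"
  shows "continuous_on S (\<lambda>x. H \<alpha> x ws)"
  unfolding homotopy_op_def
  using integral_continuous_on_param[of S 0 "1::real"
      "\<lambda>x t. t ^ length ws *\<^sub>R \<alpha> (x0 + t *\<^sub>R (x - x0)) ((x - x0) # ws)"]
    homotopy_integrand_continuous[OF assms]
  by simp

text \<open>
  For continuously differentiable forms one differentiates under the integral. Here the
  coefficients of \<open>\<omega>\<close> are only differentiable, and this is not possible. Instead pull \<open>\<omega>\<close>
  back along the cone map \<open>(t, y) \<mapsto> x0 + t (y - x0)\<close>: the pulled back
  coefficients have a continuous divergence, namely the integrand of \<open>H (d \<omega>)\<close>. The
  divergence theorem on \<open>[0, 1]\<close> times a small box gives the formula in integrated form,
  and letting the box shrink gives it at \<open>p\<close>, where \<open>H \<omega>\<close> is differentiable by assumption.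
\<close>

theorem homotopy_formula:
  fixes \<omega> :: "'a \<Rightarrow> 'a list \<Rightarrow> 'w::banach"
  assumes w: "d_continuous_form k S \<omega>" and k: "k > 0" and p: "p \<in> S"
    and Hd: "differentiable_form S (H \<omega>)" and vs: "length vs = k"
  shows "ext_deriv (H \<omega>) p vs + H (ext_deriv \<omega>) p vs = \<omega> p vs"
proof -
  have dw: "differentiable_form S \<omega>" and cw: "continuous_form k S \<omega>"
    and cd: "continuous_form (Suc k) S (ext_deriv \<omega>)"
    using w by (auto simp: d_continuous_form_def)
  note aw = continuous_form_alternating[OF cw]
  obtain R where R: "R > 0" "cball p R \<subseteq> S" using open_S p open_contains_cball by blast
  let ?Q = "cball p R" and ?c = "\<lambda>z. x0 + fst z *\<^sub>R (snd z - x0)"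
  have cS: "?c z \<in> S" if "z \<in> {0..1} \<times> ?Q" for z using that R(2) ray by auto
  have QS: "continuous_on ?Q f" if "continuous_on S f" for f :: "'a \<Rightarrow> 'w"
    using continuous_on_subset[OF that R(2)] .
  let ?G = "\<lambda>i y. (-1) ^ i *\<^sub>R H \<omega> y (drop_nth i vs)"
  have key: "box_avg (map (scaleR s) vs) (\<lambda>y. H (ext_deriv \<omega>) y vs) p
      = box_avg (map (scaleR s) vs) (\<lambda>y. \<omega> y vs) p - (1/s) *\<^sub>R flux (map (scaleR s) vs) ?G p"
    if s: "0 < s" and box: "pbox (map (scaleR s) vs) p \<subseteq> ?Q" for s
  proof -
    let ?ws = "map (scaleR s) vs"
    let ?us = "map (Pair 0) ?ws @ [(1::real, 0)]"
    \<comment> \<open>The component of \<open>\<omega>\<close> without \<open>dt\<close> belongs to the time edge, hence comes last. It is scaled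
      by \<open>s\<close> so that all directional derivatives along the scaled edges carry the factor \<open>s\<close>.\<close>
    define F where "F = (\<lambda>i z. if i < k
       then - ((-1) ^ i *\<^sub>R (fst z ^ (k - 1) *\<^sub>R \<omega> (?c z) ((snd z - x0) # drop_nth i vs)))
       else s *\<^sub>R (fst z ^ k *\<^sub>R \<omega> (?c z) vs))"
    define h where "h = (\<lambda>z. s *\<^sub>R (fst z ^ k *\<^sub>R ext_deriv \<omega> (?c z) ((snd z - x0) # vs)))"
    define F' where "F' = (\<lambda>i (z::real \<times> 'a) (u::real \<times> 'a). if i < k
       then - ((-1) ^ i *\<^sub>R (fst z ^ (k - 1) *\<^sub>R
             (coeff_deriv \<omega> (fst z *\<^sub>R snd u + fst u *\<^sub>R (snd z - x0)) (?c z) ((snd z - x0) # drop_nth i vs)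
              + \<omega> (?c z) (snd u # drop_nth i vs))
           + (real (k - 1) * (fst u * fst z ^ (k - 1 - 1))) *\<^sub>R \<omega> (?c z) ((snd z - x0) # drop_nth i vs)))
       else s *\<^sub>R (fst z ^ k *\<^sub>R coeff_deriv \<omega> (fst z *\<^sub>R snd u + fst u *\<^sub>R (snd z - x0)) (?c z) vs
           + (real k * (fst u * fst z ^ (k - 1))) *\<^sub>R \<omega> (?c z) vs))"
    have c': "(?c has_derivative (\<lambda>u. fst z *\<^sub>R snd u + fst u *\<^sub>R (snd z - x0))) (at z)" for z
      by (auto intro!: derivative_eq_intros)
    have u': "((\<lambda>z. snd z - x0) has_derivative snd) (at z)" for z :: "real \<times> 'a"
      by (auto intro!: derivative_eq_intros)
    have pw: "((\<lambda>z. fst z ^ n) has_derivative (\<lambda>u. real n * (fst u * fst z ^ (n - 1)))) (at z)"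
      for n and z :: "real \<times> 'a"
      by (rule has_derivative_eq_rhs[OF has_derivative_power[OF has_derivative_fst[OF has_derivative_ident]]])
         (simp add: fun_eq_iff)
    have FD: "(F i has_derivative F' i z) (at z)" if "?c z \<in> S" for i z
    proof (cases "i < k")
      case True
      show ?thesis unfolding F_def F'_def
        by (simp only: True if_True) (intro has_derivative_minus has_derivative_scaleR_right has_derivative_scaleR pw
            has_derivative_form_head[OF open_S dw aw c' that u'])
    next
      case False
      have "((\<lambda>z. \<omega> (?c z) vs) has_derivative
          (\<lambda>u. coeff_deriv \<omega> (fst z *\<^sub>R snd u + fst u *\<^sub>R (snd z - x0)) (?c z) vs)) (at z)"
        using has_derivative_compose[OF c' coeff_has_derivative[OF dw open_S that]] .
      then show ?thesis unfolding F_def F'_def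
        by (simp only: False if_False) (intro has_derivative_scaleR_right has_derivative_scaleR pw)
    qed
    have "box_avg ?us h (0, p) = flux ?us F (0, p)"
    proof (rule divergence_theorem_box[where Q = "{0..1} \<times> ?Q" and F' = F'])
      show "closed ({0..1::real} \<times> ?Q)" by (intro closed_Times) auto
      show "pbox ?us (0, p) \<subseteq> {0..1} \<times> ?Q" using pbox_time[of ?ws p] box by blast
      show "(F i has_derivative F' i q) (at q within {0..1} \<times> ?Q)" if "q \<in> {0..1} \<times> ?Q" for i q
        using FD[OF cS[OF that]] has_derivative_at_withinI by blast
      show "continuous_on ({0..1} \<times> ?Q) h" unfolding h_def
        by (intro continuous_intros continuous_form_head[OF cd]) (use cS in auto)
      fix z :: "real \<times> 'a" assume z: "z \<in> {0..1} \<times> ?Q"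
      let ?t = "fst z" and ?u = "snd z - x0"
      have lin: "linear (\<lambda>v. coeff_deriv \<omega> v (?c z) ws)" for ws
        using coeff_deriv_linear[OF dw open_S cS[OF z]] .
      have t1: "F' i z (?us ! i) = - ((-1) ^ i *\<^sub>R (?t ^ k *\<^sub>R (s *\<^sub>R coeff_deriv \<omega> (vs ! i) (?c z) (?u # drop_nth i vs))))
          - (s * ?t ^ (k - 1)) *\<^sub>R ((-1) ^ i *\<^sub>R \<omega> (?c z) (vs ! i # drop_nth i vs))" if "i < k" for i
      proof -
        have n: "?us ! i = (0, s *\<^sub>R (vs ! i))" using that vs by (simp add: nth_append)
        have tk: "?t ^ (k - 1) * ?t = ?t ^ k" using k by (metis power_minus_mult)
        show ?thesis unfolding F'_def n using that
          by (simp add: linear_cmul[OF lin] linear_cmul[OF alternating_linear_head[OF aw[OF cS[OF z]]]]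
               scaleR_add_right tk[symmetric] mult_ac)
      qed
      have t2: "F' k z (?us ! k) = s *\<^sub>R (?t ^ k *\<^sub>R coeff_deriv \<omega> ?u (?c z) vs)
          + (s * ?t ^ (k - 1)) *\<^sub>R (real k *\<^sub>R \<omega> (?c z) vs)"
      proof -
        have n: "?us ! k = (1, 0)" using vs by (simp add: nth_append)
        show ?thesis unfolding F'_def n by (simp add: scaleR_add_right mult_ac)
      qed
      have "(\<Sum>i<length ?us. F' i z (?us ! i)) = (\<Sum>i<k. F' i z (?us ! i)) + F' k z (?us ! k)"
        using vs by simp
      also have "(\<Sum>i<k. F' i z (?us ! i)) = - s *\<^sub>R (?t ^ k *\<^sub>R (\<Sum>i<k. (-1) ^ i *\<^sub>R coeff_deriv \<omega> (vs ! i) (?c z) (?u # drop_nth i vs)))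
          - (s * ?t ^ (k - 1)) *\<^sub>R (real k *\<^sub>R \<omega> (?c z) vs)"
      proof -
        have "(\<Sum>i<k. F' i z (?us ! i)) = (\<Sum>i<k. - ((-1) ^ i *\<^sub>R (?t ^ k *\<^sub>R (s *\<^sub>R coeff_deriv \<omega> (vs ! i) (?c z) (?u # drop_nth i vs))))
          - (s * ?t ^ (k - 1)) *\<^sub>R ((-1) ^ i *\<^sub>R \<omega> (?c z) (vs ! i # drop_nth i vs)))"
          by (intro sum.cong refl t1) auto
        also have "\<dots> = - s *\<^sub>R (?t ^ k *\<^sub>R (\<Sum>i<k. (-1) ^ i *\<^sub>R coeff_deriv \<omega> (vs ! i) (?c z) (?u # drop_nth i vs)))
          - (s * ?t ^ (k - 1)) *\<^sub>R (\<Sum>i<k. (-1) ^ i *\<^sub>R \<omega> (?c z) (vs ! i # drop_nth i vs))"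
          by (simp add: sum_subtractf sum_negf scaleR_sum_right mult_ac)
        finally show ?thesis unfolding alternating_sum_insertions[OF aw[OF cS[OF z]] vs] .
      qed
      also have "\<dots> + F' k z (?us ! k) = h z"
        unfolding t2 h_def ext_deriv_Cons vs by (simp add: scaleR_diff_right)
      finally show "h z = (\<Sum>i<length ?us. F' i z (?us ! i))" by simp
    qed
    moreover have "box_avg ?us h (0, p) = s *\<^sub>R box_avg ?ws (\<lambda>y. H (ext_deriv \<omega>) y vs) p"
      unfolding box_avg_time by (simp add: h_def homotopy_op_def vs box_avg_scaleR del: scaleR_scaleR)
    moreover have "flux ?us F (0, p) = - flux ?ws ?G p + s *\<^sub>R box_avg ?ws (\<lambda>y. \<omega> y vs) p"
    proof -
      have "continuous_on ({0..1} \<times> ?Q) (F i)" for i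
        unfolding continuous_on_eq_continuous_within
        using FD[OF cS] has_derivative_at_withinI has_derivative_continuous by blast
      then have "flux ?us F (0, p) = flux ?ws (\<lambda>i y. integral {0..1} (\<lambda>t. F i (t, y))) p
          + box_avg ?ws (\<lambda>y. F (length ?ws) (1, y) - F (length ?ws) (0, y)) p"
        by (intro flux_time[OF _ box])
      also have "flux ?ws (\<lambda>i y. integral {0..1} (\<lambda>t. F i (t, y))) p = flux ?ws (\<lambda>i y. (-1) *\<^sub>R ?G i y) p"
        by (rule flux_cong) (simp add: F_def vs homotopy_op_def del: scaleR_scaleR)
      also have "\<dots> = - flux ?ws ?G p" by (subst flux_scaleR) simp
      also have "(\<lambda>y. F (length ?ws) (1, y) - F (length ?ws) (0, y)) = (\<lambda>y. s *\<^sub>R \<omega> y vs)"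
        using k by (simp add: F_def vs zero_power)
      finally show ?thesis by (simp add: box_avg_scaleR)
    qed
    ultimately have "s *\<^sub>R box_avg ?ws (\<lambda>y. H (ext_deriv \<omega>) y vs) p
        = s *\<^sub>R (box_avg ?ws (\<lambda>y. \<omega> y vs) p - (1/s) *\<^sub>R flux ?ws ?G p)"
      using s by (simp add: scaleR_diff_right)
    then show ?thesis unfolding scaleR_cancel_left using s by blast
  qed
  have ev0: "\<forall>\<^sub>F s in at_right (0::real). 0 < s"
    by (simp add: eventually_at_right_less)
  have ev: "\<forall>\<^sub>F s in at_right 0. box_avg (map (scaleR s) vs) (\<lambda>y. \<omega> y vs) p - (1/s) *\<^sub>R flux (map (scaleR s) vs) ?G p
      = box_avg (map (scaleR s) vs) (\<lambda>y. H (ext_deriv \<omega>) y vs) p"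
    using ev0 pbox_small_subset[OF R(1), of vs p] by eventually_elim (use key in simp)
  have "((\<lambda>s. (1/s) *\<^sub>R flux (map (scaleR s) vs) ?G p) \<longlongrightarrow>
      (\<Sum>i<length vs. (-1) ^ i *\<^sub>R coeff_deriv (H \<omega>) (vs ! i) p (drop_nth i vs))) (at_right 0)"
    by (intro flux_quotient_tendsto[OF _ R(1)] has_derivative_scaleR_right coeff_has_derivative[OF Hd open_S p]
        continuous_intros QS homotopy_continuous[OF cw])
  then have "((\<lambda>s. box_avg (map (scaleR s) vs) (\<lambda>y. \<omega> y vs) p - (1/s) *\<^sub>R flux (map (scaleR s) vs) ?G p) \<longlongrightarrow>
      \<omega> p vs - ext_deriv (H \<omega>) p vs) (at_right 0)"
    unfolding ext_deriv_coeff
    by (intro tendsto_diff box_avg_tendsto[OF QS R(1)] continuous_form_coeff[OF cw])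
  from Lim_transform_eventually[OF this ev]
  have 1: "((\<lambda>s. box_avg (map (scaleR s) vs) (\<lambda>y. H (ext_deriv \<omega>) y vs) p) \<longlongrightarrow>
      \<omega> p vs - ext_deriv (H \<omega>) p vs) (at_right 0)" .
  have 2: "((\<lambda>s. box_avg (map (scaleR s) vs) (\<lambda>y. H (ext_deriv \<omega>) y vs) p) \<longlongrightarrow> H (ext_deriv \<omega>) p vs) (at_right 0)"
    by (intro box_avg_tendsto[OF QS R(1)] homotopy_continuous[OF cd])
  have "\<omega> p vs - ext_deriv (H \<omega>) p vs = H (ext_deriv \<omega>) p vs"
    by (rule tendsto_unique[OF trivial_limit_at_right_real 1 2])
  then show ?thesis by (simp add: algebra_simps)
qed

end

section \<open>Continuously differentiable forms\<close>

lemma C1_form_iff: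
  fixes \<omega> :: "'a::euclidean_space \<Rightarrow> 'a list \<Rightarrow> 'w::real_normed_vector"
  assumes S: "open S"
  shows "Ck_form 1 k S \<omega> \<longleftrightarrow> continuous_form k S \<omega> \<and> differentiable_form S \<omega> \<and>
    (\<forall>v. continuous_form k S (coeff_deriv \<omega> v))"
proof
  assume L: "Ck_form 1 k S \<omega>"
  have d: "differentiable_form S \<omega>" using L by (simp add: Ck_form_def differentiable_form_def)
  have c: "continuous_form k S \<omega>"
    using L by (simp add: Ck_form_def differentiable_imp_continuous_on)
  have "continuous_form k S (coeff_deriv \<omega> v)" for v
    using L coeff_deriv_alternating[OF S _ d continuous_form_alternating[OF c]]
    by (simp add: Ck_form_def coeff_deriv_def)
  with c d show "continuous_form k S \<omega> \<and> differentiable_form S \<omega> \<and>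
    (\<forall>v. continuous_form k S (coeff_deriv \<omega> v))" by blast
qed (auto simp: Ck_form_def differentiable_form_def coeff_deriv_def)

lemma C1_formD:
  fixes \<omega> :: "'a::euclidean_space \<Rightarrow> 'a list \<Rightarrow> 'w::real_normed_vector"
  assumes "open S" "Ck_form 1 k S \<omega>"
  shows "continuous_form k S \<omega>" "differentiable_form S \<omega>" "continuous_form k S (coeff_deriv \<omega> v)"
  using C1_form_iff[OF assms(1)] assms(2) by blast+

lemma continuous_form_cong:
  assumes "continuous_form k S \<omega>" "\<And>x vs. x \<in> S \<Longrightarrow> \<eta> x vs = \<omega> x vs"
  shows "continuous_form k S \<eta>"
  using assms alternating_cong[of k "\<omega> x" "\<eta> x" for x]
  unfolding Ck_form_def by (auto simp: cong: continuous_on_cong)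

lemma continuous_form_subset: "continuous_form k S \<omega> \<Longrightarrow> T \<subseteq> S \<Longrightarrow> continuous_form k T \<omega>"
  by (auto simp: Ck_form_def intro: continuous_on_subset)

lemma continuous_form_add:
  "continuous_form k S \<omega> \<Longrightarrow> continuous_form k S \<eta> \<Longrightarrow> continuous_form k S (\<lambda>x vs. \<omega> x vs + \<eta> x vs)"
  by (auto simp: Ck_form_def intro!: continuous_on_add alternating_add)

lemma continuous_form_scaleR:
  "continuous_form k S \<omega> \<Longrightarrow> continuous_form k S (\<lambda>x vs. c *\<^sub>R \<omega> x vs)"
  by (auto simp: Ck_form_def intro!: continuous_on_scaleR continuous_on_const alternating_scaleR)

lemma continuous_form_diff:
  "continuous_form k S \<omega> \<Longrightarrow> continuous_form k S \<eta> \<Longrightarrow> continuous_form k S (\<lambda>x vs. \<omega> x vs - \<eta> x vs)"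
  using continuous_form_add[of k S \<omega> "\<lambda>x vs. (-1) *\<^sub>R \<eta> x vs"] continuous_form_scaleR[of k S \<eta> "-1"] by simp

lemma continuous_form_zero: "continuous_form k S (\<lambda>x vs. 0)"
  by (simp add: Ck_form_def alternating_zero)

lemma wedge_cong: "(\<And>vs. \<omega> x vs = \<eta> x vs) \<Longrightarrow> wedge A \<omega> x vs = wedge A \<eta> x vs"
  by (simp add: wedge_def)

lemma wedge_add: "wedge A (\<lambda>x vs. \<omega> x vs + \<eta> x vs) x vs = wedge A \<omega> x vs + wedge A \<eta> x vs"
  by (simp add: wedge_def blinfun.add_right scaleR_add_right sum.distrib)

lemma wedge_diff: "wedge A (\<lambda>x vs. \<omega> x vs - \<eta> x vs) x vs = wedge A \<omega> x vs - wedge A \<eta> x vs"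
  by (simp add: wedge_def blinfun.diff_right scaleR_diff_right sum_subtractf)

lemma wedge_scaleR: "wedge A (\<lambda>x vs. c *\<^sub>R \<omega> x vs) x vs = c *\<^sub>R wedge A \<omega> x vs"
  by (simp add: wedge_def blinfun.scaleR_right scaleR_sum_right mult.commute)

lemma wedge_zero: "wedge A (\<lambda>x vs. 0) x vs = 0"
  by (simp add: wedge_def)

lemma wedge_continuous_form:
  assumes A: "continuous_form 1 S A" and w: "continuous_form k S \<omega>"
  shows "continuous_form (Suc k) S (wedge A \<omega>)"
  unfolding Ck_form_def
proof (intro conjI ballI allI)
  show "alternating_map (Suc k) (wedge A \<omega> x)" if "x \<in> S" for x
    by (intro wedge_alternating continuous_form_alternating[OF A that] continuous_form_alternating[OF w that])
  show "Ck_on 0 (\<lambda>x. wedge A \<omega> x vs) S" for vs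
    unfolding wedge_def Ck_on.simps
    by (intro continuous_intros continuous_form_coeff[OF A] continuous_form_coeff[OF w])
qed

lemma wedge_has_derivative:
  assumes S: "open S" "x \<in> S" and A: "differentiable_form S A" and w: "differentiable_form S \<omega>"
  shows "((\<lambda>y. wedge A \<omega> y vs) has_derivative (\<lambda>v. \<Sum>i<length vs. (-1) ^ i *\<^sub>R
     (blinfun_apply (A x [vs ! i]) (coeff_deriv \<omega> v x (drop_nth i vs))
      + blinfun_apply (coeff_deriv A v x [vs ! i]) (\<omega> x (drop_nth i vs))))) (at x)"
  unfolding wedge_def
  by (intro has_derivative_sum has_derivative_scaleR_right
      bounded_bilinear.FDERIV[OF bounded_bilinear_blinfun_apply] coeff_has_derivative[OF A S] coeff_has_derivative[OF w S])

lemma wedge_coeff_deriv: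
  assumes S: "open S" "x \<in> S" and A: "differentiable_form S A" and w: "differentiable_form S \<omega>"
  shows "coeff_deriv (wedge A \<omega>) v x vs = (\<Sum>i<length vs. (-1) ^ i *\<^sub>R
     (blinfun_apply (A x [vs ! i]) (coeff_deriv \<omega> v x (drop_nth i vs))
      + blinfun_apply (coeff_deriv A v x [vs ! i]) (\<omega> x (drop_nth i vs))))"
  by (rule coeff_deriv_unique[OF wedge_has_derivative[OF assms]])

lemma differentiable_formI:
  assumes "\<And>x vs. x \<in> S \<Longrightarrow> ((\<lambda>y. \<omega> y vs) has_derivative D x vs) (at x)"
  shows "differentiable_form S \<omega>"
  unfolding differentiable_form_def differentiable_on_def
  using assms by (metis differentiableI differentiable_at_withinI)

lemma differentiable_form_subset: "differentiable_form S \<omega> \<Longrightarrow> T \<subseteq> S \<Longrightarrow> differentiable_form T \<omega>"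
  by (auto simp: differentiable_form_def intro: differentiable_on_subset)

lemma wedge_differentiable:
  assumes "open S" "differentiable_form S A" "differentiable_form S \<omega>"
  shows "differentiable_form S (wedge A \<omega>)"
  by (rule differentiable_formI[OF wedge_has_derivative]) (use assms in auto)

lemma wedge_C1_form:
  fixes A :: "'a::euclidean_space \<Rightarrow> 'a list \<Rightarrow> 'w \<Rightarrow>\<^sub>L 'w::real_normed_vector"
  assumes S: "open S" and A: "Ck_form 1 1 S A" and w: "Ck_form 1 k S \<omega>"
  shows "Ck_form 1 (Suc k) S (wedge A \<omega>)"
proof -
  note A' = C1_formD[OF S A] and w' = C1_formD[OF S w]
  have c: "continuous_form (Suc k) S (wedge A \<omega>)" by (rule wedge_continuous_form[OF A'(1) w'(1)])
  have d: "differentiable_form S (wedge A \<omega>)" by (rule wedge_differentiable[OF S A'(2) w'(2)])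
  have "continuous_form (Suc k) S (coeff_deriv (wedge A \<omega>) v)" for v
    unfolding Ck_form_def Ck_on.simps
  proof (intro conjI ballI allI)
    show "alternating_map (Suc k) (coeff_deriv (wedge A \<omega>) v x)" if "x \<in> S" for x
      by (rule coeff_deriv_alternating[OF S that d continuous_form_alternating[OF c]])
    fix vs
    have "continuous_on S (\<lambda>x. \<Sum>i<length vs. (-1) ^ i *\<^sub>R
     (blinfun_apply (A x [vs ! i]) (coeff_deriv \<omega> v x (drop_nth i vs))
      + blinfun_apply (coeff_deriv A v x [vs ! i]) (\<omega> x (drop_nth i vs))))"
      by (intro continuous_intros continuous_form_coeff[OF A'(1)] continuous_form_coeff[OF w'(1)]
         continuous_form_coeff[OF A'(3)] continuous_form_coeff[OF w'(3)])
    then show "continuous_on S (\<lambda>x. coeff_deriv (wedge A \<omega>) v x vs)"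
      by (rule continuous_on_eq) (simp add: wedge_coeff_deriv[OF S _ A'(2) w'(2)])
  qed
  with c d show ?thesis unfolding C1_form_iff[OF S] by blast
qed

context star_domain
begin

lemma homotopy_cong:
  assumes "\<And>y vs. y \<in> S \<Longrightarrow> \<alpha> y vs = \<beta> y vs" "x \<in> S"
  shows "H \<alpha> x ws = H \<beta> x ws"
  unfolding homotopy_op_def by (rule integral_cong) (use assms ray in auto)

lemma homotopy_add:
  fixes \<alpha> \<beta> :: "'a \<Rightarrow> 'a list \<Rightarrow> 'w::banach"
  assumes "continuous_form m S \<alpha>" "continuous_form m S \<beta>" "x \<in> S"
  shows "H (\<lambda>y vs. \<alpha> y vs + \<beta> y vs) x ws = H \<alpha> x ws + H \<beta> x ws"
  unfolding homotopy_op_def scaleR_add_right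
  by (rule integral_add) (intro homotopy_integrable[OF assms(1,3)] homotopy_integrable[OF assms(2,3)])+

lemma homotopy_scaleR:
  fixes \<alpha> :: "'a \<Rightarrow> 'a list \<Rightarrow> 'w::banach"
  shows "H (\<lambda>y vs. c *\<^sub>R \<alpha> y vs) x ws = c *\<^sub>R H \<alpha> x ws"
  unfolding homotopy_op_def by (subst integral_cmul[symmetric]) (simp add: mult.commute)

lemma homotopy_diff:
  fixes \<alpha> \<beta> :: "'a \<Rightarrow> 'a list \<Rightarrow> 'w::banach"
  assumes "continuous_form m S \<alpha>" "continuous_form m S \<beta>" "x \<in> S"
  shows "H (\<lambda>y vs. \<alpha> y vs - \<beta> y vs) x ws = H \<alpha> x ws - H \<beta> x ws"
  unfolding homotopy_op_def
  by (subst integral_diff[OF homotopy_integrable[OF assms(1,3)] homotopy_integrable[OF assms(2,3)], symmetric])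
     (simp only: scaleR_diff_right)

lemma homotopy_zero: "H (\<lambda>y vs. 0 :: 'w::banach) x ws = 0"
  by (simp add: homotopy_op_def)

lemma homotopy_form:
  fixes \<alpha> :: "'a \<Rightarrow> 'a list \<Rightarrow> 'w::banach"
  assumes a: "continuous_form (Suc m) S \<alpha>"
  shows "continuous_form m S (H \<alpha>)"
  unfolding Ck_form_def Ck_on.simps
proof (intro conjI ballI allI)
  show "continuous_on S (\<lambda>x. H \<alpha> x vs)" for vs by (rule homotopy_continuous[OF a])
  fix x assume x: "x \<in> S"
  note int = homotopy_integrable[OF a x]
  have al: "alternating_map m (\<lambda>ws. \<alpha> (x0 + t *\<^sub>R (x - x0)) ((x - x0) # ws))" if "t \<in> {0..1}" for t
    by (rule alternating_head[OF continuous_form_alternating[OF a ray[OF x]]]) (use that in auto)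
  show "alternating_map m (H \<alpha> x)"
    unfolding alternating_map_def
  proof (intro conjI allI impI)
    show "H \<alpha> x vs = 0" if "length vs \<noteq> m" for vs
      unfolding homotopy_op_def using alternating_mapD(1)[OF al that]
      by (intro integral_eq_zeroI) simp_all
    show "H \<alpha> x vs = 0" if "length vs = m" "i < j" "j < m" "vs ! i = vs ! j" for vs i j
      unfolding homotopy_op_def using alternating_mapD(3)[OF al that]
      by (intro integral_eq_zeroI) simp_all
    fix vs :: "'a list" and i assume vs: "length vs = m" "i < m"
    note lin = alternating_mapD(2)[OF al vs]
    show "linear (\<lambda>v. H \<alpha> x (vs[i := v]))"
    proof (rule linearI)
      show "H \<alpha> x (vs[i := u + v]) = H \<alpha> x (vs[i := u]) + H \<alpha> x (vs[i := v])" for u v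
        unfolding homotopy_op_def
        by (subst integral_add[OF int int, symmetric])
           (auto intro!: integral_cong simp: linear_add[OF lin] scaleR_add_right)
      show "H \<alpha> x (vs[i := r *\<^sub>R v]) = r *\<^sub>R H \<alpha> x (vs[i := v])" for r v
        unfolding homotopy_op_def
        by (subst integral_cmul[symmetric])
           (auto intro!: integral_cong simp: linear_cmul[OF lin])
    qed
  qed
qed

text \<open>
  The radial vector is inserted twice into an alternating map.
\<close>

lemma homotopy_homotopy:
  fixes \<alpha> :: "'a \<Rightarrow> 'a list \<Rightarrow> 'w::banach"
  assumes a: "continuous_form m S \<alpha>" and x: "x \<in> S"
  shows "H (H \<alpha>) x ws = 0"
proof -
  have "H \<alpha> (x0 + s *\<^sub>R (x - x0)) ((x - x0) # ws) = 0" if s: "s \<in> {0..1}" for s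
  proof -
    let ?y = "x0 + s *\<^sub>R (x - x0)"
    have y: "?y \<in> S" using ray x s by auto
    have "\<alpha> (x0 + t *\<^sub>R (?y - x0)) ((?y - x0) # (x - x0) # ws) = 0" if "t \<in> {0..1}" for t
    proof -
      have A: "alternating_map m (\<alpha> (x0 + t *\<^sub>R (?y - x0)))"
        by (rule continuous_form_alternating[OF a ray[OF y]]) (use that in auto)
      have "\<alpha> (x0 + t *\<^sub>R (?y - x0)) ((x - x0) # (x - x0) # ws) = 0"
        by (rule alternating_repeated[OF A, of 0 1]) auto
      then show ?thesis
        using linear_cmul[OF alternating_linear_head[OF A, of "(x - x0) # ws"], of s "x - x0"] by simp
    qed
    then show ?thesis unfolding homotopy_op_def by (intro integral_eq_zeroI) simp
  qed
  then show ?thesis unfolding homotopy_op_def[of x0 "H \<alpha>"] by (intro integral_eq_zeroI) simp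
qed

lemma homotopy_has_derivative:
  fixes \<alpha> :: "'a \<Rightarrow> 'a list \<Rightarrow> 'w::banach"
  assumes a: "Ck_form 1 m S \<alpha>" and x: "x \<in> S"
  shows "((\<lambda>y. H \<alpha> y ws) has_derivative (\<lambda>v. integral {0..1} (\<lambda>t. t ^ length ws *\<^sub>R
    (t *\<^sub>R coeff_deriv \<alpha> v (x0 + t *\<^sub>R (x - x0)) ((x - x0) # ws) + \<alpha> (x0 + t *\<^sub>R (x - x0)) (v # ws))))) (at x)"
proof -
  note a' = C1_formD[OF open_S a]
  let ?n = "length ws" and ?c = "\<lambda>y t. x0 + t *\<^sub>R (y - x0)"
  obtain R where R: "R > 0" "ball x R \<subseteq> S" using open_S x open_contains_ball by blast
  let ?B = "ball x R"
  define D where "D = (\<lambda>y t v. t ^ ?n *\<^sub>R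
    (t *\<^sub>R coeff_deriv \<alpha> v (?c y t) ((y - x0) # ws) + \<alpha> (?c y t) (v # ws)))"
  have cS: "?c y t \<in> S" if "y \<in> ?B" "t \<in> {0..1}" for y t using ray R(2) that by auto
  have der: "((\<lambda>y. t ^ ?n *\<^sub>R \<alpha> (?c y t) ((y - x0) # ws)) has_derivative D y t) (at y)"
    if "y \<in> ?B" "t \<in> {0..1}" for y t
  proof -
    have l: "coeff_deriv \<alpha> (t *\<^sub>R v) (?c y t) l = t *\<^sub>R coeff_deriv \<alpha> v (?c y t) l" for v l
      using linear_cmul[OF coeff_deriv_linear[OF a'(2) open_S cS[OF that]]] .
    have "((\<lambda>y. \<alpha> (?c y t) ((y - x0) # ws)) has_derivative
        (\<lambda>v. coeff_deriv \<alpha> (t *\<^sub>R v) (?c y t) ((y - x0) # ws) + \<alpha> (?c y t) (v # ws))) (at y)"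
      by (rule has_derivative_form_head[OF open_S a'(2) continuous_form_alternating[OF a'(1)]])
         (use cS[OF that] in \<open>auto intro!: derivative_eq_intros\<close>)
    from has_derivative_scaleR_right[OF this, of "t ^ ?n"] show ?thesis by (simp add: D_def l)
  qed
  have bl: "bounded_linear (D y t)" if "y \<in> ?B" "t \<in> {0..1}" for y t
    using has_derivative_bounded_linear[OF der[OF that]] .
  let ?fx = "\<lambda>y t. Blinfun (D y t)"
  have app: "blinfun_apply (?fx y t) v = D y t v" if "y \<in> ?B" "t \<in> {0..1}" for y t v
    by (simp add: bounded_linear_Blinfun_apply[OF bl[OF that]])
  have contD: "continuous_on (?B \<times> {0..1}) (\<lambda>(y, t). D y t b)" for b
    unfolding D_def split_def
    by (intro continuous_intros continuous_form_head[OF a'(3)]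
         continuous_on_compose2[OF continuous_form_coeff[OF a'(1)]]) (use cS in auto)
  have cont: "continuous_on (?B \<times> cbox 0 1) (\<lambda>(y, t). ?fx y t)"
  proof (rule continuous_on_blinfun_componentwise)
    fix b :: 'a
    show "continuous_on (?B \<times> cbox 0 1) (\<lambda>z. blinfun_apply (case z of (y, t) \<Rightarrow> ?fx y t) b)"
      by (rule continuous_on_eq[OF contD[of b, folded box_real]]) (auto simp: app)
  qed
  have "((\<lambda>y. integral (cbox 0 1) (\<lambda>t. t ^ ?n *\<^sub>R \<alpha> (?c y t) ((y - x0) # ws)))
      has_derivative integral (cbox 0 1) (?fx x)) (at x within ?B)"
  proof (rule leibniz_rule[OF _ _ cont])
    fix y t assume y: "y \<in> ?B"
    then have yS: "y \<in> S" using R(2) by auto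
    show "(\<lambda>t. t ^ ?n *\<^sub>R \<alpha> (?c y t) ((y - x0) # ws)) integrable_on cbox 0 1"
      using homotopy_integrable[OF a'(1) yS] by simp
    assume t: "t \<in> cbox 0 (1::real)"
    show "((\<lambda>y. t ^ ?n *\<^sub>R \<alpha> (?c y t) ((y - x0) # ws)) has_derivative blinfun_apply (?fx y t)) (at y within ?B)"
      using has_derivative_at_withinI[OF der] bounded_linear_Blinfun_apply[OF bl] y t by simp
  qed (use R in auto)
  moreover have "blinfun_apply (integral (cbox 0 1) (?fx x)) v = integral {0..1} (\<lambda>t. D x t v)" for v
  proof -
    have "continuous_on (cbox 0 1) (?fx x)"
      by (rule continuous_on_compose2[OF cont, of _ "Pair x", simplified]) (use R in \<open>auto intro!: continuous_intros\<close>)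
    then have "?fx x integrable_on cbox 0 1" by (rule integrable_continuous)
    then have "blinfun_apply (integral (cbox 0 1) (?fx x)) v = integral (cbox 0 1) (\<lambda>t. blinfun_apply (?fx x t) v)"
      by (rule blinfun_apply_integral)
    also have "\<dots> = integral {0..1} (\<lambda>t. D x t v)"
      unfolding box_real by (rule integral_cong) (use app[of x] R in auto)
    finally show ?thesis .
  qed
  ultimately have "((\<lambda>y. H \<alpha> y ws) has_derivative (\<lambda>v. integral {0..1} (\<lambda>t. D x t v))) (at x within ?B)"
    unfolding homotopy_op_def by (simp add: fun_eq_iff has_derivative_eq_rhs)
  then show ?thesis unfolding D_def using at_within_open[of x ?B] R by simp
qed

lemma homotopy_coeff_deriv:
  fixes \<alpha> :: "'a \<Rightarrow> 'a list \<Rightarrow> 'w::banach"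
  assumes "Ck_form 1 m S \<alpha>" "x \<in> S"
  shows "coeff_deriv (H \<alpha>) v x ws = integral {0..1} (\<lambda>t. t ^ length ws *\<^sub>R
    (t *\<^sub>R coeff_deriv \<alpha> v (x0 + t *\<^sub>R (x - x0)) ((x - x0) # ws) + \<alpha> (x0 + t *\<^sub>R (x - x0)) (v # ws)))"
  by (rule coeff_deriv_unique[OF homotopy_has_derivative[OF assms]])

lemma homotopy_deriv_integrand_continuous:
  fixes \<alpha> :: "'a \<Rightarrow> 'a list \<Rightarrow> 'w::banach"
  assumes "Ck_form 1 m S \<alpha>"
  shows "continuous_on (S \<times> {0..1}) (\<lambda>(x, t). t ^ n *\<^sub>R
    (t *\<^sub>R coeff_deriv \<alpha> v (x0 + t *\<^sub>R (x - x0)) ((x - x0) # ws) + \<alpha> (x0 + t *\<^sub>R (x - x0)) (v # ws)))"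
proof -
  note a' = C1_formD[OF open_S assms]
  show ?thesis unfolding split_def
    by (intro continuous_intros continuous_form_head[OF a'(3)]
         continuous_on_compose2[OF continuous_form_coeff[OF a'(1)]]) (auto intro: ray)
qed

lemma homotopy_C1_form:
  fixes \<alpha> :: "'a \<Rightarrow> 'a list \<Rightarrow> 'w::banach"
  assumes a: "Ck_form 1 (Suc m) S \<alpha>"
  shows "Ck_form 1 m S (H \<alpha>)"
proof -
  note a' = C1_formD[OF open_S a]
  have c: "continuous_form m S (H \<alpha>)" by (rule homotopy_form[OF a'(1)])
  have d: "differentiable_form S (H \<alpha>)" by (rule differentiable_formI[OF homotopy_has_derivative[OF a]])
  have "continuous_form m S (coeff_deriv (H \<alpha>) v)" for v
    unfolding Ck_form_def Ck_on.simps
  proof (intro conjI ballI allI)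
    show "alternating_map m (coeff_deriv (H \<alpha>) v x)" if "x \<in> S" for x
      by (rule coeff_deriv_alternating[OF open_S that d continuous_form_alternating[OF c]])
    fix ws
    have "continuous_on S (\<lambda>x. integral {0..1} (\<lambda>t. t ^ length ws *\<^sub>R
      (t *\<^sub>R coeff_deriv \<alpha> v (x0 + t *\<^sub>R (x - x0)) ((x - x0) # ws) + \<alpha> (x0 + t *\<^sub>R (x - x0)) (v # ws))))"
      using integral_continuous_on_param[of S 0 "1::real" "\<lambda>x t. t ^ length ws *\<^sub>R
      (t *\<^sub>R coeff_deriv \<alpha> v (x0 + t *\<^sub>R (x - x0)) ((x - x0) # ws) + \<alpha> (x0 + t *\<^sub>R (x - x0)) (v # ws))"]
        homotopy_deriv_integrand_continuous[OF a, of "length ws" v ws] by simp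
    then show "continuous_on S (\<lambda>x. coeff_deriv (H \<alpha>) v x ws)"
      by (rule continuous_on_eq) (simp add: homotopy_coeff_deriv[OF a])
  qed
  with c d show ?thesis unfolding C1_form_iff[OF open_S] by blast
qed

end

section \<open>Weighted bounds on star-shaped compact sets\<close>

abbreviation norm_prod :: "'a::real_normed_vector list \<Rightarrow> real" where
  "norm_prod vs \<equiv> prod_list (map norm vs)"

lemma norm_prod_nonneg: "norm_prod vs \<ge> 0"
  by (induction vs) auto

lemma norm_prod_drop_nth: "i < length vs \<Longrightarrow> norm (vs ! i) * norm_prod (drop_nth i vs) = norm_prod vs"
proof (induction vs arbitrary: i)
  case (Cons v vs)
  then show ?case by (cases i) (auto simp: mult.left_commute)
qed simp

lemma linear_bound_by_Basis:
  fixes f :: "'a::euclidean_space \<Rightarrow> 'w::real_normed_vector"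
  assumes f: "linear f" and C: "\<And>b. b \<in> Basis \<Longrightarrow> norm (f b) \<le> C b * N"
  shows "norm (f u) \<le> (\<Sum>b\<in>Basis. C b) * norm u * N"
proof -
  have "f u = f (\<Sum>b\<in>Basis. (u \<bullet> b) *\<^sub>R b)" by (simp add: euclidean_representation)
  also have "\<dots> = (\<Sum>b\<in>Basis. (u \<bullet> b) *\<^sub>R f b)"
    unfolding linear_sum[OF f] by (intro sum.cong refl linear_cmul[OF f])
  finally have "norm (f u) \<le> (\<Sum>b\<in>Basis. norm u * (C b * N))"
    by (simp only:) (intro sum_norm_le, simp add: mult_mono C Basis_le_norm)
  then show ?thesis by (simp add: sum_distrib_right sum_distrib_left mult_ac)
qed

text \<open>
  A uniform bound for all arguments follows from the finitely many basis arguments.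
  Products of norms keep later estimates free of bases.
\<close>

lemma form_bounded_on_compact:
  fixes \<omega> :: "'a::euclidean_space \<Rightarrow> 'a list \<Rightarrow> 'w::real_normed_vector"
  assumes "compact K" "continuous_form k K \<omega>"
  shows "\<exists>C\<ge>0. \<forall>x\<in>K. \<forall>vs. norm (\<omega> x vs) \<le> C * norm_prod vs"
  using assms(2)
proof (induction k arbitrary: \<omega>)
  case 0
  have "compact ((\<lambda>x. \<omega> x []) ` K)"
    by (rule compact_continuous_image[OF continuous_form_coeff[OF 0] assms(1)])
  then obtain C where C: "\<And>x. x \<in> K \<Longrightarrow> norm (\<omega> x []) \<le> C"
    using compact_imp_bounded bounded_iff by (metis imageI)
  have "norm (\<omega> x vs) \<le> max C 0 * norm_prod vs" if "x \<in> K" for x vs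
  proof (cases "vs = []")
    case True
    then show ?thesis using C[OF that] by simp
  next
    case False
    then have "\<omega> x vs = 0" using alternating_mapD(1)[OF continuous_form_alternating[OF 0 that]] by auto
    then show ?thesis using norm_prod_nonneg[of vs] by simp
  qed
  then show ?case by (intro exI[of _ "max C 0"]) auto
next
  case (Suc k)
  have "\<exists>C\<ge>0. \<forall>x\<in>K. \<forall>vs. norm (\<omega> x (b # vs)) \<le> C * norm_prod vs" for b
    by (rule Suc.IH) (use Suc.prems alternating_head in \<open>auto simp: Ck_form_def\<close>)
  then obtain C where C: "\<And>b. C b \<ge> 0" "\<And>b x vs. x \<in> K \<Longrightarrow> norm (\<omega> x (b # vs)) \<le> C b * norm_prod vs"
    by metis
  have "norm (\<omega> x vs) \<le> (\<Sum>b\<in>Basis. C b) * norm_prod vs" if x: "x \<in> K" for x vs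
  proof (cases vs)
    case Nil
    then have "\<omega> x vs = 0" using alternating_mapD(1)[OF continuous_form_alternating[OF Suc.prems x]] by auto
    then show ?thesis using norm_prod_nonneg[of vs] C(1) by (simp add: sum_nonneg)
  next
    case (Cons u ws)
    have "norm (\<omega> x (u # ws)) \<le> (\<Sum>b\<in>Basis. C b) * norm u * norm_prod ws"
      by (rule linear_bound_by_Basis[OF alternating_linear_head[OF continuous_form_alternating[OF Suc.prems x]] C(2)[OF x]])
    then show ?thesis by (simp add: Cons mult_ac)
  qed
  then show ?case using C(1) by (intro exI[of _ "\<Sum>b\<in>Basis. C b"]) (auto intro: sum_nonneg)
qed

lemma form_deriv_bounded_on_compact:
  fixes \<omega> :: "'a::euclidean_space \<Rightarrow> 'a list \<Rightarrow> 'w::real_normed_vector"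
  assumes K: "compact K" "K \<subseteq> S" and S: "open S" and w: "Ck_form 1 k S \<omega>"
  shows "\<exists>C\<ge>0. \<forall>x\<in>K. \<forall>v vs. norm (coeff_deriv \<omega> v x vs) \<le> C * norm v * norm_prod vs"
proof -
  note w' = C1_formD[OF S w]
  have "\<exists>C\<ge>0. \<forall>x\<in>K. \<forall>vs. norm (coeff_deriv \<omega> b x vs) \<le> C * norm_prod vs" for b
    by (rule form_bounded_on_compact[OF K(1) continuous_form_subset[OF w'(3) K(2)]])
  then obtain C where C: "\<And>b. C b \<ge> 0" "\<And>b x vs. x \<in> K \<Longrightarrow> norm (coeff_deriv \<omega> b x vs) \<le> C b * norm_prod vs"
    by metis
  have "norm (coeff_deriv \<omega> v x vs) \<le> (\<Sum>b\<in>Basis. C b) * norm v * norm_prod vs" if x: "x \<in> K" for x v vs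
    by (rule linear_bound_by_Basis[OF coeff_deriv_linear[OF w'(2) S] C(2)[OF x]]) (use x K(2) in auto)
  then show ?thesis using C(1) by (intro exI[of _ "\<Sum>b\<in>Basis. C b"]) (auto intro: sum_nonneg)
qed

lemma exp_ray_integral:
  fixes \<mu> \<rho> :: real
  assumes "\<mu> > 0"
  shows "((\<lambda>t. \<rho> * exp (\<mu> * (t * \<rho>))) has_integral (exp (\<mu> * \<rho>) - 1) / \<mu>) {0..1}"
proof -
  have "((\<lambda>t. \<rho> * exp (\<mu> * (t * \<rho>))) has_integral exp (\<mu> * (1 * \<rho>)) / \<mu> - exp (\<mu> * (0 * \<rho>)) / \<mu>) {0..1}"
    by (rule fundamental_theorem_of_calculus)
       (use assms in \<open>auto intro!: derivative_eq_intros simp flip: has_real_derivative_iff_has_vector_derivative\<close>)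
  then show ?thesis by (simp add: diff_divide_distrib)
qed

lemma has_derivative_series_M_test:
  fixes f :: "nat \<Rightarrow> 'a::real_normed_vector \<Rightarrow> 'b::banach"
  assumes S: "open S" "convex S" "x \<in> S"
    and f: "\<And>n y. y \<in> S \<Longrightarrow> (f n has_derivative f' n y) (at y)"
    and M: "\<And>n y h. y \<in> S \<Longrightarrow> norm (f' n y h) \<le> M n * norm h" "summable M"
    and s: "\<And>y. y \<in> S \<Longrightarrow> (\<lambda>n. f n y) sums F y"
  shows "\<exists>F'. (F has_derivative F') (at x)"
proof -
  have sm: "summable (\<lambda>i. f' i y h)" if "y \<in> S" for y h
    by (rule summable_comparison_test'[of "\<lambda>n. M n * norm h" 0]) (use M that in \<open>auto intro: summable_mult2\<close>)
  have "\<exists>g. \<forall>y\<in>S. (\<lambda>n. f n y) sums g y \<and> (g has_derivative (\<lambda>h. \<Sum>i. f' i y h)) (at y within S)"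
  proof (rule has_derivative_series[where f = f and f' = f', OF S(2) _ _ S(3) s[OF S(3)]])
    show "(f n has_derivative f' n y) (at y within S)" if "y \<in> S" for n y
      using f[OF that] has_derivative_at_withinI by blast
    fix e :: real assume "e > 0"
    then obtain N where N: "\<And>n. n \<ge> N \<Longrightarrow> norm (\<Sum>i. M (i + n)) < e"
      using suminf_exist_split[OF _ M(2)] by blast
    have "norm ((\<Sum>i<n. f' i y h) - (\<Sum>i. f' i y h)) \<le> e * norm h" if "n \<ge> N" "y \<in> S" for n y h
    proof -
      have "norm ((\<Sum>i<n. f' i y h) - (\<Sum>i. f' i y h)) = norm (\<Sum>i. f' (i + n) y h)"
        using suminf_minus_initial_segment[OF sm[OF that(2), of h], of n] by (simp add: norm_minus_commute)
      also have "\<dots> \<le> (\<Sum>i. M (i + n) * norm h)"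
        by (rule norm_suminf_le) (use M that(2) in \<open>auto intro!: summable_mult2 simp: summable_iff_shift\<close>)
      also have "\<dots> = (\<Sum>i. M (i + n)) * norm h"
        by (rule suminf_mult2[symmetric]) (use M in \<open>simp add: summable_iff_shift\<close>)
      also have "\<dots> \<le> e * norm h" using N[OF that(1)] by (intro mult_right_mono) auto
      finally show ?thesis .
    qed
    then show "\<forall>\<^sub>F n in sequentially. \<forall>y\<in>S. \<forall>h. norm ((\<Sum>i<n. f' i y h) - (\<Sum>i. f' i y h)) \<le> e * norm h"
      unfolding eventually_sequentially by blast
  qed
  then obtain g where g: "\<And>y. y \<in> S \<Longrightarrow> (\<lambda>n. f n y) sums g y"
      "\<And>y. y \<in> S \<Longrightarrow> (g has_derivative (\<lambda>h. \<Sum>i. f' i y h)) (at y within S)" by blast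
  have gF: "g y = F y" if "y \<in> S" for y using sums_unique2[OF g(1)[OF that] s[OF that]] .
  have "(g has_derivative (\<lambda>h. \<Sum>i. f' i x h)) (at x)" using g(2)[OF S(3)] at_within_open[OF S(3,1)] by simp
  then have "(F has_derivative (\<lambda>h. \<Sum>i. f' i x h)) (at x)"
    by (rule has_derivative_transform_within_open[OF _ S(1,3) gF])
  then show ?thesis by blast
qed

context star_domain
begin

definition star_compact :: "'a set \<Rightarrow> bool" where
  "star_compact K \<longleftrightarrow> compact K \<and> K \<subseteq> S \<and> (\<forall>x\<in>K. \<forall>t\<in>{0..1}. x0 + t *\<^sub>R (x - x0) \<in> K)"

lemma star_compact_hull:
  assumes "compact K" "K \<subseteq> S"
  shows "\<exists>K'. K \<subseteq> K' \<and> star_compact K'"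
proof -
  let ?f = "\<lambda>z. x0 + snd z *\<^sub>R (fst z - x0)"
  let ?K = "?f ` (K \<times> {0..1})"
  have "compact ?K"
    by (intro compact_continuous_image compact_Times continuous_intros assms compact_Icc)
  moreover have "K \<subseteq> ?K"
  proof
    fix x assume "x \<in> K"
    then show "x \<in> ?K" by (intro image_eqI[of _ _ "(x, 1)"]) auto
  qed
  moreover have "?K \<subseteq> S" using assms(2) ray by auto
  moreover have "x0 + t *\<^sub>R (x - x0) \<in> ?K" if "x \<in> ?K" "t \<in> {0..1}" for x t
  proof -
    from that(1) obtain z where z: "x = ?f z" "z \<in> K \<times> {0..1}" by (rule imageE)
    obtain y s where "z = (y, s)" by (cases z)
    with z have y: "y \<in> K" "s \<in> {0..1}" "x = x0 + s *\<^sub>R (y - x0)" by auto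
    have "t * s \<in> {0..1}" using y(2) that(2) by (auto intro: mult_le_one)
    then have 1: "(y, t * s) \<in> K \<times> {0..1}" using y(1) by simp
    have 2: "x0 + t *\<^sub>R (x - x0) = ?f (y, t * s)" unfolding y(3) by simp
    show ?thesis unfolding 2 by (rule imageI[OF 1])
  qed
  ultimately show ?thesis unfolding star_compact_def
    by (intro exI[of _ ?K] conjI ballI) assumption+
qed

text \<open>
  Along a ray of length \<open>\<rho>\<close> one has \<open>\<integral> \<rho> exp (\<mu> t \<rho>) dt \<le> exp (\<mu> \<rho>) / \<mu>\<close> over the unit
  interval. With respect to this exponential weight the homotopy operator therefore has
  norm at most \<open>1 / \<mu>\<close>, which is as small as desired.
\<close>

definition weight_bound :: "'a set \<Rightarrow> real \<Rightarrow> real \<Rightarrow> ('a \<Rightarrow> 'a list \<Rightarrow> 'w::real_normed_vector) \<Rightarrow> bool" where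
  "weight_bound K \<mu> M \<omega> \<longleftrightarrow> (\<forall>x\<in>K. \<forall>vs. norm (\<omega> x vs) \<le> M * exp (\<mu> * norm (x - x0)) * norm_prod vs)"

lemma weight_boundD:
  "weight_bound K \<mu> M \<omega> \<Longrightarrow> x \<in> K \<Longrightarrow> norm (\<omega> x vs) \<le> M * exp (\<mu> * norm (x - x0)) * norm_prod vs"
  by (simp add: weight_bound_def)

lemma weight_bound_mono:
  assumes "weight_bound K \<mu> M \<omega>" "M \<le> N"
  shows "weight_bound K \<mu> N \<omega>"
  unfolding weight_bound_def
proof (intro ballI allI)
  fix x and vs :: "'a list" assume "x \<in> K"
  have "M * exp (\<mu> * norm (x - x0)) * norm_prod vs \<le> N * exp (\<mu> * norm (x - x0)) * norm_prod vs"
    by (intro mult_right_mono assms(2)) (auto simp: norm_prod_nonneg)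
  then show "norm (\<omega> x vs) \<le> N * exp (\<mu> * norm (x - x0)) * norm_prod vs"
    using weight_boundD[OF assms(1) \<open>x \<in> K\<close>, of vs] by linarith
qed

lemma weight_bound_const:
  assumes "\<And>x vs. x \<in> K \<Longrightarrow> norm (\<omega> x vs) \<le> M * norm_prod vs" "M \<ge> 0" "\<mu> \<ge> 0"
  shows "weight_bound K \<mu> M \<omega>"
  unfolding weight_bound_def
proof (intro ballI allI)
  fix x and vs :: "'a list" assume "x \<in> K"
  have "M * 1 * norm_prod vs \<le> M * exp (\<mu> * norm (x - x0)) * norm_prod vs"
    by (intro mult_right_mono mult_left_mono) (use assms(2,3) in \<open>auto simp: norm_prod_nonneg\<close>)
  then show "norm (\<omega> x vs) \<le> M * exp (\<mu> * norm (x - x0)) * norm_prod vs"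
    using assms(1)[OF \<open>x \<in> K\<close>, of vs] by simp
qed

lemma ray_integrand_bound:
  fixes f :: "'w::real_normed_vector"
  assumes t: "t \<in> {0..1}" and f: "norm f \<le> M * exp (\<mu> * norm (x0 + t *\<^sub>R (x - x0) - x0)) * norm_prod ((x - x0) # ws)"
  shows "norm (t ^ n *\<^sub>R f) \<le> (M * norm_prod ws) * (norm (x - x0) * exp (\<mu> * (t * norm (x - x0))))"
proof -
  have "norm (t ^ n *\<^sub>R f) \<le> 1 * norm f"
    unfolding norm_scaleR by (intro mult_right_mono) (use t in \<open>auto simp: power_le_one\<close>)
  then show ?thesis using f t by (simp add: mult_ac)
qed

lemma homotopy_weight_bound:
  fixes \<alpha> :: "'a \<Rightarrow> 'a list \<Rightarrow> 'w::banach"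
  assumes K: "star_compact K" and a: "continuous_form m S \<alpha>" and b: "weight_bound K \<mu> M \<alpha>"
    and "\<mu> > 0" "M \<ge> 0"
  shows "weight_bound K \<mu> (M / \<mu>) (H \<alpha>)"
  unfolding weight_bound_def
proof (intro ballI allI)
  fix x and ws :: "'a list" assume x: "x \<in> K"
  then have xS: "x \<in> S" using K by (auto simp: star_compact_def)
  let ?r = "norm (x - x0)"
  have I: "((\<lambda>t. (M * norm_prod ws) * (?r * exp (\<mu> * (t * ?r)))) has_integral
      (M * norm_prod ws) * ((exp (\<mu> * ?r) - 1) / \<mu>)) {0..1}"
    by (rule has_integral_mult_right[OF exp_ray_integral[OF \<open>\<mu> > 0\<close>]])
  have "norm (H \<alpha> x ws) \<le> integral {0..1} (\<lambda>t. (M * norm_prod ws) * (?r * exp (\<mu> * (t * ?r))))"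
    unfolding homotopy_op_def
  proof (rule integral_norm_bound_integral[OF homotopy_integrable[OF a xS]])
    show "(\<lambda>t. (M * norm_prod ws) * (?r * exp (\<mu> * (t * ?r)))) integrable_on {0..1}" using I by blast
    fix t :: real assume t: "t \<in> {0..1}"
    then have "x0 + t *\<^sub>R (x - x0) \<in> K" using K x by (auto simp: star_compact_def)
    from ray_integrand_bound[OF t weight_boundD[OF b this]]
    show "norm (t ^ length ws *\<^sub>R \<alpha> (x0 + t *\<^sub>R (x - x0)) ((x - x0) # ws))
      \<le> (M * norm_prod ws) * (?r * exp (\<mu> * (t * ?r)))" .
  qed
  also have "\<dots> = (M * norm_prod ws) * ((exp (\<mu> * ?r) - 1) / \<mu>)" using I by (rule integral_unique)
  also have "\<dots> \<le> (M * norm_prod ws) * (exp (\<mu> * ?r) / \<mu>)"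
    using \<open>\<mu> > 0\<close> \<open>M \<ge> 0\<close> norm_prod_nonneg[of ws] by (intro mult_left_mono divide_right_mono) auto
  finally show "norm (H \<alpha> x ws) \<le> M / \<mu> * exp (\<mu> * ?r) * norm_prod ws" by (simp add: mult_ac)
qed

text \<open>
  Differentiating the contracted radial vector produces a second summand that carries no
  factor \<open>1 / \<mu>\<close>, but it involves only the form and not its derivative.
\<close>

lemma homotopy_deriv_weight_bound:
  fixes \<alpha> :: "'a \<Rightarrow> 'a list \<Rightarrow> 'w::banach"
  assumes K: "star_compact K" and a: "Ck_form 1 m S \<alpha>"
    and b: "weight_bound K \<mu> M \<alpha>" "weight_bound K \<mu> D (coeff_deriv \<alpha> v)"
    and "\<mu> > 0" "M \<ge> 0" "D \<ge> 0"
  shows "weight_bound K \<mu> (D / \<mu> + M * norm v) (coeff_deriv (H \<alpha>) v)"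
  unfolding weight_bound_def
proof (intro ballI allI)
  fix x and ws :: "'a list" assume x: "x \<in> K"
  then have xS: "x \<in> S" using K by (auto simp: star_compact_def)
  let ?r = "norm (x - x0)" and ?c = "\<lambda>t. x0 + t *\<^sub>R (x - x0)"
  let ?C = "M * exp (\<mu> * ?r) * norm v * norm_prod ws"
  have I: "((\<lambda>t. (D * norm_prod ws) * (?r * exp (\<mu> * (t * ?r))) + ?C) has_integral
      (D * norm_prod ws) * ((exp (\<mu> * ?r) - 1) / \<mu>) + ?C) {0..1}"
    using has_integral_add[OF has_integral_mult_right[OF exp_ray_integral[OF \<open>\<mu> > 0\<close>]] has_integral_const_real[of ?C 0 1]]
    by simp
  have "norm (coeff_deriv (H \<alpha>) v x ws) \<le> integral {0..1} (\<lambda>t. (D * norm_prod ws) * (?r * exp (\<mu> * (t * ?r))) + ?C)"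
    unfolding homotopy_coeff_deriv[OF a xS]
  proof (rule integral_norm_bound_integral)
    show "(\<lambda>t. (D * norm_prod ws) * (?r * exp (\<mu> * (t * ?r))) + ?C) integrable_on {0..1}" using I by blast
    have "continuous_on {0..1} (\<lambda>t. (case (x, t) of (x, t) \<Rightarrow> t ^ length ws *\<^sub>R (t *\<^sub>R coeff_deriv \<alpha> v (x0 + t *\<^sub>R (x - x0)) ((x - x0) # ws) + \<alpha> (x0 + t *\<^sub>R (x - x0)) (v # ws))))"
      by (rule continuous_on_compose2[OF homotopy_deriv_integrand_continuous[OF a]])
         (use xS in \<open>auto intro!: continuous_intros\<close>)
    then show "(\<lambda>t. t ^ length ws *\<^sub>R (t *\<^sub>R coeff_deriv \<alpha> v (?c t) ((x - x0) # ws) + \<alpha> (?c t) (v # ws))) integrable_on {0..1}"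
      by (intro integrable_continuous_real) simp
    fix t :: real assume t: "t \<in> {0..1}"
    then have ct: "?c t \<in> K" using K x by (auto simp: star_compact_def)
    have 1: "norm (t ^ Suc (length ws) *\<^sub>R coeff_deriv \<alpha> v (?c t) ((x - x0) # ws))
        \<le> (D * norm_prod ws) * (?r * exp (\<mu> * (t * ?r)))"
      by (rule ray_integrand_bound[OF t weight_boundD[OF b(2) ct]])
    have "norm (t ^ length ws *\<^sub>R \<alpha> (?c t) (v # ws)) \<le> 1 * norm (\<alpha> (?c t) (v # ws))"
      unfolding norm_scaleR by (intro mult_right_mono) (use t in \<open>auto simp: power_le_one\<close>)
    also have "\<dots> \<le> M * exp (\<mu> * norm (?c t - x0)) * norm_prod (v # ws)"
      using weight_boundD[OF b(1) ct, of "v # ws"] by simp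
    also have "\<dots> \<le> M * exp (\<mu> * ?r) * norm_prod (v # ws)"
    proof (intro mult_right_mono mult_left_mono)
      have "t * ?r \<le> ?r" using t by (intro mult_left_le_one_le) auto
      then show "exp (\<mu> * norm (?c t - x0)) \<le> exp (\<mu> * ?r)" using t \<open>\<mu> > 0\<close> by simp
    qed (use \<open>M \<ge> 0\<close> norm_prod_nonneg[of "v # ws"] in auto)
    finally have 2: "norm (t ^ length ws *\<^sub>R \<alpha> (?c t) (v # ws)) \<le> ?C" by (simp add: mult_ac)
    have "t ^ length ws *\<^sub>R (t *\<^sub>R coeff_deriv \<alpha> v (?c t) ((x - x0) # ws) + \<alpha> (?c t) (v # ws))
       = t ^ Suc (length ws) *\<^sub>R coeff_deriv \<alpha> v (?c t) ((x - x0) # ws) + t ^ length ws *\<^sub>R \<alpha> (?c t) (v # ws)"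
      by (simp add: scaleR_add_right mult.commute)
    then show "norm (t ^ length ws *\<^sub>R (t *\<^sub>R coeff_deriv \<alpha> v (?c t) ((x - x0) # ws) + \<alpha> (?c t) (v # ws)))
       \<le> (D * norm_prod ws) * (?r * exp (\<mu> * (t * ?r))) + ?C"
      using norm_triangle_mono[OF 1 2] by simp
  qed
  also have "\<dots> = (D * norm_prod ws) * ((exp (\<mu> * ?r) - 1) / \<mu>) + ?C" using I by (rule integral_unique)
  also have "\<dots> \<le> (D * norm_prod ws) * (exp (\<mu> * ?r) / \<mu>) + ?C"
    using \<open>\<mu> > 0\<close> \<open>D \<ge> 0\<close> norm_prod_nonneg[of ws] by (intro add_right_mono mult_left_mono divide_right_mono) auto
  finally show "norm (coeff_deriv (H \<alpha>) v x ws) \<le> (D / \<mu> + M * norm v) * exp (\<mu> * ?r) * norm_prod ws"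
    by (simp add: algebra_simps)
qed

lemma wedge_weight_bound:
  fixes \<omega> :: "'a \<Rightarrow> 'a list \<Rightarrow> 'w::real_normed_vector"
  assumes A: "\<And>x v. x \<in> K \<Longrightarrow> norm (A x [v]) \<le> a * norm v" and al: "\<And>x. x \<in> K \<Longrightarrow> alternating_map k (\<omega> x)"
    and b: "weight_bound K \<mu> M \<omega>" and "a \<ge> 0" "M \<ge> 0"
  shows "weight_bound K \<mu> (real (Suc k) * a * M) (wedge A \<omega>)"
  unfolding weight_bound_def
proof (intro ballI allI)
  fix x and vs :: "'a list" assume x: "x \<in> K"
  let ?e = "exp (\<mu> * norm (x - x0))"
  show "norm (wedge A \<omega> x vs) \<le> real (Suc k) * a * M * ?e * norm_prod vs"
  proof (cases "length vs = Suc k")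
    case True
    have "norm (wedge A \<omega> x vs) \<le> (\<Sum>i<length vs. a * M * ?e * norm_prod vs)"
      unfolding wedge_def
    proof (rule sum_norm_le)
      fix i assume "i \<in> {..<length vs}"
      then have i: "i < length vs" by simp
      have "norm (blinfun_apply (A x [vs ! i]) (\<omega> x (drop_nth i vs)))
          \<le> norm (A x [vs ! i]) * norm (\<omega> x (drop_nth i vs))" by (rule norm_blinfun)
      also have "\<dots> \<le> (a * norm (vs ! i)) * (M * ?e * norm_prod (drop_nth i vs))"
        by (intro mult_mono A[OF x] weight_boundD[OF b x]) (use \<open>a \<ge> 0\<close> in auto)
      also have "\<dots> = a * M * ?e * norm_prod vs"
        unfolding norm_prod_drop_nth[OF i, symmetric] by (simp add: mult_ac)
      finally show "norm ((-1) ^ i *\<^sub>R blinfun_apply (A x [vs ! i]) (\<omega> x (drop_nth i vs))) \<le> a * M * ?e * norm_prod vs"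
        by simp
    qed
    then show ?thesis using True by (simp add: mult_ac)
  next
    case False
    then have "\<omega> x (drop_nth i vs) = 0" if "i < length vs" for i
      using alternating_mapD(1)[OF al[OF x], of "drop_nth i vs"] that by auto
    then have "wedge A \<omega> x vs = 0" by (auto simp: wedge_def intro!: sum.neutral)
    then show ?thesis using \<open>a \<ge> 0\<close> \<open>M \<ge> 0\<close> norm_prod_nonneg[of vs] by simp
  qed
qed

lemma weight_bound_add:
  assumes "weight_bound K \<mu> M \<omega>" "weight_bound K \<mu> N \<eta>"
    and "\<And>x vs. x \<in> K \<Longrightarrow> \<zeta> x vs = \<omega> x vs + \<eta> x vs"
  shows "weight_bound K \<mu> (M + N) \<zeta>"
  unfolding weight_bound_def
proof (intro ballI allI)
  fix x and vs :: "'a list" assume x: "x \<in> K"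
  show "norm (\<zeta> x vs) \<le> (M + N) * exp (\<mu> * norm (x - x0)) * norm_prod vs"
    using norm_triangle_mono[OF weight_boundD[OF assms(1) x, of vs] weight_boundD[OF assms(2) x, of vs]] assms(3)[OF x]
    by (simp add: algebra_simps)
qed

end

section \<open>The Volterra operator of a connection and its Neumann series\<close>

lemma alternating_sum:
  "(\<And>i. i \<in> I \<Longrightarrow> alternating_map k (f i)) \<Longrightarrow> alternating_map k (\<lambda>vs. \<Sum>i\<in>I. f i vs)"
  by (induction I rule: infinite_finite_induct) (auto intro: alternating_zero alternating_add)

lemma alternating_limit:
  fixes f :: "nat \<Rightarrow> 'a::real_vector list \<Rightarrow> 'w::real_normed_vector"
  assumes f: "\<And>n. alternating_map k (f n)" and lim: "\<And>vs. (\<lambda>n. f n vs) \<longlonglongrightarrow> g vs"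
  shows "alternating_map k g"
  unfolding alternating_map_def
proof (intro conjI allI impI)
  have zero: "g vs = 0" if "\<And>n. f n vs = 0" for vs
    using LIMSEQ_unique[OF lim[of vs]] that by simp
  show "g vs = 0" if "length vs \<noteq> k" for vs
    by (rule zero) (use alternating_mapD(1)[OF f that] in auto)
  show "g vs = 0" if "length vs = k" "i < j" "j < k" "vs ! i = vs ! j" for vs i j
    by (rule zero) (use alternating_mapD(3)[OF f that] in auto)
  fix vs :: "'a list" and i assume vs: "length vs = k" "i < k"
  note lin = alternating_mapD(2)[OF f vs]
  show "linear (\<lambda>v. g (vs[i := v]))"
  proof (rule linearI)
    fix u v
    have "(\<lambda>n. f n (vs[i := u + v])) \<longlonglongrightarrow> g (vs[i := u]) + g (vs[i := v])"
      unfolding linear_add[OF lin] by (intro tendsto_add lim)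
    then show "g (vs[i := u + v]) = g (vs[i := u]) + g (vs[i := v])" by (rule LIMSEQ_unique[OF lim])
  next
    fix r v
    have "(\<lambda>n. f n (vs[i := r *\<^sub>R v])) \<longlonglongrightarrow> r *\<^sub>R g (vs[i := v])"
      unfolding linear_cmul[OF lin] by (intro tendsto_intros lim)
    then show "g (vs[i := r *\<^sub>R v]) = r *\<^sub>R g (vs[i := v])" by (rule LIMSEQ_unique[OF lim])
  qed
qed

locale connection_domain = star_domain S x0 for S :: "'a::euclidean_space set" and x0 +
  fixes A :: "'a \<Rightarrow> 'a list \<Rightarrow> 'w::euclidean_space \<Rightarrow>\<^sub>L 'w"
  assumes A_C1: "Ck_form 1 1 S A"
begin

lemmas A_form = C1_formD[OF open_S A_C1]

abbreviation iter :: "('a \<Rightarrow> 'a list \<Rightarrow> 'w) \<Rightarrow> nat \<Rightarrow> 'a \<Rightarrow> 'a list \<Rightarrow> 'w" where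
  "iter \<eta> l \<equiv> ((\<lambda>\<omega>. H (wedge A \<omega>)) ^^ l) \<eta>"

lemma volterra_form:
  "continuous_form k S \<omega> \<Longrightarrow> continuous_form k S (H (wedge A \<omega>))"
  by (intro homotopy_form wedge_continuous_form A_form)

lemma iter_form: "continuous_form k S \<eta> \<Longrightarrow> continuous_form k S (iter \<eta> l)"
  by (induction l) (auto intro: volterra_form)

lemma iter_C1: "Ck_form 1 k S \<eta> \<Longrightarrow> Ck_form 1 k S (iter \<eta> l)"
  by (induction l) (auto intro!: homotopy_C1_form wedge_C1_form[OF open_S A_C1] simp del: One_nat_def)

text \<open>
  The weight \<open>\<mu>\<close> is chosen so large that \<open>\<omega> \<mapsto> H (A \<and> \<omega>)\<close> contracts weighted bounds of
  \<open>k\<close>-forms by the factor 1/4 on \<open>K\<close>.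
\<close>

definition admissible :: "'a set \<Rightarrow> nat \<Rightarrow> real \<Rightarrow> real \<Rightarrow> bool" where
  "admissible K k a \<mu> \<longleftrightarrow> star_compact K \<and> a \<ge> 0 \<and> \<mu> > 0 \<and> real (Suc k) * a \<le> \<mu> / 4 \<and>
     (\<forall>x\<in>K. \<forall>v. norm (A x [v]) \<le> a * norm v) \<and>
     (\<forall>x\<in>K. \<forall>u v. norm (coeff_deriv A u x [v]) \<le> a * norm u * norm v)"

lemma admissible_exists:
  assumes K: "star_compact K"
  shows "\<exists>a \<mu>. admissible K k a \<mu>"
proof -
  have K': "compact K" "K \<subseteq> S" using K by (auto simp: star_compact_def)
  obtain a1 where a1: "a1 \<ge> 0" "\<And>x vs. x \<in> K \<Longrightarrow> norm (A x vs) \<le> a1 * norm_prod vs"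
    using form_bounded_on_compact[OF K'(1) continuous_form_subset[OF A_form(1) K'(2)]] by blast
  obtain a2 where a2: "a2 \<ge> 0" "\<And>x v vs. x \<in> K \<Longrightarrow> norm (coeff_deriv A v x vs) \<le> a2 * norm v * norm_prod vs"
    using form_deriv_bounded_on_compact[OF K' open_S A_C1] by blast
  let ?a = "max a1 a2"
  have "norm (A x [v]) \<le> ?a * norm v" if "x \<in> K" for x v
    using a1(2)[OF that, of "[v]"] mult_right_mono[of a1 ?a "norm v"] by simp
  moreover have "norm (coeff_deriv A u x [v]) \<le> ?a * norm u * norm v" if "x \<in> K" for x u v
    using a2(2)[OF that, of u "[v]"] mult_right_mono[of a2 ?a "norm u * norm v"] by (simp add: mult_ac)
  ultimately have "admissible K k ?a (4 * (real (Suc k) * ?a) + 4)"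
    unfolding admissible_def using K a1(1) by (auto intro!: add_nonneg_pos mult_nonneg_nonneg)
  then show ?thesis by blast
qed

lemma volterra_weight_bound:
  fixes \<omega> :: "'a \<Rightarrow> 'a list \<Rightarrow> 'w"
  assumes adm: "admissible K k a \<mu>" and w: "continuous_form k S \<omega>"
    and b: "weight_bound K \<mu> M \<omega>" "M \<ge> 0"
  shows "weight_bound K \<mu> (M / 4) (H (wedge A \<omega>))"
proof -
  have al: "alternating_map k (\<omega> x)" if "x \<in> K" for x
    using continuous_form_alternating[OF w] adm that by (auto simp: admissible_def star_compact_def)
  have "weight_bound K \<mu> (real (Suc k) * a * M) (wedge A \<omega>)"
    by (rule wedge_weight_bound[OF _ al b(1) _ b(2)]) (use adm in \<open>auto simp: admissible_def\<close>)
  then have "weight_bound K \<mu> (real (Suc k) * a * M / \<mu>) (H (wedge A \<omega>))"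
    by (rule homotopy_weight_bound[rotated 2])
       (use adm b(2) wedge_continuous_form[OF A_form(1) w] in \<open>auto simp: admissible_def\<close>)
  moreover have "real (Suc k) * a * M / \<mu> \<le> M / 4"
  proof -
    have "(real (Suc k) * a) * M \<le> (\<mu> / 4) * M"
      using adm b(2) by (intro mult_right_mono) (auto simp: admissible_def)
    then show ?thesis using adm by (auto simp: admissible_def field_simps)
  qed
  ultimately show ?thesis by (rule weight_bound_mono)
qed

lemma volterra_deriv_weight_bound:
  fixes \<omega> :: "'a \<Rightarrow> 'a list \<Rightarrow> 'w"
  assumes adm: "admissible K k a \<mu>" and w: "Ck_form 1 k S \<omega>"
    and b: "weight_bound K \<mu> M \<omega>" "M \<ge> 0"
    and d: "\<And>v. weight_bound K \<mu> (D * norm v) (coeff_deriv \<omega> v)" "D \<ge> 0"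
  shows "weight_bound K \<mu> (((M + D) / 4 + \<mu> / 4 * M) * norm v) (coeff_deriv (H (wedge A \<omega>)) v)"
proof -
  note w' = C1_formD[OF open_S w]
  have KS: "K \<subseteq> S" and a: "a \<ge> 0" and \<mu>: "\<mu> > 0" "real (Suc k) * a \<le> \<mu> / 4" and K: "star_compact K"
    using adm by (auto simp: admissible_def star_compact_def)
  let ?q = "real (Suc k) * a"
  have q: "?q \<ge> 0" using a by simp
  have al: "alternating_map k (\<omega> x)" if "x \<in> K" for x
    using continuous_form_alternating[OF w'(1)] KS that by auto
  have wC: "Ck_form 1 (Suc k) S (wedge A \<omega>)" by (rule wedge_C1_form[OF open_S A_C1 w])
  have 1: "weight_bound K \<mu> (?q * M) (wedge A \<omega>)"
    by (rule wedge_weight_bound[OF _ al b(1) _ b(2)]) (use adm in \<open>auto simp: admissible_def\<close>)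
  have "weight_bound K \<mu> (?q * (D * norm v)) (wedge A (coeff_deriv \<omega> v))"
    by (rule wedge_weight_bound[OF _ _ d(1)])
       (use adm d(2) continuous_form_alternating[OF w'(3)] KS in \<open>auto simp: admissible_def\<close>)
  moreover have "weight_bound K \<mu> (real (Suc k) * (a * norm v) * M) (wedge (coeff_deriv A v) \<omega>)"
  proof (rule wedge_weight_bound[OF _ al b(1) _ b(2)])
    show "norm (coeff_deriv A v x [u]) \<le> a * norm v * norm u" if "x \<in> K" for x u
      using adm that unfolding admissible_def by blast
  qed (use a in auto)
  ultimately have "weight_bound K \<mu> (?q * (D * norm v) + real (Suc k) * (a * norm v) * M) (coeff_deriv (wedge A \<omega>) v)"
    by (rule weight_bound_add)
       (use KS in \<open>auto simp: wedge_coeff_deriv[OF open_S _ A_form(2) w'(2)] wedge_def scaleR_add_right sum.distrib\<close>)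
  then have 2: "weight_bound K \<mu> (?q * (M + D) * norm v) (coeff_deriv (wedge A \<omega>) v)"
    by (rule weight_bound_mono) (simp add: algebra_simps)
  have "weight_bound K \<mu> (?q * (M + D) * norm v / \<mu> + ?q * M * norm v) (coeff_deriv (H (wedge A \<omega>)) v)"
    by (rule homotopy_deriv_weight_bound[OF K wC 1 2 \<mu>(1)]) (use q b(2) d(2) in auto)
  moreover have "?q * (M + D) * norm v / \<mu> + ?q * M * norm v \<le> ((M + D) / 4 + \<mu> / 4 * M) * norm v"
  proof -
    have "?q * ((M + D) * norm v) \<le> \<mu> / 4 * ((M + D) * norm v)"
      using b(2) d(2) \<mu>(2) by (intro mult_right_mono) auto
    then have 1: "?q * (M + D) * norm v / \<mu> \<le> (M + D) / 4 * norm v" using \<mu>(1) by (simp add: field_simps)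
    have "?q * (M * norm v) \<le> \<mu> / 4 * (M * norm v)"
      using b(2) \<mu>(2) by (intro mult_right_mono) auto
    then have 2: "?q * M * norm v \<le> \<mu> / 4 * M * norm v" by (simp only: mult.assoc)
    show ?thesis using add_mono[OF 1 2] by (simp only: distrib_right)
  qed
  ultimately show ?thesis by (rule weight_bound_mono)
qed

lemma iter_weight_bound:
  assumes adm: "admissible K k a \<mu>" and \<eta>: "continuous_form k S \<eta>"
  shows "\<exists>C\<ge>0. \<forall>l. weight_bound K \<mu> (C * (1/4) ^ l) (iter \<eta> l)"
proof -
  have K: "compact K" "K \<subseteq> S" and \<mu>: "\<mu> > 0" using adm by (auto simp: admissible_def star_compact_def)
  obtain C where C: "C \<ge> 0" "\<And>x vs. x \<in> K \<Longrightarrow> norm (\<eta> x vs) \<le> C * norm_prod vs"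
    using form_bounded_on_compact[OF K(1) continuous_form_subset[OF \<eta> K(2)]] by blast
  have "weight_bound K \<mu> (C * (1/4) ^ l) (iter \<eta> l)" for l
  proof (induction l)
    case 0
    show ?case using weight_bound_const[of K \<eta> C \<mu>] C \<mu> by simp
  next
    case (Suc l)
    from volterra_weight_bound[OF adm iter_form[OF \<eta>] this] C(1) show ?case by simp
  qed
  with C(1) show ?thesis by blast
qed

text \<open>
  The rate 1/2 is slower than the rate 1/4 of the iterates, so that the summand which is
  not contracted is absorbed into the constant.
\<close>

lemma iter_deriv_weight_bound:
  assumes adm: "admissible K k a \<mu>" and \<eta>: "Ck_form 1 k S \<eta>"
  shows "\<exists>C\<ge>0. \<forall>l v. weight_bound K \<mu> (C * (1/2) ^ l * norm v) (coeff_deriv (iter \<eta> l) v)"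
proof -
  have K: "compact K" "K \<subseteq> S" and \<mu>: "\<mu> > 0" using adm by (auto simp: admissible_def star_compact_def)
  obtain M where M: "M \<ge> 0" "\<And>l. weight_bound K \<mu> (M * (1/4) ^ l) (iter \<eta> l)"
    using iter_weight_bound[OF adm C1_formD(1)[OF open_S \<eta>]] by blast
  obtain D where D: "D \<ge> 0" "\<And>x v vs. x \<in> K \<Longrightarrow> norm (coeff_deriv \<eta> v x vs) \<le> D * norm v * norm_prod vs"
    using form_deriv_bounded_on_compact[OF K open_S \<eta>] by blast
  define C where "C = D + (1 + \<mu>) * M"
  have C: "C \<ge> 0" "D \<le> C" "(1 + \<mu>) * M \<le> C" using D(1) M(1) \<mu> by (auto simp: C_def)
  have "weight_bound K \<mu> (C * (1/2) ^ l * norm v) (coeff_deriv (iter \<eta> l) v)" for l v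
  proof (induction l arbitrary: v)
    case 0
    have "weight_bound K \<mu> (D * norm v) (coeff_deriv \<eta> v)"
      by (rule weight_bound_const) (use D \<mu> in auto)
    then have "weight_bound K \<mu> (C * norm v) (coeff_deriv \<eta> v)"
      by (rule weight_bound_mono) (intro mult_right_mono C(2) norm_ge_zero)
    then show ?case by simp
  next
    case (Suc l)
    let ?M = "M * (1/4) ^ l" and ?D = "C * (1/2) ^ l"
    have step: "weight_bound K \<mu> (((?M + ?D) / 4 + \<mu> / 4 * ?M) * norm v) (coeff_deriv (H (wedge A (iter \<eta> l))) v)"
      by (rule volterra_deriv_weight_bound[OF adm iter_C1[OF \<eta>] M(2) _ Suc.IH]) (use M(1) C(1) in auto)
    have "(1 + \<mu>) * ?M \<le> C * (1/4) ^ l" using C(3) by (simp add: mult_right_mono mult.assoc[symmetric])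
    also have "\<dots> \<le> ?D" by (intro mult_left_mono power_mono C(1)) auto
    finally have le: "(1 + \<mu>) * ?M \<le> ?D" .
    have "(m + d) / 4 + \<mu> / 4 * m \<le> d / 2" if "(1 + \<mu>) * m \<le> d" for m d :: real
      using that by (simp add: distrib_right add_divide_distrib)
    from this[OF le] have "(?M + ?D) / 4 + \<mu> / 4 * ?M \<le> ?D / 2" .
    then have "((?M + ?D) / 4 + \<mu> / 4 * ?M) * norm v \<le> ?D / 2 * norm v" by (intro mult_right_mono) auto
    from weight_bound_mono[OF step this] show ?case by simp
  qed
  with C(1) show ?thesis by blast
qed

end

context connection_domain
begin

lemma norm_series_term: "norm (series_term x0 A \<eta> l x vs) = norm (iter \<eta> l x vs)"
  by (simp add: series_term_def)

lemma picard_uniform_limit: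
  assumes \<eta>: "continuous_form k S \<eta>" and K: "compact K" "K \<subseteq> S"
  shows "uniform_limit K (\<lambda>N x. \<Sum>l<N. series_term x0 A \<eta> l x vs) (\<lambda>x. series_sum x0 A \<eta> x vs) sequentially"
proof -
  obtain K' where K': "K \<subseteq> K'" "star_compact K'" using star_compact_hull[OF K] by blast
  obtain a \<mu> where adm: "admissible K' k a \<mu>" using admissible_exists[OF K'(2)] by blast
  obtain C where C: "C \<ge> 0" "\<And>l. weight_bound K' \<mu> (C * (1/4) ^ l) (iter \<eta> l)"
    using iter_weight_bound[OF adm \<eta>] by blast
  obtain R where R: "\<And>x. x \<in> K \<Longrightarrow> norm (x - x0) \<le> R"
    using compact_imp_bounded[OF K(1)] bounded_any_center[of K x0] by (metis dist_commute dist_norm)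
  have \<mu>: "\<mu> > 0" using adm by (simp add: admissible_def)
  show ?thesis unfolding series_sum_def
  proof (rule Weierstrass_m_test)
    fix l x assume x: "x \<in> K"
    have "norm (iter \<eta> l x vs) \<le> C * (1/4) ^ l * exp (\<mu> * norm (x - x0)) * norm_prod vs"
      by (rule weight_boundD[OF C(2)]) (use x K' in auto)
    also have "\<dots> \<le> C * (1/4) ^ l * exp (\<mu> * R) * norm_prod vs"
      using R[OF x] \<mu> C(1) by (intro mult_right_mono mult_left_mono) (auto simp: norm_prod_nonneg)
    finally show "norm (series_term x0 A \<eta> l x vs) \<le> (C * exp (\<mu> * R) * norm_prod vs) * (1/4) ^ l"
      by (simp add: norm_series_term mult_ac)
  next
    show "summable (\<lambda>l. (C * exp (\<mu> * R) * norm_prod vs) * (1/4) ^ l)"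
      by (intro summable_mult summable_geometric) auto
  qed
qed

lemma picard_sums:
  assumes "continuous_form k S \<eta>" "x \<in> S"
  shows "(\<lambda>l. series_term x0 A \<eta> l x vs) sums series_sum x0 A \<eta> x vs"
  using tendsto_uniform_limitI[OF picard_uniform_limit[OF assms(1), of "{x}"], of x] assms(2)
  by (simp add: sums_def)

lemma picard_series_converges:
  assumes "continuous_form k S \<eta>" "B \<subseteq> S"
  shows "series_converges x0 A \<eta> B (series_sum x0 A \<eta>)"
  unfolding series_converges_def
  using picard_sums[OF assms(1)] picard_uniform_limit[OF assms(1)] assms(2) by blast

lemma series_term_form: "continuous_form k S \<eta> \<Longrightarrow> continuous_form k S (series_term x0 A \<eta> l)"
  using continuous_form_scaleR[OF iter_form, of k \<eta> "(-1) ^ l" l]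
  by (rule continuous_form_cong) (simp_all add: series_term_def)

lemma partial_sum_form:
  assumes "continuous_form k S \<eta>"
  shows "continuous_form k S (\<lambda>x vs. \<Sum>l<N. series_term x0 A \<eta> l x vs)"
  unfolding Ck_form_def Ck_on.simps
  by (intro conjI ballI allI alternating_sum continuous_on_sum
      continuous_form_alternating[OF series_term_form[OF assms]] continuous_form_coeff[OF series_term_form[OF assms]])

lemma picard_form:
  assumes \<eta>: "continuous_form k S \<eta>"
  shows "continuous_form k S (series_sum x0 A \<eta>)"
  unfolding Ck_form_def Ck_on.simps
proof (intro conjI ballI allI)
  show "alternating_map k (series_sum x0 A \<eta> x)" if x: "x \<in> S" for x
  proof (rule alternating_limit)
    show "alternating_map k (\<lambda>vs. \<Sum>l<n. series_term x0 A \<eta> l x vs)" for n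
      using continuous_form_alternating[OF partial_sum_form[OF \<eta>] x] .
    show "(\<lambda>n. \<Sum>l<n. series_term x0 A \<eta> l x vs) \<longlonglongrightarrow> series_sum x0 A \<eta> x vs" for vs
      using picard_sums[OF \<eta> x] by (simp add: sums_def)
  qed
  show "continuous_on S (\<lambda>x. series_sum x0 A \<eta> x vs)" for vs
  proof (rule continuous_at_imp_continuous_on, rule ballI)
    fix x assume "x \<in> S"
    then obtain e where e: "e > 0" "cball x e \<subseteq> S" using open_S open_contains_cball by blast
    have "continuous_on (cball x e) (\<lambda>x. series_sum x0 A \<eta> x vs)"
      by (rule uniform_limit_theorem[OF _ picard_uniform_limit[OF \<eta> compact_cball e(2)]])
         (intro always_eventually allI continuous_on_subset[OF continuous_form_coeff[OF partial_sum_form[OF \<eta>]] e(2)], simp)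
    then show "isCont (\<lambda>x. series_sum x0 A \<eta> x vs) x"
      by (rule continuous_on_interior) (use e in auto)
  qed
qed

lemma partial_sum_step:
  assumes \<eta>: "continuous_form k S \<eta>" and x: "x \<in> S"
  shows "(\<Sum>l<Suc N. series_term x0 A \<eta> l x ws)
    = \<eta> x ws - H (wedge A (\<lambda>y vs. \<Sum>l<N. series_term x0 A \<eta> l y vs)) x ws"
proof (induction N)
  case 0
  show ?case by (simp add: series_term_def wedge_zero homotopy_cong[of _ "\<lambda>y vs. 0", OF _ x] homotopy_zero)
next
  case (Suc N)
  let ?P = "\<lambda>y vs. \<Sum>l<N. series_term x0 A \<eta> l y vs" and ?T = "series_term x0 A \<eta> N"
  have "H (wedge A (\<lambda>y vs. ?P y vs + ?T y vs)) x ws = H (\<lambda>y vs. wedge A ?P y vs + wedge A ?T y vs) x ws"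
    by (rule homotopy_cong[OF _ x]) (rule wedge_add)
  also have "\<dots> = H (wedge A ?P) x ws + H (wedge A ?T) x ws"
    by (rule homotopy_add[OF wedge_continuous_form[OF A_form(1) partial_sum_form[OF \<eta>]]
          wedge_continuous_form[OF A_form(1) series_term_form[OF \<eta>]] x])
  also have "H (wedge A ?T) x ws = H (\<lambda>y vs. (-1) ^ N *\<^sub>R wedge A (iter \<eta> N) y vs) x ws"
    by (rule homotopy_cong[OF _ x]) (simp add: series_term_def[abs_def] wedge_scaleR)
  also have "\<dots> = - series_term x0 A \<eta> (Suc N) x ws"
    by (simp add: homotopy_scaleR series_term_def)
  finally show ?case using Suc.IH by simp
qed

lemma wedge_tendsto:
  assumes "\<And>vs. (\<lambda>n. f n x vs) \<longlonglongrightarrow> g x vs"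
  shows "(\<lambda>n. wedge A (f n) x vs) \<longlonglongrightarrow> wedge A g x vs"
  unfolding wedge_def by (intro tendsto_intros assms)

text \<open>
  The partial sums satisfy the equation up to a shift of the index; along
  the ray they are dominated by a common integrable function, so the limit may be taken
  under the integral.
\<close>

lemma picard_fixpoint:
  assumes \<eta>: "continuous_form k S \<eta>" and x: "x \<in> S"
  shows "series_sum x0 A \<eta> x ws = \<eta> x ws - H (wedge A (series_sum x0 A \<eta>)) x ws"
proof -
  let ?P = "\<lambda>N y vs. \<Sum>l<N. series_term x0 A \<eta> l y vs" and ?\<phi> = "series_sum x0 A \<eta>"
  obtain K where K: "x \<in> K" "star_compact K" using star_compact_hull[of "{x}"] x by auto
  obtain a \<mu> where adm: "admissible K k a \<mu>" using admissible_exists[OF K(2)] by blast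
  obtain C where C: "C \<ge> 0" "\<And>l. weight_bound K \<mu> (C * (1/4) ^ l) (iter \<eta> l)"
    using iter_weight_bound[OF adm \<eta>] by blast
  have \<mu>: "\<mu> > 0" and a: "a \<ge> 0" and KS: "K \<subseteq> S" using adm by (auto simp: admissible_def star_compact_def)
  have Pb: "weight_bound K \<mu> (2 * C) (?P N)" for N
    unfolding weight_bound_def
  proof (intro ballI allI)
    fix y and vs :: "'a list" assume y: "y \<in> K"
    let ?E = "exp (\<mu> * norm (y - x0)) * norm_prod vs"
    have "norm (?P N y vs) \<le> (\<Sum>l<N. C * (1/4) ^ l * ?E)"
      by (rule sum_norm_le) (use weight_boundD[OF C(2) y] in \<open>simp add: norm_series_term mult.assoc\<close>)
    also have "\<dots> = (\<Sum>l<N. (1/4) ^ l) * (C * ?E)" by (simp add: sum_distrib_right sum_distrib_left mult_ac)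
    also have "(\<Sum>l<N. (1/4) ^ l) \<le> (2 :: real)"
    proof -
      have "(\<Sum>l<N. (1/4) ^ l) = (1 - (1/4) ^ N) / (3/4 :: real)" by (simp add: sum_gp_strict)
      also have "\<dots> \<le> 2"
      proof -
        have le: "(1 - q) / (3/4) \<le> 2" if "q \<ge> 0" for q :: real using that by simp
        show ?thesis by (rule le) simp
      qed
      finally show ?thesis .
    qed
    finally show "norm (?P N y vs) \<le> 2 * C * exp (\<mu> * norm (y - x0)) * norm_prod vs"
      using C(1) norm_prod_nonneg[of vs] by (simp add: mult_right_mono mult.assoc)
  qed
  let ?c = "\<lambda>t. x0 + t *\<^sub>R (x - x0)" and ?r = "norm (x - x0)"
  let ?f = "\<lambda>N t. t ^ length ws *\<^sub>R wedge A (?P N) (?c t) ((x - x0) # ws)"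
  let ?M = "real (Suc k) * a * (2 * C)"
  have wb: "weight_bound K \<mu> ?M (wedge A (?P N))" for N
    by (rule wedge_weight_bound[OF _ continuous_form_alternating[OF partial_sum_form[OF \<eta>]] Pb])
       (use adm C(1) KS in \<open>auto simp: admissible_def\<close>)
  have "(\<lambda>N. integral {0..1} (?f N)) \<longlonglongrightarrow> integral {0..1} (\<lambda>t. t ^ length ws *\<^sub>R wedge A ?\<phi> (?c t) ((x - x0) # ws))"
  proof (rule dominated_convergence(2)[where h = "\<lambda>t. (?M * norm_prod ws) * (?r * exp (\<mu> * (t * ?r)))"])
    show "?f N integrable_on {0..1}" for N
      by (rule homotopy_integrable[OF wedge_continuous_form[OF A_form(1) partial_sum_form[OF \<eta>]] x])
    show "(\<lambda>t. (?M * norm_prod ws) * (?r * exp (\<mu> * (t * ?r)))) integrable_on {0..1}"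
      by (intro integrable_continuous_real continuous_intros)
    fix t :: real assume t: "t \<in> {0..1}"
    then have ct: "?c t \<in> K" using K by (auto simp: star_compact_def)
    show "norm (?f N t) \<le> (?M * norm_prod ws) * (?r * exp (\<mu> * (t * ?r)))" for N
      by (rule ray_integrand_bound[OF t weight_boundD[OF wb ct]])
    show "(\<lambda>N. ?f N t) \<longlonglongrightarrow> t ^ length ws *\<^sub>R wedge A ?\<phi> (?c t) ((x - x0) # ws)"
      using picard_sums[OF \<eta>, of "?c t"] ct KS
      by (intro tendsto_intros wedge_tendsto) (auto simp: sums_def)
  qed
  then have "(\<lambda>N. \<eta> x ws - H (wedge A (?P N)) x ws) \<longlonglongrightarrow> \<eta> x ws - H (wedge A ?\<phi>) x ws"
    unfolding homotopy_op_def by (intro tendsto_intros)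
  moreover have "(\<lambda>N. \<eta> x ws - H (wedge A (?P N)) x ws) \<longlonglongrightarrow> ?\<phi> x ws"
    using LIMSEQ_Suc[OF picard_sums[OF \<eta> x, of ws, unfolded sums_def]] unfolding partial_sum_step[OF \<eta> x] .
  ultimately show ?thesis by (metis LIMSEQ_unique)
qed

text \<open>
  The difference \<open>\<delta>\<close> satisfies \<open>\<delta> = - H (A \<and> \<delta>)\<close>. Any weighted bound for it
  improves by the factor 1/4, hence \<open>\<delta> = 0\<close>.
\<close>

lemma volterra_unique:
  assumes \<phi>: "continuous_form k S \<phi>" "\<And>x vs. x \<in> S \<Longrightarrow> \<phi> x vs = \<eta> x vs - H (wedge A \<phi>) x vs"
    and \<psi>: "continuous_form k S \<psi>" "\<And>x vs. x \<in> S \<Longrightarrow> \<psi> x vs = \<eta> x vs - H (wedge A \<psi>) x vs"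
    and x: "x \<in> S"
  shows "\<phi> x = \<psi> x"
proof
  fix vs :: "'a list"
  define \<delta> where "\<delta> = (\<lambda>y vs. \<phi> y vs - \<psi> y vs)"
  have \<delta>: "continuous_form k S \<delta>" unfolding \<delta>_def by (rule continuous_form_diff[OF \<phi>(1) \<psi>(1)])
  have eq: "\<delta> y ws = - H (wedge A \<delta>) y ws" if y: "y \<in> S" for y ws
  proof -
    have "H (wedge A \<delta>) y ws = H (\<lambda>y vs. wedge A \<phi> y vs - wedge A \<psi> y vs) y ws"
      by (rule homotopy_cong[OF _ y]) (simp add: \<delta>_def wedge_diff)
    also have "\<dots> = H (wedge A \<phi>) y ws - H (wedge A \<psi>) y ws"
      by (rule homotopy_diff[OF wedge_continuous_form[OF A_form(1) \<phi>(1)] wedge_continuous_form[OF A_form(1) \<psi>(1)] y])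
    finally show ?thesis using \<phi>(2)[OF y, of ws] \<psi>(2)[OF y, of ws] by (simp add: \<delta>_def)
  qed
  obtain K where K: "x \<in> K" "star_compact K" using star_compact_hull[of "{x}"] x by auto
  obtain a \<mu> where adm: "admissible K k a \<mu>" using admissible_exists[OF K(2)] by blast
  have KS: "compact K" "K \<subseteq> S" and \<mu>: "\<mu> > 0" using adm by (auto simp: admissible_def star_compact_def)
  obtain C where C: "C \<ge> 0" "\<And>x vs. x \<in> K \<Longrightarrow> norm (\<delta> x vs) \<le> C * norm_prod vs"
    using form_bounded_on_compact[OF KS(1) continuous_form_subset[OF \<delta> KS(2)]] by blast
  have b: "weight_bound K \<mu> (C * (1/4) ^ n) \<delta>" for n
  proof (induction n)
    case 0
    show ?case using weight_bound_const[of K \<delta> C \<mu>] C \<mu> by simp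
  next
    case (Suc n)
    have "weight_bound K \<mu> (C * (1/4) ^ n / 4) (H (wedge A \<delta>))"
      by (rule volterra_weight_bound[OF adm \<delta> Suc.IH]) (use C(1) in auto)
    then show ?case using eq KS(2) by (auto simp: weight_bound_def subset_iff)
  qed
  have "(\<lambda>n. C * (1/4) ^ n * exp (\<mu> * norm (x - x0)) * norm_prod vs) \<longlonglongrightarrow> C * 0 * exp (\<mu> * norm (x - x0)) * norm_prod vs"
    by (intro tendsto_intros LIMSEQ_realpow_zero) auto
  then have "norm (\<delta> x vs) \<le> C * 0 * exp (\<mu> * norm (x - x0)) * norm_prod vs"
    by (rule LIMSEQ_le_const) (use weight_boundD[OF b K(1)] in auto)
  then show "\<phi> x vs = \<psi> x vs" by (simp add: \<delta>_def)
qed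

text \<open>
  The homotopy operator does not turn differentiable forms into differentiable ones, so
  differentiability of the sum cannot be read off from the fixed point equation. It
  comes from the convergence of the differentiated series.
\<close>

lemma picard_differentiable:
  assumes \<eta>: "Ck_form 1 k S \<eta>"
  shows "differentiable_form S (series_sum x0 A \<eta>)"
proof -
  note \<eta>' = C1_formD[OF open_S \<eta>]
  have "\<exists>D. ((\<lambda>y. series_sum x0 A \<eta> y vs) has_derivative D) (at x)" if "x \<in> S" for x vs
  proof -
    obtain e where e: "e > 0" "cball x e \<subseteq> S" using open_S \<open>x \<in> S\<close> open_contains_cball by blast
    obtain K where K: "cball x e \<subseteq> K" "star_compact K" using star_compact_hull[OF compact_cball e(2)] by blast
    obtain a \<mu> where adm: "admissible K k a \<mu>" using admissible_exists[OF K(2)] by blast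
    obtain C where C: "C \<ge> 0" "\<And>l v. weight_bound K \<mu> (C * (1/2) ^ l * norm v) (coeff_deriv (iter \<eta> l) v)"
      using iter_deriv_weight_bound[OF adm \<eta>] by blast
    have \<mu>: "\<mu> > 0" using adm by (simp add: admissible_def)
    obtain R where R: "\<And>y. y \<in> K \<Longrightarrow> norm (y - x0) \<le> R"
      using compact_imp_bounded[of K] bounded_any_center[of K x0] K(2)
      by (metis dist_commute dist_norm star_compact_def)
    have bK: "y \<in> K" "y \<in> S" if "y \<in> ball x e" for y using that K(1) e(2) by auto
    show ?thesis
    proof (rule has_derivative_series_M_test[where S = "ball x e"
          and f' = "\<lambda>l y v. (-1) ^ l *\<^sub>R coeff_deriv (iter \<eta> l) v y vs"])
      fix l y assume y: "y \<in> ball x e"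
      show "((\<lambda>y. series_term x0 A \<eta> l y vs) has_derivative (\<lambda>v. (-1) ^ l *\<^sub>R coeff_deriv (iter \<eta> l) v y vs)) (at y)"
        unfolding series_term_def
        by (rule has_derivative_scaleR_right[OF coeff_has_derivative[OF C1_formD(2)[OF open_S iter_C1[OF \<eta>]] open_S bK(2)[OF y]]])
      fix v
      have "norm (coeff_deriv (iter \<eta> l) v y vs) \<le> C * (1/2) ^ l * norm v * exp (\<mu> * norm (y - x0)) * norm_prod vs"
        by (rule weight_boundD[OF C(2) bK(1)[OF y]])
      also have "\<dots> \<le> C * (1/2) ^ l * norm v * exp (\<mu> * R) * norm_prod vs"
        using R[OF bK(1)[OF y]] \<mu> C(1) by (intro mult_right_mono mult_left_mono) (auto simp: norm_prod_nonneg)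
      finally show "norm ((-1) ^ l *\<^sub>R coeff_deriv (iter \<eta> l) v y vs) \<le> ((C * exp (\<mu> * R) * norm_prod vs) * (1/2) ^ l) * norm v"
        by (simp add: mult_ac)
    next
      show "summable (\<lambda>l. (C * exp (\<mu> * R) * norm_prod vs) * (1/2) ^ l)"
        by (intro summable_mult summable_geometric) auto
      show "(\<lambda>l. series_term x0 A \<eta> l y vs) sums series_sum x0 A \<eta> y vs" if "y \<in> ball x e" for y
        by (rule picard_sums[OF \<eta>'(1) bK(2)[OF that]])
    qed (use e in auto)
  qed
  then show ?thesis
    unfolding differentiable_form_def differentiable_on_def
    by (metis differentiableI differentiable_at_withinI)
qed

end

section \<open>The covariant equation\<close>

lemma ext_deriv_wrong_length:
  assumes S: "open S" "p \<in> S" and w: "differentiable_form S \<omega>" "\<And>y. y \<in> S \<Longrightarrow> alternating_map k (\<omega> y)"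
    and "length vs \<noteq> Suc k"
  shows "ext_deriv \<omega> p vs = 0"
  unfolding ext_deriv_coeff
  by (intro sum.neutral ballI)
     (use assms(5) alternating_mapD(1)[OF coeff_deriv_alternating[OF S w]] in auto)

lemma coeff_deriv_add:
  assumes "open S" "p \<in> S" "differentiable_form S \<omega>" "differentiable_form S \<eta>"
  shows "coeff_deriv (\<lambda>y vs. \<omega> y vs + \<eta> y vs) v p vs = coeff_deriv \<omega> v p vs + coeff_deriv \<eta> v p vs"
  by (rule coeff_deriv_unique[OF has_derivative_add[OF coeff_has_derivative[OF assms(3,1,2)] coeff_has_derivative[OF assms(4,1,2)]]])

lemma coeff_deriv_diff:
  assumes "open S" "p \<in> S" "differentiable_form S \<omega>" "differentiable_form S \<eta>"
  shows "coeff_deriv (\<lambda>y vs. \<omega> y vs - \<eta> y vs) v p vs = coeff_deriv \<omega> v p vs - coeff_deriv \<eta> v p vs"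
  by (rule coeff_deriv_unique[OF has_derivative_diff[OF coeff_has_derivative[OF assms(3,1,2)] coeff_has_derivative[OF assms(4,1,2)]]])

lemma ext_deriv_add:
  assumes "open S" "p \<in> S" "differentiable_form S \<omega>" "differentiable_form S \<eta>"
  shows "ext_deriv (\<lambda>y vs. \<omega> y vs + \<eta> y vs) p vs = ext_deriv \<omega> p vs + ext_deriv \<eta> p vs"
  by (simp add: ext_deriv_coeff coeff_deriv_add[OF assms] scaleR_add_right sum.distrib)

lemma ext_deriv_diff:
  assumes "open S" "p \<in> S" "differentiable_form S \<omega>" "differentiable_form S \<eta>"
  shows "ext_deriv (\<lambda>y vs. \<omega> y vs - \<eta> y vs) p vs = ext_deriv \<omega> p vs - ext_deriv \<eta> p vs"
  by (simp add: ext_deriv_coeff coeff_deriv_diff[OF assms] scaleR_diff_right sum_subtractf)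

lemma differentiable_form_add:
  "differentiable_form S \<omega> \<Longrightarrow> differentiable_form S \<eta> \<Longrightarrow> differentiable_form S (\<lambda>x vs. \<omega> x vs + \<eta> x vs)"
  by (simp add: differentiable_form_def differentiable_on_def)

lemma differentiable_form_diff:
  "differentiable_form S \<omega> \<Longrightarrow> differentiable_form S \<eta> \<Longrightarrow> differentiable_form S (\<lambda>x vs. \<omega> x vs - \<eta> x vs)"
  by (simp add: differentiable_form_def differentiable_on_def)

lemma differentiable_form_zero: "differentiable_form S (\<lambda>x vs. 0)"
  by (simp add: differentiable_form_def)

lemma ext_deriv_zero: "ext_deriv (\<lambda>x vs. 0) p vs = 0"
  by (simp add: ext_deriv_def)

lemma C1_form_subset:
  fixes \<omega> :: "'a::euclidean_space \<Rightarrow> 'a list \<Rightarrow> 'w::real_normed_vector"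
  assumes "open S" "open T" "T \<subseteq> S" "Ck_form 1 k S \<omega>"
  shows "Ck_form 1 k T \<omega>"
  using C1_formD[OF assms(1,4)] assms(3) unfolding C1_form_iff[OF assms(2)]
  by (blast intro: continuous_form_subset differentiable_form_subset)

lemma exact_form_continuous:
  assumes "exact_form k S \<omega>"
  shows "continuous_form k S \<omega>"
proof -
  obtain m \<beta> where "k = Suc m" "d_continuous_form m S \<beta>" "\<And>x. x \<in> S \<Longrightarrow> \<omega> x = ext_deriv \<beta> x"
    using assms by (auto simp: exact_form_def)
  then show ?thesis by (auto simp: d_continuous_form_def intro: continuous_form_cong)
qed

lemma exact_form_closed:
  fixes \<omega> :: "'a::euclidean_space \<Rightarrow> 'a list \<Rightarrow> 'w::banach"
  assumes "exact_form k S \<omega>" "open S" "differentiable_form S \<omega>"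
  shows "closed_form S \<omega>"
proof -
  obtain m \<beta> where "k = Suc m" "d_continuous_form m S \<beta>" "\<And>x. x \<in> S \<Longrightarrow> \<omega> x = ext_deriv \<beta> x"
    using assms(1) by (auto simp: exact_form_def)
  then show ?thesis unfolding closed_form_def
    using ext_deriv_exact_zero[OF assms(2), of m \<beta> \<omega>] assms(3) by auto
qed

lemma closed_form_subset: "closed_form S \<omega> \<Longrightarrow> T \<subseteq> S \<Longrightarrow> closed_form T \<omega>"
  by (auto simp: closed_form_def intro: differentiable_form_subset)

context star_domain
begin

text \<open>
  The homotopy formula without its second summand.
\<close>

lemma closed_form_homotopy:
  fixes \<alpha> :: "'a \<Rightarrow> 'a list \<Rightarrow> 'w::banach"
  assumes a: "continuous_form m S \<alpha>" "m > 0" "closed_form S \<alpha>" and Hd: "differentiable_form S (H \<alpha>)"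
    and p: "p \<in> S"
  shows "ext_deriv (H \<alpha>) p vs = \<alpha> p vs"
proof (cases "length vs = m")
  case True
  have z: "ext_deriv \<alpha> x vs = 0" if "x \<in> S" for x vs using a(3) that by (simp add: closed_form_def)
  have "continuous_form (Suc m) S (ext_deriv \<alpha>)"
    by (rule continuous_form_cong[OF continuous_form_zero]) (rule z)
  then have "d_continuous_form m S \<alpha>" using a by (simp add: d_continuous_form_def closed_form_def)
  from homotopy_formula[OF this a(2) p Hd True]
  have "ext_deriv (H \<alpha>) p vs + H (ext_deriv \<alpha>) p vs = \<alpha> p vs" .
  moreover have "H (ext_deriv \<alpha>) p vs = H (\<lambda>y vs. 0 :: 'w) p vs" by (rule homotopy_cong[OF z p])
  ultimately show ?thesis by (simp add: homotopy_zero)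
next
  case False
  obtain n where m: "m = Suc n" using a(2) by (cases m) auto
  have "ext_deriv (H \<alpha>) p vs = 0"
    by (rule ext_deriv_wrong_length[OF open_S p Hd, of n])
       (use continuous_form_alternating[OF homotopy_form] a(1) False in \<open>auto simp: m\<close>)
  then show ?thesis using alternating_mapD(1)[OF continuous_form_alternating[OF a(1) p] False] by simp
qed

end

context connection_domain
begin

text \<open>
  Insert \<open>d H \<psi> = c\<close> and \<open>d \<psi> = J - A \<and> \<psi>\<close> into the homotopy formula for \<open>\<psi>\<close>.
\<close>

lemma solution_integral_equation:
  assumes k: "k > 0" and J: "continuous_form (Suc k) S J" and c: "continuous_form k S c"
    and sol: "solves_covariant A J k S \<psi>" and dH: "dH_equals x0 c S \<psi>" and x: "x \<in> S"
  shows "\<psi> x vs = (c x vs + H J x vs) - H (wedge A \<psi>) x vs"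
proof -
  have d: "d_continuous_form k S \<psi>" and eq: "\<And>x vs. x \<in> S \<Longrightarrow> ext_deriv \<psi> x vs = J x vs - wedge A \<psi> x vs"
    using sol by (auto simp: solves_covariant_def eq_diff_eq)
  have cw: "continuous_form k S \<psi>" using d by (simp add: d_continuous_form_def)
  show ?thesis
  proof (cases "length vs = k")
    case True
    have "H (ext_deriv \<psi>) x vs = H (\<lambda>y vs. J y vs - wedge A \<psi> y vs) x vs"
      by (rule homotopy_cong[OF eq x])
    also have "\<dots> = H J x vs - H (wedge A \<psi>) x vs"
      by (rule homotopy_diff[OF J wedge_continuous_form[OF A_form(1) cw] x])
    finally have 1: "H (ext_deriv \<psi>) x vs = H J x vs - H (wedge A \<psi>) x vs" .
    have "ext_deriv (H \<psi>) x vs + H (ext_deriv \<psi>) x vs = \<psi> x vs"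
      by (rule homotopy_formula[OF d k x _ True]) (use dH in \<open>simp add: dH_equals_def\<close>)
    moreover have "ext_deriv (H \<psi>) x vs = c x vs" using dH x by (simp add: dH_equals_def)
    ultimately have "\<psi> x vs = c x vs + H (ext_deriv \<psi>) x vs" by simp
    then show ?thesis unfolding 1 by simp
  next
    case False
    have z: "\<omega> x vs = 0" if "continuous_form k S \<omega>" for \<omega> :: "'a \<Rightarrow> 'a list \<Rightarrow> 'w"
      using alternating_mapD(1)[OF continuous_form_alternating[OF that x] False] .
    show ?thesis
      by (simp add: z[OF cw] z[OF c] z[OF homotopy_form[OF J]] z[OF volterra_form[OF cw]])
  qed
qed

text \<open>
  Since \<open>H H = 0\<close>, a solution of the integral equation has \<open>H \<phi> = H c\<close>, and \<open>d H c = c\<close> because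
  \<open>c\<close> is closed. If \<open>A \<and> \<phi>\<close> is closed, then \<open>d H (A \<and> \<phi>) = A \<and> \<phi>\<close>, so applying \<open>d\<close> to the
  integral equation gives \<open>d \<phi> = J - A \<and> \<phi>\<close>. Conversely this equation makes \<open>J - A \<and> \<phi>\<close>
  exact, hence closed, and \<open>J\<close> is closed.
\<close>

lemma volterra_solution_iff:
  assumes k: "k > 0" and c: "Ck_form 1 k S c" "closed_form S c" and J: "Ck_form 1 (Suc k) S J" "closed_form S J"
    and \<phi>: "continuous_form k S \<phi>" "differentiable_form S \<phi>"
      "\<And>x vs. x \<in> S \<Longrightarrow> \<phi> x vs = (c x vs + H J x vs) - H (wedge A \<phi>) x vs"
  shows "dH_equals x0 c S \<phi>" and "solves_covariant A J k S \<phi> \<longleftrightarrow> closed_form S (wedge A \<phi>)"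
proof -
  obtain m where m: "k = Suc m" using k by (cases k) auto
  note c' = C1_formD[OF open_S c(1)] and J' = C1_formD[OF open_S J(1)]
  note HJ = C1_formD[OF open_S homotopy_C1_form[OF J(1)]]
  have wf: "continuous_form (Suc k) S (wedge A \<phi>)" by (rule wedge_continuous_form[OF A_form(1) \<phi>(1)])
  have wd: "differentiable_form S (wedge A \<phi>)" by (rule wedge_differentiable[OF open_S A_form(2) \<phi>(2)])
  have Hc: "Ck_form 1 m S (H c)" using homotopy_C1_form c(1) unfolding m .
  note Hc' = C1_formD[OF open_S Hc]
  have "H \<phi> x ws = H c x ws" if x: "x \<in> S" for x ws
  proof -
    have "H \<phi> x ws = H (\<lambda>y vs. (c y vs + H J y vs) - H (wedge A \<phi>) y vs) x ws"
      by (rule homotopy_cong[OF \<phi>(3) x])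
    also have "\<dots> = H c x ws + H (H J) x ws - H (H (wedge A \<phi>)) x ws"
      using homotopy_diff[OF continuous_form_add[OF c'(1) HJ(1)] volterra_form[OF \<phi>(1)] x, of ws]
        homotopy_add[OF c'(1) HJ(1) x, of ws] by simp
    finally show ?thesis by (simp add: homotopy_homotopy[OF J'(1) x] homotopy_homotopy[OF wf x])
  qed
  note H\<phi> = this
  show "dH_equals x0 c S \<phi>" unfolding dH_equals_def
  proof (intro conjI ballI allI)
    show "differentiable_form S (H \<phi>)" by (rule differentiable_form_cong[OF Hc'(2) H\<phi>])
    fix x vs assume x: "x \<in> S"
    have "ext_deriv (H \<phi>) x vs = ext_deriv (H c) x vs" by (rule ext_deriv_cong[OF open_S x H\<phi>])
    also have "\<dots> = c x vs" by (rule closed_form_homotopy[OF c'(1) k c(2) Hc'(2) x])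
    finally show "ext_deriv (H \<phi>) x vs = c x vs" .
  qed
  show "solves_covariant A J k S \<phi> \<longleftrightarrow> closed_form S (wedge A \<phi>)"
  proof
    assume sol: "solves_covariant A J k S \<phi>"
    have eq: "J x vs - wedge A \<phi> x vs = ext_deriv \<phi> x vs" if "x \<in> S" for x vs
      using sol that by (auto simp: solves_covariant_def algebra_simps)
    have "ext_deriv (\<lambda>x vs. J x vs - wedge A \<phi> x vs) x vs = 0" if x: "x \<in> S" for x vs
      by (rule ext_deriv_exact_zero[OF open_S _ eq differentiable_form_diff[OF J'(2) wd] x])
         (use sol in \<open>auto simp: solves_covariant_def\<close>)
    then have "ext_deriv (wedge A \<phi>) x vs = 0" if x: "x \<in> S" for x vs
      using ext_deriv_diff[OF open_S x J'(2) wd, of vs] J(2) x by (simp add: closed_form_def)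
    with wd show "closed_form S (wedge A \<phi>)" by (simp add: closed_form_def)
  next
    assume cl: "closed_form S (wedge A \<phi>)"
    have Hw: "H (wedge A \<phi>) x vs = (c x vs + H J x vs) - \<phi> x vs" if "x \<in> S" for x vs
      using \<phi>(3)[OF that, of vs] by (simp add: algebra_simps)
    have cHJ: "differentiable_form S (\<lambda>x vs. c x vs + H J x vs)" by (rule differentiable_form_add[OF c'(2) HJ(2)])
    have Hwd: "differentiable_form S (H (wedge A \<phi>))"
      by (rule differentiable_form_cong[OF differentiable_form_diff[OF cHJ \<phi>(2)] Hw])
    have eq: "ext_deriv \<phi> x vs = J x vs - wedge A \<phi> x vs" if x: "x \<in> S" for x vs
    proof -
      have "ext_deriv \<phi> x vs = ext_deriv (\<lambda>x vs. (c x vs + H J x vs) - H (wedge A \<phi>) x vs) x vs"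
        by (rule ext_deriv_cong[OF open_S x \<phi>(3)])
      also have "\<dots> = (ext_deriv c x vs + ext_deriv (H J) x vs) - ext_deriv (H (wedge A \<phi>)) x vs"
        using ext_deriv_diff[OF open_S x cHJ Hwd] ext_deriv_add[OF open_S x c'(2) HJ(2)] by simp
      also have "ext_deriv c x vs = 0" using c(2) x by (simp add: closed_form_def)
      also have "ext_deriv (H J) x vs = J x vs"
        by (rule closed_form_homotopy[OF J'(1) _ J(2) HJ(2) x]) simp
      also have "ext_deriv (H (wedge A \<phi>)) x vs = wedge A \<phi> x vs"
        by (rule closed_form_homotopy[OF wf _ cl Hwd x]) simp
      finally show ?thesis by simp
    qed
    have "continuous_form (Suc k) S (ext_deriv \<phi>)"
      by (rule continuous_form_cong[OF continuous_form_diff[OF J'(1) wf] eq])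
    with \<phi>(1,2) eq show "solves_covariant A J k S \<phi>"
      by (simp add: solves_covariant_def d_continuous_form_def)
  qed
qed

lemma series_sum_in_kernel:
  assumes "in_wedge_kernel A S \<eta>" "x \<in> S"
  shows "series_sum x0 A \<eta> x vs = \<eta> x vs"
proof -
  have 1: "iter \<eta> (Suc l) y ws = 0" if "y \<in> S" for l y ws
    using that
  proof (induction l arbitrary: y ws)
    case 0
    have "H (wedge A \<eta>) y ws = H (\<lambda>y vs. 0 :: 'w) y ws"
      by (rule homotopy_cong[OF _ 0]) (use assms(1) in \<open>auto simp: in_wedge_kernel_def\<close>)
    then show ?case by (simp add: homotopy_zero)
  next
    case (Suc l)
    have "wedge A (iter \<eta> (Suc l)) z us = 0" if "z \<in> S" for z us
      using wedge_cong[of "iter \<eta> (Suc l)" z "\<lambda>x vs. 0" A us, OF Suc.IH[OF that]] by (simp add: wedge_zero)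
    then have "H (wedge A (iter \<eta> (Suc l))) y ws = H (\<lambda>y vs. 0 :: 'w) y ws"
      by (rule homotopy_cong[OF _ Suc.prems])
    then show ?case by (simp add: homotopy_zero)
  qed
  have "series_term x0 A \<eta> l x vs = 0" if "l \<noteq> 0" for l
    using 1[OF assms(2), of "l - 1"] that by (cases l) (simp_all add: series_term_def)
  then have "series_sum x0 A \<eta> x vs = (\<Sum>l\<in>{0}. series_term x0 A \<eta> l x vs)"
    unfolding series_sum_def by (intro suminf_finite) auto
  then show ?thesis by (simp add: series_term_def)
qed

lemma series_sum_add_fixpoint:
  assumes c: "continuous_form k S c" and J: "continuous_form k S \<eta>" and x: "x \<in> S"
  shows "series_sum x0 A c x vs + series_sum x0 A \<eta> x vs
    = (c x vs + \<eta> x vs) - H (wedge A (\<lambda>x vs. series_sum x0 A c x vs + series_sum x0 A \<eta> x vs)) x vs"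
proof -
  have "H (wedge A (\<lambda>x vs. series_sum x0 A c x vs + series_sum x0 A \<eta> x vs)) x vs
      = H (\<lambda>x vs. wedge A (series_sum x0 A c) x vs + wedge A (series_sum x0 A \<eta>) x vs) x vs"
    by (rule homotopy_cong[OF wedge_add x])
  also have "\<dots> = H (wedge A (series_sum x0 A c)) x vs + H (wedge A (series_sum x0 A \<eta>)) x vs"
    by (rule homotopy_add[OF _ _ x]; rule wedge_continuous_form[OF A_form(1) picard_form]) (rule c, rule J)
  finally show ?thesis using picard_fixpoint[OF c x, of vs] picard_fixpoint[OF J x, of vs] by simp
qed

end

theorem theorem2:
  fixes U :: "(real ^ 'n) set" and x0 :: "real ^ 'n" and k :: nat
    and A :: "real ^ 'n \<Rightarrow> (real ^ 'n) list \<Rightarrow> 'v \<Rightarrow>\<^sub>L 'v::euclidean_space"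
    and J c :: "real ^ 'n \<Rightarrow> (real ^ 'n) list \<Rightarrow> 'v"
  assumes U: "open U" "bounded U" "x0 \<in> U" "\<And>x. x \<in> U \<Longrightarrow> closed_segment x0 x \<subseteq> U"
    and k: "k > 0"
    and A: "smooth_form 1 U A" "\<exists>m. \<forall>x\<in>U. dim (range (\<lambda>v. A x [v])) = m"
    and J: "exact_form (Suc k) U J"
    and c: "exact_form k U c" "\<not> in_wedge_kernel A U c"
  shows
    "let HJ = homotopy_op x0 J;
         \<phi>H = series_sum x0 A c;
         \<phi>I = series_sum x0 A HJ;
         \<phi> = (\<lambda>x vs. \<phi>H x vs + \<phi>I x vs);
         solution = (\<lambda>\<psi>. solves_covariant A J k U \<psi> \<and> \<not> in_wedge_kernel A U \<psi> \<and>
                          dH_equals x0 c U \<psi>);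
         hom_solution = (\<lambda>\<psi>. solves_covariant A (\<lambda>_ _. 0) k U \<psi> \<and> dH_equals x0 c U \<psi>)
     in (\<forall>\<psi> \<psi>'. solution \<psi> \<longrightarrow> solution \<psi>' \<longrightarrow> (\<forall>x\<in>U. \<psi> x = \<psi>' x)) \<and>
        (\<forall>r>0. ereal r * (coeff_sup_norm A (cball x0 r \<inter> U) / ereal (real k)) = 1 \<longrightarrow>
          (let B = ball x0 r \<inter> U in
             series_converges x0 A c B \<phi>H \<and> series_converges x0 A HJ B \<phi>I \<and>
             continuous_form k B \<phi>H \<and> continuous_form k B \<phi>I \<and>
             (\<forall>\<psi>. solution \<psi> \<longrightarrow> (\<forall>x\<in>B. \<psi> x = \<phi> x)) \<and>
             (\<forall>\<psi>. hom_solution \<psi> \<longrightarrow> (\<forall>x\<in>B. \<psi> x = \<phi>H x)) \<and>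
             (Ck_form 1 k U c \<longrightarrow>
                dH_equals x0 c B \<phi>H \<and>
                (solves_covariant A (\<lambda>_ _. 0) k B \<phi>H \<longleftrightarrow> closed_form B (wedge A \<phi>H))) \<and>
             (Ck_form 1 k U c \<longrightarrow> Ck_form 1 (Suc k) U J \<longrightarrow>
                dH_equals x0 c B \<phi> \<and>
                (solves_covariant A J k B \<phi> \<longleftrightarrow> closed_form B (wedge A \<phi>))) \<and>
             (antiexact_form x0 k U HJ \<longrightarrow> in_wedge_kernel A U HJ \<longrightarrow>
                (\<forall>x\<in>B. \<phi> x = (\<lambda>vs. \<phi>H x vs + HJ x vs)) \<and>
                (\<forall>\<psi>. solution \<psi> \<longrightarrow> (\<forall>x\<in>B. \<psi> x = (\<lambda>vs. \<phi>H x vs + HJ x vs))))))"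
proof -
  have ray: "x0 + t *\<^sub>R (x - x0) \<in> U" if "x \<in> U" "0 \<le> t" "t \<le> 1" for x t
  proof -
    have "x0 + t *\<^sub>R (x - x0) = (1 - t) *\<^sub>R x0 + t *\<^sub>R x" by (simp add: algebra_simps)
    then have "x0 + t *\<^sub>R (x - x0) \<in> closed_segment x0 x" using that by (auto simp: in_segment)
    then show ?thesis using U(4)[OF that(1)] by blast
  qed
  have A1: "Ck_form 1 1 U A" using A(1) unfolding smooth_form_def by blast
  interpret U: connection_domain U x0 A
    by unfold_locales (use U(1,3) ray A1 in auto)
  have cc: "continuous_form k U c" by (rule exact_form_continuous[OF c(1)])
  have cJ: "continuous_form (Suc k) U J" by (rule exact_form_continuous[OF J])
  let ?HJ = "homotopy_op x0 J"
  have cHJ: "continuous_form k U ?HJ" by (rule U.homotopy_form[OF cJ])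
  let ?\<phi>H = "series_sum x0 A c" and ?\<phi>I = "series_sum x0 A ?HJ"
  let ?\<phi> = "\<lambda>x vs. ?\<phi>H x vs + ?\<phi>I x vs"
  have f\<phi>: "continuous_form k U ?\<phi>" by (rule continuous_form_add[OF U.picard_form[OF cc] U.picard_form[OF cHJ]])
  have H0: "homotopy_op x0 (\<lambda>_ _. 0) x vs = (0 :: 'v)" for x vs by (rule U.homotopy_zero)
  have sol: "\<psi> x = ?\<phi> x" if "solves_covariant A J k U \<psi>" "dH_equals x0 c U \<psi>" "x \<in> U" for \<psi> x
  proof (rule U.volterra_unique[OF _ U.solution_integral_equation[OF k cJ cc that(1,2)] f\<phi> U.series_sum_add_fixpoint[OF cc cHJ] that(3)])
    show "continuous_form k U \<psi>" using that(1) by (simp add: solves_covariant_def d_continuous_form_def)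
  qed
  have hom: "\<psi> x = ?\<phi>H x" if "solves_covariant A (\<lambda>_ _. 0) k U \<psi>" "dH_equals x0 c U \<psi>" "x \<in> U" for \<psi> x
  proof (rule U.volterra_unique[OF _ _ U.picard_form[OF cc] U.picard_fixpoint[OF cc] that(3)])
    show "continuous_form k U \<psi>" using that(1) by (simp add: solves_covariant_def d_continuous_form_def)
    show "\<psi> x vs = c x vs - homotopy_op x0 (wedge A \<psi>) x vs" if "x \<in> U" for x vs
      using U.solution_integral_equation[OF k continuous_form_zero cc \<open>solves_covariant A (\<lambda>_ _. 0) k U \<psi>\<close> \<open>dH_equals x0 c U \<psi>\<close> that, of vs]
      by (simp add: H0)
  qed
  have ker: "?\<phi>I x vs = ?HJ x vs" if "in_wedge_kernel A U ?HJ" "x \<in> U" for x vs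
    using U.series_sum_in_kernel[OF that] .
  {
    fix r :: real assume r: "r > 0"
    let ?B = "ball x0 r \<inter> U"
    have BU: "?B \<subseteq> U" and oB: "open ?B" using U(1) by auto
    have "x0 + t *\<^sub>R (x - x0) \<in> ?B" if "x \<in> ?B" "0 \<le> t" "t \<le> 1" for x t
    proof -
      have "norm (t *\<^sub>R (x - x0)) \<le> norm (x - x0)" using that by (auto intro: mult_left_le_one_le)
      then have "dist x0 (x0 + t *\<^sub>R (x - x0)) < r"
        using that(1) by (simp add: dist_norm norm_minus_commute)
      with ray that show ?thesis by auto
    qed
    then interpret B: connection_domain ?B x0 A
      by unfold_locales (use oB U(3) r C1_form_subset[OF U(1) oB BU A1] in auto)
    have c1: "dH_equals x0 c ?B ?\<phi>H \<and> (solves_covariant A (\<lambda>_ _. 0) k ?B ?\<phi>H \<longleftrightarrow> closed_form ?B (wedge A ?\<phi>H))"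
      if C: "Ck_form 1 k U c"
    proof -
      have cl: "closed_form ?B c"
        by (rule closed_form_subset[OF exact_form_closed[OF c(1) U(1) C1_formD(2)[OF U(1) C]] BU])
      have Z: "Ck_form 1 (Suc k) ?B (\<lambda>_ _. 0 :: 'v)"
        unfolding C1_form_iff[OF oB] coeff_deriv_def
        by (simp add: continuous_form_zero differentiable_form_zero)
      have Zc: "closed_form ?B (\<lambda>_ _. 0 :: 'v)" by (simp add: closed_form_def differentiable_form_zero ext_deriv_zero)
      have eq: "?\<phi>H x vs = (c x vs + homotopy_op x0 (\<lambda>_ _. 0) x vs) - homotopy_op x0 (wedge A ?\<phi>H) x vs" if "x \<in> ?B" for x vs
        using U.picard_fixpoint[OF cc, of x vs] that by (simp add: H0)
      note * = B.volterra_solution_iff[OF k C1_form_subset[OF U(1) oB BU C] cl Z Zc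
          continuous_form_subset[OF U.picard_form[OF cc] BU]
          differentiable_form_subset[OF U.picard_differentiable[OF C] BU] eq]
      show ?thesis using * by blast
    qed
    have c2: "dH_equals x0 c ?B ?\<phi> \<and> (solves_covariant A J k ?B ?\<phi> \<longleftrightarrow> closed_form ?B (wedge A ?\<phi>))"
      if C: "Ck_form 1 k U c" and CJ: "Ck_form 1 (Suc k) U J"
    proof -
      have cl: "closed_form ?B c"
        by (rule closed_form_subset[OF exact_form_closed[OF c(1) U(1) C1_formD(2)[OF U(1) C]] BU])
      have clJ: "closed_form ?B J"
        by (rule closed_form_subset[OF exact_form_closed[OF J U(1) C1_formD(2)[OF U(1) CJ]] BU])
      have d: "differentiable_form U ?\<phi>"
        by (rule differentiable_form_add[OF U.picard_differentiable[OF C] U.picard_differentiable[OF U.homotopy_C1_form[OF CJ]]])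
      have eq: "?\<phi> x vs = (c x vs + ?HJ x vs) - homotopy_op x0 (wedge A ?\<phi>) x vs" if "x \<in> ?B" for x vs
        using U.series_sum_add_fixpoint[OF cc cHJ, of x vs] that by blast
      note * = B.volterra_solution_iff[OF k C1_form_subset[OF U(1) oB BU C] cl C1_form_subset[OF U(1) oB BU CJ] clJ
          continuous_form_subset[OF f\<phi> BU] differentiable_form_subset[OF d BU] eq]
      show ?thesis using * by blast
    qed
    note U.picard_series_converges[OF cc BU] U.picard_series_converges[OF cHJ BU]
      continuous_form_subset[OF U.picard_form[OF cc] BU] continuous_form_subset[OF U.picard_form[OF cHJ] BU] c1 c2
  }
  note local = this
  show ?thesis
    unfolding Let_def
  proof (intro conjI allI impI ballI)
    fix \<psi> \<psi>' x
    assume "solves_covariant A J k U \<psi> \<and> \<not> in_wedge_kernel A U \<psi> \<and> dH_equals x0 c U \<psi>"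
      "solves_covariant A J k U \<psi>' \<and> \<not> in_wedge_kernel A U \<psi>' \<and> dH_equals x0 c U \<psi>'" "x \<in> U"
    then show "\<psi> x = \<psi>' x" using sol[of \<psi> x] sol[of \<psi>' x] by simp
  qed (use local sol hom ker in auto)
qed

end
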